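(* Let $\mathbb{F}$ be a field of characteristic zero, let $I\subset R=\mathbb{F}[x_1,x_2]$ be a height two ideal minimally generated by three homogeneous polynomials of the same degree $d$, let $L_1=\mathcal{F}(g_1)$ and $L_2=\mathcal{F}(g_2)$ be the Fourier transforms of the equations $g_1,g_2$ of the symmetric algebra of $I$, let $Q$ be the left $\mathcal{T}$-module $Q=\mathcal{T}/\mathcal{T}(L_1,L_2)$, and let $\mathcal{K}$ be the kernel of the canonical map $\mathrm{Sym}(I)\to\mathrm{Rees}(I)$. Then there is an isomorphism of graded $U$-modules $$\mathcal{K}\cong \mathrm{H}^0_{\mathrm{dR}}(Q)=\{w\in Q\mid \partial_1\bullet w=0\text{ and }\partial_2\bullet w=0\}.$$ In particular, for any integer $p$ there is an isomorphism of $\mathbb{F}$-vector spaces $$\mathcal{K}_{p,*}\cong \mathrm{H}^0_{\mathrm{dR}}(Q_p)=\{w\in Q_p\mid \partial_1\bullet w=0\text{ and }\partial_2\bullet w=0\}.$$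
   Context: Write $I=(f_1,f_2,f_3)$ with $f_i$ homogeneous of degree $d$. By Hilbert–Burch $I$ has a graded free resolution $0\to R(-d-\mu)\oplus R(-2d+\mu)\xrightarrow{\varphi}R(-d)^3\xrightarrow{[f_1,f_2,f_3]}I\to 0$, where the first column of $\varphi$ has homogeneous entries of degree $\mu$ and the second of degree $d-\mu$ (one may order the columns so that $0<\mu\le d-\mu$). Let $U=\mathbb{F}[T_1,T_2,T_3]$ and $S=R[T_1,T_2,T_3]$, bigraded by $\mathrm{bideg}(T_i)=(1,0)$, $\mathrm{bideg}(x_i)=(0,1)$. Put $[g_1,g_2]=[T_1,T_2,T_3]\cdot\varphi$, so $\mathrm{Sym}(I)\cong S/(g_1,g_2)$ with $\mathrm{bideg}(g_1)=(1,\mu)$, $\mathrm{bideg}(g_2)=(1,d-\mu)$. $\mathrm{Rees}(I)=\bigoplus_{i\ge0}I^it^i$ is the quotient of $S$ via $T_i\mapsto f_it$ (with $\mathrm{bideg}(t)=(1,-d)$). Thus $\mathcal{K}$ is a bigraded $S$-module; $\mathcal{K}_{p,*}=\bigoplus_{q\in\mathbb{Z}}\mathcal{K}_{p,q}$, and $\mathcal{K}$ is regarded as a graded $U$-module with degree $p$ part $\mathcal{K}_{p,*}$. $D=A_2(\mathbb{F})=\mathbb{F}\langle x_1,x_2,\partial_1,\partial_2\rangle$ is the Weyl algebra ($\partial_ix_j=x_j\partial_i+\delta_{ij}$, the $x$'s commute, the $\partial$'s commute), and $\mathcal{T}=D[T_1,T_2,T_3]$ with central variables $T_i$, graded by total degree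 in the $T_i$'s (so $x_i,\partial_i$ have degree $0$). The Fourier transform $\mathcal{F}$ is the automorphism of $\mathcal{T}$ with $\mathcal{F}(x_i)=\partial_i$, $\mathcal{F}(\partial_i)=-x_i$, $\mathcal{F}(T_i)=T_i$. Since $L_1,L_2$ are linear in the $T_i$'s, $Q$ inherits a grading $Q=\bigoplus_pQ_p$, with each $Q_p$ a left $D$-module. The symbol $\bullet$ denotes the left module action. *)

theory Defs
  imports
    "HOL-Library.Poly_Mapping"
    "HOL-Library.Numeral_Type"
    "HOL-Library.Extended_Nat"
    "HOL-Computational_Algebra.Polynomial"
    "HOL-Algebra.QuotRing"
    "HOL-Algebra.Ideal_Product"
    "HOL-Algebra.Generated_Groups"
    "HOL-Algebra.Module"
    "HOL-Analysis.Finite_Cartesian_Product"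
begin

section \<open>Polynomials\<close>

text \<open>
  Polynomials over \<^typ>\<open>'c\<close> in indeterminates indexed by \<^typ>\<open>'v\<close>, with the convolution
  product of \<^theory>\<open>HOL-Library.Poly_Mapping\<close>.  The coefficients need not commute among
  themselves, but they commute with the indeterminates.  In the index type \<open>3\<close> the
  numerals \<open>1, 2, 3\<close> denote the three distinct elements; likewise \<open>1, 2\<close> in the type \<open>2\<close>.
\<close>

type_synonym ('v, 'c) mpoly = "('v \<Rightarrow>\<^sub>0 nat) \<Rightarrow>\<^sub>0 'c"

definition mvar :: "'v \<Rightarrow> ('v, 'c::zero_neq_one) mpoly" where
  "mvar v = Poly_Mapping.single (Poly_Mapping.single v 1) 1"

definition mconst :: "'c::zero \<Rightarrow> ('v, 'c) mpoly" where
  "mconst c = Poly_Mapping.single 0 c"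

definition mdeg :: "('v \<Rightarrow>\<^sub>0 nat) \<Rightarrow> int" where
  "mdeg m = (\<Sum>v\<in>Poly_Mapping.keys m. int (Poly_Mapping.lookup m v))"

definition homogeneous :: "int \<Rightarrow> ('v, 'c::zero) mpoly \<Rightarrow> bool" where
  "homogeneous k p \<longleftrightarrow> (\<forall>m\<in>Poly_Mapping.keys p. mdeg m = k)"

definition mpoly_eval ::
  "('c::zero \<Rightarrow> 'b::comm_semiring_1) \<Rightarrow> ('v \<Rightarrow> 'b) \<Rightarrow> ('v, 'c) mpoly \<Rightarrow> 'b" where
  "mpoly_eval h e p =
    (\<Sum>m\<in>Poly_Mapping.keys p. h (Poly_Mapping.lookup p m) *
      (\<Prod>v\<in>Poly_Mapping.keys m. e v ^ Poly_Mapping.lookup m v))"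

lemma mpoly_sum_single:
  "p = (\<Sum>k\<in>Poly_Mapping.keys p. Poly_Mapping.single k (Poly_Mapping.lookup p k))"
  by (rule poly_mapping_eqI)
    (simp add: lookup_sum lookup_single when_def in_keys_iff)

lemma poly_mapping_additive_induct [case_names zero single add]:
  assumes "P 0" and "\<And>k c. P (Poly_Mapping.single k c)" and "\<And>a b. P a \<Longrightarrow> P b \<Longrightarrow> P (a + b)"
  shows "P (p :: 'k \<Rightarrow>\<^sub>0 'c::comm_monoid_add)"
proof -
  have "P (\<Sum>k\<in>A. Poly_Mapping.single k (Poly_Mapping.lookup p k))" if "finite A" for A
    using that by (induction A rule: finite_induct) (auto intro: assms)
  then show ?thesis
    using mpoly_sum_single[of p] by (metis finite_keys)
qed


section \<open>Rings and ideals\<close>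

definition type_ring :: "'a::ring_1 ring" where
  "type_ring = \<lparr>carrier = UNIV, mult = (*), one = 1, zero = 0, add = (+)\<rparr>"

lemma type_ring_simps [simp]:
  "carrier type_ring = UNIV" "x \<otimes>\<^bsub>type_ring\<^esub> y = x * y" "\<one>\<^bsub>type_ring\<^esub> = 1"
  "\<zero>\<^bsub>type_ring\<^esub> = 0" "x \<oplus>\<^bsub>type_ring\<^esub> y = x + y"
  by (simp_all add: type_ring_def)

lemma ring_type_ring: "ring (type_ring :: 'a::ring_1 ring)"
proof (rule ringI)
  show "abelian_group (type_ring :: 'a ring)"
  proof (rule abelian_groupI)
    fix x :: 'a
    assume "x \<in> carrier type_ring"
    show "\<exists>y\<in>carrier type_ring. y \<oplus>\<^bsub>type_ring\<^esub> x = \<zero>\<^bsub>type_ring\<^esub>"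
      by (rule bexI[of _ "- x"]) simp_all
  qed (simp_all add: add_ac)
  show "Group.monoid (type_ring :: 'a ring)"
    by (rule monoidI) (simp_all add: mult.assoc)
qed (simp_all add: algebra_simps)

lemma cring_type_ring: "cring (type_ring :: 'a::comm_ring_1 ring)"
proof -
  interpret ring "type_ring :: 'a ring" by (rule ring_type_ring)
  show ?thesis
    by unfold_locales (simp add: mult.commute)
qed

lemma a_inv_type_ring [simp]: "\<ominus>\<^bsub>type_ring\<^esub> x = - (x :: 'a::ring_1)"
proof -
  interpret ring "type_ring :: 'a ring" by (rule ring_type_ring)
  show ?thesis
    by (rule minus_equality) simp_all
qed

lemma ideal_type_ringI:
  fixes J :: "'a::ring_1 set"
  assumes "0 \<in> J" "\<And>a b. a \<in> J \<Longrightarrow> b \<in> J \<Longrightarrow> a + b \<in> J"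
    "\<And>a r. a \<in> J \<Longrightarrow> r * a \<in> J" "\<And>a r. a \<in> J \<Longrightarrow> a * r \<in> J"
  shows "ideal J type_ring"
proof (rule idealI[OF ring_type_ring])
  interpret ring "type_ring :: 'a ring" by (rule ring_type_ring)
  show "subgroup J (add_monoid type_ring)"
  proof (rule add.subgroupI)
    fix a
    assume "a \<in> J"
    then show "\<ominus>\<^bsub>type_ring\<^esub> a \<in> J"
      using assms(3)[of a "- 1"] by simp
  qed (use assms in auto)
qed (use assms in auto)

definition prime_height :: "('a, 'm) ring_scheme \<Rightarrow> 'a set \<Rightarrow> enat" where
  "prime_height R P = Sup {enat n | n. \<exists>C :: nat \<Rightarrow> 'a set.
     (\<forall>i\<le>n. primeideal (C i) R) \<and> (\<forall>i<n. C i \<subset> C (Suc i)) \<and> C n = P}"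

definition ideal_height :: "('a, 'm) ring_scheme \<Rightarrow> 'a set \<Rightarrow> enat" where
  "ideal_height R I = Inf {prime_height R P | P. primeideal P R \<and> I \<subseteq> P}"


section \<open>The Weyl algebra\<close>

text \<open>The free monoid, written additively so that it can serve as an exponent type.\<close>

datatype 'g word = Word (letters: "'g list")

instantiation word :: (type) monoid_add
begin

definition "0 = Word []"

definition "v + w = Word (letters v @ letters w)"

instance
  by standard (simp_all add: zero_word_def plus_word_def)

end

type_synonym ('g, 'c) free_alg = "'g word \<Rightarrow>\<^sub>0 'c"

definition fvar :: "'g \<Rightarrow> ('g, 'c::zero_neq_one) free_alg" where
  "fvar g = Poly_Mapping.single (Word [g]) 1"

definition free_eval ::
  "('c::zero \<Rightarrow> 'b::semiring_1) \<Rightarrow> ('g \<Rightarrow> 'b) \<Rightarrow> ('g, 'c) free_alg \<Rightarrow> 'b" where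
  "free_eval h e p =
    (\<Sum>w\<in>Poly_Mapping.keys p. h (Poly_Mapping.lookup p w) * prod_list (map e (letters w)))"

datatype weyl_gen = GX 2 | GD 2

definition weyl_relators :: "(weyl_gen, 'f::comm_ring_1) free_alg set" where
  "weyl_relators =
     {fvar (GX i) * fvar (GX j) - fvar (GX j) * fvar (GX i) | i j. True} \<union>
     {fvar (GD i) * fvar (GD j) - fvar (GD j) * fvar (GD i) | i j. True} \<union>
     {fvar (GD i) * fvar (GX j) - (fvar (GX j) * fvar (GD i) + of_bool (i = j)) | i j. True}"

definition weyl_ideal :: "(weyl_gen, 'f::comm_ring_1) free_alg set" where
  "weyl_ideal = Idl\<^bsub>type_ring\<^esub> weyl_relators"

lemma ideal_weyl_ideal: "ideal (weyl_ideal :: (weyl_gen, 'f::comm_ring_1) free_alg set) type_ring"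
  unfolding weyl_ideal_def by (rule ring.genideal_ideal[OF ring_type_ring]) simp

lemma weyl_ideal_closed:
  fixes a b r :: "(weyl_gen, 'f::comm_ring_1) free_alg"
  shows "0 \<in> (weyl_ideal :: (weyl_gen, 'f) free_alg set)"
    and "a \<in> weyl_ideal \<Longrightarrow> b \<in> weyl_ideal \<Longrightarrow> a + b \<in> weyl_ideal"
    and "a \<in> weyl_ideal \<Longrightarrow> - a \<in> weyl_ideal"
    and "a \<in> weyl_ideal \<Longrightarrow> b \<in> weyl_ideal \<Longrightarrow> a - b \<in> weyl_ideal"
    and "a \<in> weyl_ideal \<Longrightarrow> r * a \<in> weyl_ideal"
    and "a \<in> weyl_ideal \<Longrightarrow> a * r \<in> weyl_ideal"
proof -
  interpret ideal "weyl_ideal :: (weyl_gen, 'f) free_alg set" type_ring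
    by (rule ideal_weyl_ideal)
  show "0 \<in> (weyl_ideal :: (weyl_gen, 'f) free_alg set)"
    using additive_subgroup.zero_closed[OF is_additive_subgroup] by simp
  show "a \<in> weyl_ideal \<Longrightarrow> r * a \<in> weyl_ideal" "a \<in> weyl_ideal \<Longrightarrow> a * r \<in> weyl_ideal"
    using I_l_closed[of a r] I_r_closed[of a r] by simp_all
  have add: "x + y \<in> weyl_ideal" if "x \<in> weyl_ideal" "y \<in> weyl_ideal"
    for x y :: "(weyl_gen, 'f) free_alg"
    using additive_subgroup.a_closed[OF is_additive_subgroup that] by simp
  have neg: "- x \<in> weyl_ideal" if "x \<in> weyl_ideal" for x :: "(weyl_gen, 'f) free_alg"
    using additive_subgroup.a_inv_closed[OF is_additive_subgroup that] by simp
  show "a \<in> weyl_ideal \<Longrightarrow> b \<in> weyl_ideal \<Longrightarrow> a + b \<in> weyl_ideal" by (rule add)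
  show "a \<in> weyl_ideal \<Longrightarrow> - a \<in> weyl_ideal" by (rule neg)
  show "a \<in> weyl_ideal \<Longrightarrow> b \<in> weyl_ideal \<Longrightarrow> a - b \<in> weyl_ideal"
    using add[of a "- b"] neg[of b] by simp
qed

lemma weyl_ideal_relator: "r \<in> weyl_relators \<Longrightarrow> r \<in> weyl_ideal"
  unfolding weyl_ideal_def using ring.genideal_self[OF ring_type_ring] by fastforce

lemma weyl_ideal_minimal:
  "ideal J type_ring \<Longrightarrow> weyl_relators \<subseteq> J \<Longrightarrow> weyl_ideal \<subseteq> J"
  unfolding weyl_ideal_def by (rule ring.genideal_minimal[OF ring_type_ring])

text \<open>
  The Weyl algebra is not the zero ring: it acts on \<open>\<FF>[[x\<^sub>1, x\<^sub>2]]\<close>, represented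
  by coefficient functions.
\<close>

fun weyl_gen_act :: "weyl_gen \<Rightarrow> ((2 \<Rightarrow> nat) \<Rightarrow> 'f::comm_ring_1) \<Rightarrow> (2 \<Rightarrow> nat) \<Rightarrow> 'f" where
  "weyl_gen_act (GX i) v m = (if m i = 0 then 0 else v (m(i := m i - 1)))"
| "weyl_gen_act (GD i) v m = of_nat (m i + 1) * v (m(i := m i + 1))"

definition weyl_word_act ::
  "weyl_gen word \<Rightarrow> ((2 \<Rightarrow> nat) \<Rightarrow> 'f::comm_ring_1) \<Rightarrow> (2 \<Rightarrow> nat) \<Rightarrow> 'f" where
  "weyl_word_act w = foldr weyl_gen_act (letters w)"

definition weyl_act ::
  "(weyl_gen, 'f::comm_ring_1) free_alg \<Rightarrow> ((2 \<Rightarrow> nat) \<Rightarrow> 'f) \<Rightarrow> (2 \<Rightarrow> nat) \<Rightarrow> 'f" where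
  "weyl_act p v m =
    (\<Sum>w\<in>Poly_Mapping.keys p. Poly_Mapping.lookup p w * weyl_word_act w v m)"

lemma weyl_act_sum_superset:
  assumes "finite A" "Poly_Mapping.keys p \<subseteq> A"
  shows "weyl_act p v m = (\<Sum>w\<in>A. Poly_Mapping.lookup p w * weyl_word_act w v m)"
  unfolding weyl_act_def using assms
  by (intro sum.mono_neutral_left) (auto simp: in_keys_iff)

lemma weyl_act_add: "weyl_act (p + q) v = (\<lambda>m. weyl_act p v m + weyl_act q v m)"
proof
  fix m
  let ?A = "Poly_Mapping.keys p \<union> Poly_Mapping.keys q"
  have "finite ?A" "Poly_Mapping.keys (p + q) \<subseteq> ?A"
    by (simp_all add: keys_add)
  then show "weyl_act (p + q) v m = weyl_act p v m + weyl_act q v m"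
    by (simp add: weyl_act_sum_superset[of ?A] lookup_add distrib_right sum.distrib)
qed

lemma weyl_act_zero [simp]: "weyl_act 0 v = (\<lambda>m. 0)"
  by (simp add: weyl_act_def fun_eq_iff)

lemma weyl_act_single: "weyl_act (Poly_Mapping.single w c) v = (\<lambda>m. c * weyl_word_act w v m)"
  by (auto simp: weyl_act_def fun_eq_iff)

lemma weyl_act_uminus: "weyl_act (- p) v = (\<lambda>m. - weyl_act p v m)"
  by (simp add: weyl_act_def fun_eq_iff sum_negf)

lemma weyl_act_diff: "weyl_act (p - q) v = (\<lambda>m. weyl_act p v m - weyl_act q v m)"
  using weyl_act_add[of p "- q" v] by (simp add: weyl_act_uminus)

lemma weyl_word_act_linear:
  "weyl_word_act w (\<lambda>m. u m + v m) = (\<lambda>m. weyl_word_act w u m + weyl_word_act w v m)"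
  "weyl_word_act w (\<lambda>m. c * v m) = (\<lambda>m. c * weyl_word_act w v m)"
proof -
  have gen: "weyl_gen_act g (\<lambda>m. u m + v m) = (\<lambda>m. weyl_gen_act g u m + weyl_gen_act g v m)"
    "weyl_gen_act g (\<lambda>m. c * v m) = (\<lambda>m. c * weyl_gen_act g v m)"
    for g and u v :: "(2 \<Rightarrow> nat) \<Rightarrow> 'a" and c
    by (cases g; simp add: fun_eq_iff algebra_simps)+
  have "foldr weyl_gen_act gs (\<lambda>m. u m + v m) =
      (\<lambda>m. foldr weyl_gen_act gs u m + foldr weyl_gen_act gs v m)"
    "foldr weyl_gen_act gs (\<lambda>m. c * v m) = (\<lambda>m. c * foldr weyl_gen_act gs v m)" for gs
    by (induction gs) (simp_all add: gen)
  then show "weyl_word_act w (\<lambda>m. u m + v m) = (\<lambda>m. weyl_word_act w u m + weyl_word_act w v m)"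
    "weyl_word_act w (\<lambda>m. c * v m) = (\<lambda>m. c * weyl_word_act w v m)"
    by (simp_all add: weyl_word_act_def)
qed

lemma weyl_word_act_zero: "weyl_word_act w (\<lambda>m. 0) = (\<lambda>m. 0)"
  using weyl_word_act_linear(2)[of w 0 "\<lambda>m. 0"] by simp

lemma weyl_act_linear:
  "weyl_act p (\<lambda>m. u m + v m) = (\<lambda>m. weyl_act p u m + weyl_act p v m)"
  by (simp add: weyl_act_def fun_eq_iff weyl_word_act_linear distrib_left sum.distrib)

lemma weyl_act_at_zero: "weyl_act p (\<lambda>m. 0) = (\<lambda>m. 0)"
  by (simp add: weyl_act_def weyl_word_act_zero fun_eq_iff)

lemma weyl_act_mult: "weyl_act (p * q) v = weyl_act p (weyl_act q v)"
proof (induction p rule: poly_mapping_additive_induct)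
  case (single w c)
  show ?case
  proof (induction q rule: poly_mapping_additive_induct)
    case zero
    show ?case by (simp add: weyl_act_at_zero)
  next
    case (single w' c')
    have "weyl_word_act (w + w') v = weyl_word_act w (weyl_word_act w' v)"
      by (simp add: weyl_word_act_def plus_word_def)
    then show ?case
      by (simp add: mult_single weyl_act_single weyl_word_act_linear mult.assoc)
  next
    case (add a b)
    then show ?case by (simp add: distrib_left weyl_act_add weyl_act_linear)
  qed
next
  case (add a b)
  then show ?case by (simp add: distrib_right weyl_act_add)
qed simp

lemma weyl_act_fvar: "weyl_act (fvar g) v = weyl_gen_act g v"
  by (simp add: fvar_def weyl_act_single weyl_word_act_def)

lemma weyl_act_one: "weyl_act 1 v = v"
proof -
  have "weyl_act (Poly_Mapping.single 0 1) v = v"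
    by (simp only: weyl_act_single) (simp add: weyl_word_act_def zero_word_def)
  then show ?thesis by (simp flip: single_one)
qed

lemma weyl_act_ideal: "p \<in> weyl_ideal \<Longrightarrow> weyl_act p v = (\<lambda>m. 0)"
proof -
  let ?J = "{p :: (weyl_gen, 'a) free_alg. \<forall>v. weyl_act p v = (\<lambda>m. 0)}"
  have "ideal ?J type_ring"
    by (rule ideal_type_ringI) (simp_all add: weyl_act_add weyl_act_mult weyl_act_at_zero)
  moreover have "weyl_relators \<subseteq> ?J"
    by (auto simp: weyl_relators_def weyl_act_diff weyl_act_add weyl_act_mult weyl_act_fvar
        weyl_act_one fun_eq_iff fun_upd_twist distrib_right)
      (simp_all add: algebra_simps fun_upd_twist,
        rename_tac j v m, case_tac "m j", simp_all add: algebra_simps fun_upd_idem)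
  ultimately show "p \<in> weyl_ideal \<Longrightarrow> weyl_act p v = (\<lambda>m. 0)"
    using weyl_ideal_minimal[of ?J] by blast
qed

lemma one_not_in_weyl_ideal: "1 \<notin> (weyl_ideal :: (weyl_gen, 'f::comm_ring_1) free_alg set)"
  using weyl_act_ideal[of 1 "\<lambda>m. 1 :: 'f"] by (auto simp: weyl_act_one fun_eq_iff)

definition weyl_rel ::
  "(weyl_gen, 'f::comm_ring_1) free_alg \<Rightarrow> (weyl_gen, 'f) free_alg \<Rightarrow> bool" where
  "weyl_rel a b \<longleftrightarrow> a - b \<in> weyl_ideal"

quotient_type (overloaded) 'f weyl = "(weyl_gen, 'f::comm_ring_1) free_alg" / weyl_rel
proof (rule equivpI)
  show "reflp (weyl_rel :: (weyl_gen, 'f) free_alg \<Rightarrow> _)"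
    by (simp add: reflp_def weyl_rel_def weyl_ideal_closed(1))
  show "symp (weyl_rel :: (weyl_gen, 'f) free_alg \<Rightarrow> _)"
    using weyl_ideal_closed(3) by (fastforce simp: symp_def weyl_rel_def)
  show "transp (weyl_rel :: (weyl_gen, 'f) free_alg \<Rightarrow> _)"
    using weyl_ideal_closed(2) by (fastforce simp: transp_def weyl_rel_def)
qed

instantiation weyl :: (comm_ring_1) ring_1
begin

lift_definition zero_weyl :: "'a weyl" is 0 .

lift_definition one_weyl :: "'a weyl" is 1 .

lift_definition plus_weyl :: "'a weyl \<Rightarrow> 'a weyl \<Rightarrow> 'a weyl" is "(+)"
  unfolding weyl_rel_def
  by (metis add_diff_add weyl_ideal_closed(2))

lift_definition uminus_weyl :: "'a weyl \<Rightarrow> 'a weyl" is uminus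
  unfolding weyl_rel_def
  by (metis minus_diff_minus weyl_ideal_closed(3))

lift_definition minus_weyl :: "'a weyl \<Rightarrow> 'a weyl \<Rightarrow> 'a weyl" is "(-)"
  unfolding weyl_rel_def
proof -
  fix a b c d :: "(weyl_gen, 'a) free_alg"
  assume "a - b \<in> weyl_ideal" "c - d \<in> weyl_ideal"
  then have "(a - b) - (c - d) \<in> weyl_ideal" by (rule weyl_ideal_closed(4))
  then show "a - c - (b - d) \<in> weyl_ideal" by (simp add: algebra_simps)
qed

lift_definition times_weyl :: "'a weyl \<Rightarrow> 'a weyl \<Rightarrow> 'a weyl" is "(*)"
  unfolding weyl_rel_def
proof -
  fix a b c d :: "(weyl_gen, 'a) free_alg"
  assume "a - b \<in> weyl_ideal" "c - d \<in> weyl_ideal"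
  then have "(a - b) * c + b * (c - d) \<in> weyl_ideal"
    by (intro weyl_ideal_closed(2) weyl_ideal_closed(5) weyl_ideal_closed(6))
  then show "a * c - b * d \<in> weyl_ideal" by (simp add: algebra_simps)
qed

instance
proof
  fix a b c :: "'a weyl"
  show "(0 :: 'a weyl) \<noteq> 1"
    by transfer
      (use one_not_in_weyl_ideal weyl_ideal_closed(3) in \<open>fastforce simp: weyl_rel_def\<close>)
qed (transfer; simp add: algebra_simps weyl_rel_def weyl_ideal_closed(1))+

end

lift_definition wx :: "2 \<Rightarrow> 'f::comm_ring_1 weyl" is "\<lambda>i. fvar (GX i)" .

lift_definition wd :: "2 \<Rightarrow> 'f::comm_ring_1 weyl" is "\<lambda>i. fvar (GD i)" .

lift_definition wconst :: "'f \<Rightarrow> 'f::comm_ring_1 weyl" is "Poly_Mapping.single 0" .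

lemma wx_commute: "wx i * wx j = wx j * wx i"
  by transfer (unfold weyl_rel_def, rule weyl_ideal_relator, unfold weyl_relators_def, blast)

lemma wd_commute: "wd i * wd j = wd j * wd i"
  by transfer (unfold weyl_rel_def, rule weyl_ideal_relator, unfold weyl_relators_def, blast)

lemma wd_wx: "wd i * wx j = wx j * wd i + of_bool (i = j)"
proof -
  have "wd i * wx j = wx j * wd i + (abs_weyl (of_bool (i = j)) :: 'a weyl)"
    unfolding wd.abs_eq wx.abs_eq times_weyl.abs_eq plus_weyl.abs_eq weyl.abs_eq_iff weyl_rel_def
    by (rule weyl_ideal_relator, unfold weyl_relators_def) blast
  then show ?thesis by (cases "i = j") (simp_all add: zero_weyl.abs_eq one_weyl.abs_eq)
qed

lemma wconst_simps [simp]: "wconst 0 = 0" "wconst 1 = 1"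
  by (transfer; simp add: weyl_rel_def weyl_ideal_closed(1))+

lemma wconst_add: "wconst (a + b) = wconst a + wconst b"
  by transfer (simp add: weyl_rel_def weyl_ideal_closed(1) single_add)

lemma wconst_mult: "wconst (a * b) = wconst a * wconst b"
  by transfer (simp add: weyl_rel_def weyl_ideal_closed(1) mult_single)

lemma wconst_central: "wconst c * u = u * wconst c"
proof transfer
  fix c :: 'a and u :: "(weyl_gen, 'a) free_alg"
  have "Poly_Mapping.single 0 c * u = u * Poly_Mapping.single 0 c"
    by (induction u rule: poly_mapping_additive_induct)
      (simp_all add: mult_single mult.commute distrib_left distrib_right)
  then show "weyl_rel (Poly_Mapping.single 0 c * u) (u * Poly_Mapping.single 0 c)"
    by (simp add: weyl_rel_def weyl_ideal_closed(1))
qed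


subsection \<open>The Fourier transform\<close>

fun fourier_gen :: "weyl_gen \<Rightarrow> 'f::comm_ring_1 weyl" where
  "fourier_gen (GX i) = wd i"
| "fourier_gen (GD i) = - wx i"

lemma free_eval_add:
  assumes "h 0 = 0" "\<And>a b. h (a + b) = h a + h b"
  shows "free_eval h e (p + q) = free_eval h e p + free_eval h e (q :: ('g, 'c::comm_monoid_add) free_alg)"
proof -
  let ?A = "Poly_Mapping.keys p \<union> Poly_Mapping.keys q"
  have *: "free_eval h e r =
      (\<Sum>w\<in>?A. h (Poly_Mapping.lookup r w) * prod_list (map e (letters w)))"
    if "Poly_Mapping.keys r \<subseteq> ?A" for r
    unfolding free_eval_def using that
    by (intro sum.mono_neutral_left) (auto simp: in_keys_iff assms)
  show ?thesis
    using keys_add[of p q]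
    by (simp add: * lookup_add assms distrib_right sum.distrib)
qed

lemma free_eval_single:
  "h 0 = 0 \<Longrightarrow> free_eval h e (Poly_Mapping.single w c) = h c * prod_list (map e (letters w))"
  by (simp add: free_eval_def)

lemma free_eval_mult:
  fixes p q :: "('g, 'c::comm_semiring_1) free_alg"
  assumes h: "h 0 = 0" "\<And>a b. h (a + b) = h a + h b" "\<And>a b. h (a * b) = h a * h b"
    and central: "\<And>c u. h c * u = u * h c"
  shows "free_eval h e (p * q) = free_eval h e p * free_eval h e q"
proof -
  have zero: "free_eval h e (0 :: ('g, 'c) free_alg) = 0" by (simp add: free_eval_def)
  note add = free_eval_add[of h, OF h(1,2)]
  show ?thesis
  proof (induction p rule: poly_mapping_additive_induct)
    case (single w c)
    show ?case
    proof (induction q rule: poly_mapping_additive_induct)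
      case (single w' c')
      have "h c * h c' * (prod_list (map e (letters w)) * prod_list (map e (letters w'))) =
          h c * prod_list (map e (letters w)) * (h c' * prod_list (map e (letters w')))"
        by (metis central mult.assoc)
      then show ?case
        by (simp add: mult_single free_eval_single h plus_word_def)
    qed (simp_all add: zero add distrib_left)
  qed (simp_all add: zero add distrib_right)
qed

definition fourier_free :: "(weyl_gen, 'f::comm_ring_1) free_alg \<Rightarrow> 'f weyl" where
  "fourier_free = free_eval wconst fourier_gen"

lemma fourier_free_simps:
  fixes a b :: "(weyl_gen, 'f::comm_ring_1) free_alg" and c :: 'f
  shows "fourier_free 0 = (0 :: 'f weyl)" "fourier_free 1 = (1 :: 'f weyl)"
  "fourier_free (a + b) = fourier_free a + fourier_free b"
  "fourier_free (a * b) = fourier_free a * fourier_free b"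
  "fourier_free (- a) = - fourier_free a"
  "fourier_free (a - b) = fourier_free a - fourier_free b"
  "fourier_free (fvar g) = (fourier_gen g :: 'f weyl)"
  "fourier_free (Poly_Mapping.single 0 c) = wconst c"
proof -
  have letters_zero: "letters (0 :: weyl_gen word) = []"
    by (simp add: zero_word_def)
  have single: "fourier_free (Poly_Mapping.single w c) =
      wconst c * prod_list (map fourier_gen (letters w))" for w and c :: 'f
    by (simp add: fourier_free_def free_eval_single)
  show zero: "fourier_free 0 = (0 :: 'f weyl)"
    by (simp add: fourier_free_def free_eval_def)
  show "fourier_free 1 = (1 :: 'f weyl)"
    using single[of 0 1] letters_zero by simp
  show add: "fourier_free (a + b) = fourier_free a + fourier_free b" for a b :: "(_, 'f) free_alg"
    by (simp add: fourier_free_def free_eval_add wconst_add)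
  show "fourier_free (a * b) = fourier_free a * fourier_free b"
    unfolding fourier_free_def
    by (rule free_eval_mult) (rule wconst_simps wconst_add wconst_mult wconst_central)+
  show neg: "fourier_free (- a) = - fourier_free a" for a :: "(_, 'f) free_alg"
    using add[of a "- a"] zero by (simp add: eq_neg_iff_add_eq_0 add.commute)
  show "fourier_free (a - b) = fourier_free a - fourier_free b"
    using add[of a "- b"] neg[of b] by simp
  show "fourier_free (fvar g) = (fourier_gen g :: 'f weyl)"
    by (simp add: fvar_def single)
  show "fourier_free (Poly_Mapping.single 0 c) = wconst c"
    by (simp add: single letters_zero)
qed

lemma fourier_free_ideal: "p \<in> weyl_ideal \<Longrightarrow> fourier_free p = 0"
proof -
  let ?J = "{p :: (weyl_gen, 'a) free_alg. fourier_free p = 0}"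
  have "ideal ?J type_ring"
    by (rule ideal_type_ringI) (simp_all add: fourier_free_simps)
  moreover have "weyl_relators \<subseteq> ?J"
    by (auto simp: weyl_relators_def fourier_free_simps wx_commute wd_commute wd_wx of_bool_def)
  ultimately show "p \<in> weyl_ideal \<Longrightarrow> fourier_free p = 0"
    using weyl_ideal_minimal[of ?J] by blast
qed

lift_definition fourier_weyl :: "'f::comm_ring_1 weyl \<Rightarrow> 'f weyl" is fourier_free
  unfolding weyl_rel_def
  by (metis fourier_free_ideal fourier_free_simps(6) right_minus_eq)

lemma fourier_weyl_simps:
  "fourier_weyl 1 = 1" "fourier_weyl (a + b) = fourier_weyl a + fourier_weyl b"
  "fourier_weyl (a * b) = fourier_weyl a * fourier_weyl b"
  "fourier_weyl (- a) = - fourier_weyl a"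
  "fourier_weyl (wconst c) = wconst c"
  "fourier_weyl (wx i) = wd i" "fourier_weyl (wd i) = - wx i"
  by (transfer; simp add: fourier_free_simps)+

lemma weyl_induct [case_names const x d add mult]:
  assumes c: "\<And>c. P (wconst c)" and x: "\<And>i. P (wx i)" and d: "\<And>i. P (wd i)"
    and add: "\<And>a b. P a \<Longrightarrow> P b \<Longrightarrow> P (a + b)" and mult: "\<And>a b. P a \<Longrightarrow> P b \<Longrightarrow> P (a * b)"
  shows "P (u :: 'f::comm_ring_1 weyl)"
proof -
  have word: "P (abs_weyl (Poly_Mapping.single (Word gs) 1))" for gs
  proof (induction gs)
    case Nil
    show ?case
      using c[of 1] by (simp add: wconst_def zero_word_def)
  next
    case (Cons g gs)
    have "Poly_Mapping.single (Word (g # gs)) (1 :: 'f) = fvar g * Poly_Mapping.single (Word gs) 1"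
      by (simp add: fvar_def mult_single plus_word_def)
    then have "abs_weyl (Poly_Mapping.single (Word (g # gs)) (1 :: 'f)) =
        abs_weyl (fvar g) * abs_weyl (Poly_Mapping.single (Word gs) 1)"
      by (simp add: times_weyl.abs_eq)
    moreover have "P (abs_weyl (fvar g))"
      using x d by (cases g) (simp_all add: wx.abs_eq wd.abs_eq)
    ultimately show ?case
      using Cons.IH by (simp add: mult)
  qed
  have "P (abs_weyl p)" for p
  proof (induction p rule: poly_mapping_additive_induct)
    case zero
    show ?case using c[of 0] by (simp add: zero_weyl.abs_eq)
  next
    case (single w k)
    have "Poly_Mapping.single w k = Poly_Mapping.single 0 k * Poly_Mapping.single w 1"
      by (simp add: mult_single)
    then have "abs_weyl (Poly_Mapping.single w k) =
        wconst k * abs_weyl (Poly_Mapping.single w 1)"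
      by (simp add: times_weyl.abs_eq wconst.abs_eq)
    then show ?case
      using c word[of "letters w"] by (simp add: mult)
  next
    case (add a b)
    then show ?case
      using assms(4) by (simp flip: plus_weyl.abs_eq)
  qed
  then show ?thesis
    by (metis Quotient_weyl Quotient_abs_rep)
qed

lemma fourier_weyl_order_4: "fourier_weyl (fourier_weyl (fourier_weyl (fourier_weyl u))) = u"
  by (induction u rule: weyl_induct) (simp_all add: fourier_weyl_simps)

lemma bij_fourier_weyl: "bij fourier_weyl"
  by (rule o_bij[of "fourier_weyl \<circ> fourier_weyl \<circ> fourier_weyl"])
    (simp_all add: fun_eq_iff fourier_weyl_order_4)

text \<open>The ring \<open>\<T> = D[T\<^sub>1, T\<^sub>2, T\<^sub>3]\<close>; the Fourier transform fixes the \<open>T\<^sub>i\<close>.\<close>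

type_synonym 'f weyl_T = "(3, 'f weyl) mpoly"

definition fourier :: "'f::comm_ring_1 weyl_T \<Rightarrow> 'f weyl_T" where
  "fourier = Poly_Mapping.map fourier_weyl"

text \<open>The inclusions \<open>R \<subseteq> D\<close> and \<open>S = R[T\<^sub>1, T\<^sub>2, T\<^sub>3] \<subseteq> \<T>\<close>.\<close>

definition weyl_of_poly :: "(2, 'f::comm_ring_1) mpoly \<Rightarrow> 'f weyl" where
  "weyl_of_poly p =
    (\<Sum>m\<in>Poly_Mapping.keys p. wconst (Poly_Mapping.lookup p m) *
      (wx 1 ^ Poly_Mapping.lookup m 1 * wx 2 ^ Poly_Mapping.lookup m 2))"

definition weyl_T_of_poly :: "(3, (2, 'f::comm_ring_1) mpoly) mpoly \<Rightarrow> 'f weyl_T" where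
  "weyl_T_of_poly = Poly_Mapping.map weyl_of_poly"


section \<open>Symmetric algebra and Rees algebra of an ideal\<close>

text \<open>
  For an ideal \<open>I\<close> of a commutative ring \<open>R\<close>, the symmetric algebra of the \<open>R\<close>-module \<open>I\<close> is
  \<open>R[e\<^sub>a | a \<in> I]\<close> modulo the relations expressing that \<open>a \<mapsto> e\<^sub>a\<close> is \<open>R\<close>-linear.
\<close>

definition sym_poly_ring :: "'r::comm_ring_1 set \<Rightarrow> ('r, 'r) mpoly ring" where
  "sym_poly_ring I =
    type_ring\<lparr>carrier := {p. \<forall>m\<in>Poly_Mapping.keys p. Poly_Mapping.keys m \<subseteq> I}\<rparr>"

definition sym_relators :: "'r::comm_ring_1 set \<Rightarrow> ('r, 'r) mpoly set" where
  "sym_relators I =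
     {mvar (a + b) - (mvar a + mvar b) | a b. a \<in> I \<and> b \<in> I} \<union>
     {mvar (r * a) - mconst r * mvar a | r a. a \<in> I}"

definition sym_ideal :: "'r::comm_ring_1 set \<Rightarrow> ('r, 'r) mpoly set" where
  "sym_ideal I = Idl\<^bsub>sym_poly_ring I\<^esub> (sym_relators I)"

definition Sym :: "'r::comm_ring_1 set \<Rightarrow> ('r, 'r) mpoly set ring" where
  "Sym I = sym_poly_ring I Quot sym_ideal I"

text \<open>The subring of \<open>R[t]\<close> of all polynomials whose \<open>n\<close>-th coefficient lies in \<open>I\<^sup>n\<close>.\<close>

definition Rees :: "'r::comm_ring_1 set \<Rightarrow> 'r poly ring" where
  "Rees I = type_ring\<lparr>carrier := {p. \<forall>n. coeff p n \<in> I [^]\<^bsub>ideals_set type_ring\<^esub> n}\<rparr>"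

text \<open>The canonical map \<open>e\<^sub>a \<mapsto> a t\<close>.\<close>

definition Sym_to_Rees :: "('r::comm_ring_1, 'r) mpoly set \<Rightarrow> 'r poly" where
  "Sym_to_Rees X = the_elem (mpoly_eval (\<lambda>c. [:c:]) (\<lambda>a. Polynomial.monom a 1) ` X)"

definition Rees_kernel :: "'r::comm_ring_1 set \<Rightarrow> ('r, 'r) mpoly set set" where
  "Rees_kernel I = a_kernel (Sym I) (Rees I) Sym_to_Rees"

text \<open>
  The structure map \<open>S \<rightarrow> Sym(I)\<close>, \<open>T\<^sub>i \<mapsto> e\<^bsub>f\<^sub>i\<^esub>\<close>, for generators \<open>f\<^sub>1, f\<^sub>2, f\<^sub>3\<close> of \<open>I\<close>.  It makes the
  kernel an \<open>S\<close>-module, hence a \<open>U\<close>-module, and induces the bigrading.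
\<close>

definition Sym_presentation ::
  "'r::comm_ring_1 ^ 3 \<Rightarrow> 'r set \<Rightarrow> (3, 'r) mpoly \<Rightarrow> ('r, 'r) mpoly set" where
  "Sym_presentation f I s =
    sym_ideal I +>\<^bsub>sym_poly_ring I\<^esub> mpoly_eval mconst (\<lambda>i. mvar (f $ i)) s"

definition bihomogeneous :: "int \<Rightarrow> int \<Rightarrow> ('w, ('v, 'c::zero) mpoly) mpoly \<Rightarrow> bool" where
  "bihomogeneous p q s \<longleftrightarrow>
    (\<forall>m\<in>Poly_Mapping.keys s. mdeg m = p \<and> homogeneous q (Poly_Mapping.lookup s m))"

definition K_bidegree ::
  "(2, 'f::comm_ring_1) mpoly ^ 3 \<Rightarrow> (2, 'f) mpoly set \<Rightarrow> int \<Rightarrow> int \<Rightarrow>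
    ((2, 'f) mpoly, (2, 'f) mpoly) mpoly set set" where
  "K_bidegree f I p q = Sym_presentation f I ` {s. bihomogeneous p q s} \<inter> Rees_kernel I"

text \<open>\<open>\<K>\<^bsub>p,*\<^esub>\<close>, the sum of all \<open>\<K>\<^bsub>p,q\<^esub>\<close> with \<open>q \<in> \<int>\<close>.\<close>

definition K_degree ::
  "(2, 'f::comm_ring_1) mpoly ^ 3 \<Rightarrow> (2, 'f) mpoly set \<Rightarrow> int \<Rightarrow>
    ((2, 'f) mpoly, (2, 'f) mpoly) mpoly set set" where
  "K_degree f I p = generate (add_monoid (Sym I)) (\<Union>q. K_bidegree f I p q)"

text \<open>\<open>\<K>\<close> as a module over \<open>U = \<FF>[T\<^sub>1, T\<^sub>2, T\<^sub>3]\<close>; the ring fields of the record that are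
  irrelevant for a module are left undefined.\<close>

definition K_module ::
  "(2, 'f::comm_ring_1) mpoly ^ 3 \<Rightarrow> (2, 'f) mpoly set \<Rightarrow>
    ((3, 'f) mpoly, ((2, 'f) mpoly, (2, 'f) mpoly) mpoly set) module" where
  "K_module f I =
    \<lparr>carrier = Rees_kernel I, mult = undefined, one = undefined,
     zero = \<zero>\<^bsub>Sym I\<^esub>, add = add (Sym I),
     smult = (\<lambda>u k. Sym_presentation f I (Poly_Mapping.map mconst u) \<otimes>\<^bsub>Sym I\<^esub> k)\<rparr>"


section \<open>Quotients of \<open>\<T>\<close> and their de Rham cohomology\<close>

definition left_ideal2 :: "'a::ring_1 \<Rightarrow> 'a \<Rightarrow> 'a set" where
  "left_ideal2 a b = {s * a + t * b | s t. True}"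

text \<open>For a left ideal \<open>J\<close> of \<open>\<T>\<close>: the left action of \<open>\<T>\<close> on the cosets of \<open>J\<close>, the quotient
  \<open>\<T>/J\<close>, and its component of degree \<open>p\<close>.\<close>

definition coset_act :: "'a::ring_1 set \<Rightarrow> 'a \<Rightarrow> 'a set \<Rightarrow> 'a set" where
  "coset_act J r w = J <+>\<^bsub>type_ring\<^esub> (r <#\<^bsub>type_ring\<^esub> w)"

definition Q_carrier :: "'f::comm_ring_1 weyl_T set \<Rightarrow> 'f weyl_T set set" where
  "Q_carrier J = a_rcosets\<^bsub>type_ring\<^esub> J"

definition Q_degree :: "'f::comm_ring_1 weyl_T set \<Rightarrow> int \<Rightarrow> 'f weyl_T set set" where
  "Q_degree J p = {J +>\<^bsub>type_ring\<^esub> t | t. homogeneous p t}"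

text \<open>\<open>H\<^sup>0\<^sub>d\<^sub>R(W)\<close> for a \<open>D\<close>-submodule \<open>W\<close> of \<open>\<T>/J\<close>, whose zero element is the coset \<open>J\<close>.\<close>

definition H0_dR :: "'f::comm_ring_1 weyl_T set \<Rightarrow> 'f weyl_T set set \<Rightarrow> 'f weyl_T set set" where
  "H0_dR J W =
    {w \<in> W. coset_act J (mconst (wd 1)) w = J \<and> coset_act J (mconst (wd 2)) w = J}"

definition H0_dR_module ::
  "'f::comm_ring_1 weyl_T set \<Rightarrow> ((3, 'f) mpoly, 'f weyl_T set) module" where
  "H0_dR_module J =
    \<lparr>carrier = H0_dR J (Q_carrier J), mult = undefined, one = undefined,
     zero = J, add = set_add type_ring,
     smult = (\<lambda>u. coset_act J (Poly_Mapping.map wconst u))\<rparr>"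


section \<open>Module isomorphisms\<close>

definition module_iso ::
  "('a, 'k) ring_scheme \<Rightarrow> ('a, 'b, 'm) module_scheme \<Rightarrow> ('a, 'c, 'n) module_scheme \<Rightarrow> ('b \<Rightarrow> 'c) set"
  where
  "module_iso R M N =
    {h. bij_betw h (carrier M) (carrier N) \<and>
      (\<forall>x\<in>carrier M. \<forall>y\<in>carrier M. h (x \<oplus>\<^bsub>M\<^esub> y) = h x \<oplus>\<^bsub>N\<^esub> h y) \<and>
      (\<forall>r\<in>carrier R. \<forall>x\<in>carrier M. h (r \<odot>\<^bsub>M\<^esub> x) = r \<odot>\<^bsub>N\<^esub> h x)}"

text \<open>An \<open>\<FF>\<close>-subspace \<open>W\<close> of a module over a polynomial ring over \<open>\<FF>\<close>, as an \<open>\<FF>\<close>-vector space.\<close>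

definition subspace_module ::
  "(('v, 'f::zero) mpoly, 'b) module \<Rightarrow> 'b set \<Rightarrow> ('f, 'b) module" where
  "subspace_module M W =
    \<lparr>carrier = W, mult = undefined, one = undefined,
     zero = \<zero>\<^bsub>M\<^esub>, add = add M, smult = (\<lambda>c. smult M (mconst c))\<rparr>"


section \<open>Hilbert--Burch resolutions\<close>

text \<open>
  \<open>\<phi>\<close> is a matrix with columns homogeneous of degrees \<open>\<mu>\<close> and \<open>d - \<mu>\<close> such that
  \<open>0 \<rightarrow> R(-d-\<mu>) \<oplus> R(-2d+\<mu>) \<rightarrow> R(-d)\<^sup>3 \<rightarrow> (f\<^sub>1, f\<^sub>2, f\<^sub>3) \<rightarrow> 0\<close> is exact.
\<close>

definition hilbert_burch ::
  "(2, 'f::comm_ring_1) mpoly ^ 3 \<Rightarrow> int \<Rightarrow> int \<Rightarrow> (2, 'f) mpoly ^ 2 ^ 3 \<Rightarrow> bool" where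
  "hilbert_burch f d \<mu> \<phi> \<longleftrightarrow>
    (\<forall>i. homogeneous \<mu> (\<phi> $ i $ 1)) \<and>
    (\<forall>i. homogeneous (d - \<mu>) (\<phi> $ i $ 2)) \<and>
    inj (\<lambda>c. \<phi> *v c) \<and>
    range (\<lambda>c. \<phi> *v c) = {a. (\<Sum>i\<in>UNIV. a $ i * f $ i) = 0}"

text \<open>\<open>[g\<^sub>1, g\<^sub>2] = [T\<^sub>1, T\<^sub>2, T\<^sub>3] \<cdot> \<phi>\<close>\<close>

definition sym_equation ::
  "(2, 'f::comm_ring_1) mpoly ^ 2 ^ 3 \<Rightarrow> 2 \<Rightarrow> (3, (2, 'f) mpoly) mpoly" where
  "sym_equation \<phi> j = (\<Sum>i\<in>UNIV. mvar i * mconst (\<phi> $ i $ j))"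

definition L_operator :: "(2, 'f::comm_ring_1) mpoly ^ 2 ^ 3 \<Rightarrow> 2 \<Rightarrow> 'f weyl_T" where
  "L_operator \<phi> j = fourier (weyl_T_of_poly (sym_equation \<phi> j))"

end

theory Submission
  imports Defs "HOL-Analysis.Cartesian_Space"
begin

text \<open>
  The Weyl algebra has normal forms: every \<open>t \<in> \<T>\<close> is uniquely a finite sum of terms \<open>x\<^sup>a s\<^sub>a(\<partial>,
  T)\<close> with \<open>s\<^sub>a \<in> S\<close>, called the symbol of \<open>t\<close> at \<open>a\<close>. The operators \<open>L\<^sub>1, L\<^sub>2\<close> have constant
  coefficients, and right multiplication by such an operator multiplies each symbol. So \<open>t\<close> lies
  in \<open>J = \<T>(L\<^sub>1, L\<^sub>2)\<close> exactly if all its symbols lie in \<open>G = (g\<^sub>1, g\<^sub>2)\<close> (\<open>in_J_iff\<close>), and \<open>Q\<close>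
  is a direct sum of copies \<open>x\<^sup>a (S/G)\<close> of the symmetric algebra. The product rule shows that
  \<open>\<partial>\<^sub>i\<close> acts on the left by replacing the symbol at \<open>a\<close> by \<open>(a\<^sub>i + 1) s\<^bsub>a + e\<^sub>i\<^esub> + x\<^sub>i s\<^sub>a\<close>.

  Consequently a class in \<open>Q\<close> is killed by \<open>\<partial>\<^sub>1\<close> and \<open>\<partial>\<^sub>2\<close> exactly if \<open>s\<^sub>a = (-x)\<^sup>a / a! \<cdot> s\<^sub>0\<close>
  in \<open>S/G\<close> for all \<open>a\<close>; here characteristic zero is used. Such a class is determined by \<open>s\<^sub>0\<close>
  (\<open>horizontal_in_J_iff\<close>). As only finitely many symbols are nonzero, \<open>s\<^sub>0\<close> is killed by powers
  of the variables (\<open>horizontal_torsion\<close>), and conversely each torsion element arises from a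
  finite sum (\<open>horizontal_lift\<close>). Taking \<open>s\<^sub>0\<close> is thus an isomorphism from \<open>H\<^sup>0\<^sub>d\<^sub>R(Q)\<close> to the
  submodule of \<open>Sym(I)\<close> of elements killed by powers of \<open>x\<^sub>1\<close> and \<open>x\<^sub>2\<close>. It is linear over \<open>U\<close>
  and respects the degree in \<open>T\<close>.

  It remains to see that this torsion is \<open>\<K>\<close> (\<open>rees_eval_zero_iff\<close>). Torsion maps to zero in
  \<open>Rees(I) \<subseteq> R[t]\<close>, and \<open>R[t]\<close> is a domain. In the other direction let \<open>h = \<Sum>\<^sub>i c\<^sub>i f\<^sub>i \<in> I\<close> and
  \<open>T\<^sub>h = \<Sum>\<^sub>i c\<^sub>i T\<^sub>i\<close>. In \<open>Sym(I)\<close> one has \<open>h T\<^sub>i = f\<^sub>i T\<^sub>h\<close>, hence \<open>h\<^sup>p s(T) = s(f) T\<^sub>h\<^sup>p\<close> if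
  \<open>s\<close> has degree \<open>p\<close>; so \<open>h\<^sup>p\<close> kills \<open>s\<close> if \<open>s\<close> maps to zero. This applies to powers of \<open>x\<^sub>1\<close>
  and \<open>x\<^sub>2\<close>, because \<open>I\<close> contains all forms of degree \<open>2 d\<close>: by the resolution, the part of
  degree \<open>2 d\<close> of \<open>R/I\<close> has dimension \<open>(2 d + 1) - 3 (d + 1) + (d - \<mu> + 1) + (\<mu> + 1) = 0\<close>
  (\<open>hilbert_burch_generates\<close>).
\<close>

section \<open>Polynomials as sums of monomials\<close>

lemma lookup_map_zero:
  "f 0 = 0 \<Longrightarrow> Poly_Mapping.lookup (Poly_Mapping.map f p) k = f (Poly_Mapping.lookup p k)"
  by (simp add: map.rep_eq when_def)

lemma map_zero_add:
  assumes "f 0 = 0" "\<And>a b. f (a + b) = f a + f b"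
  shows "Poly_Mapping.map f (p + q) = Poly_Mapping.map f p + Poly_Mapping.map f q"
  by (rule poly_mapping_eqI) (simp add: lookup_map_zero lookup_add assms)

lemma map_zero [simp]: "Poly_Mapping.map f 0 = 0"
  by (simp add: map_eq_zero_iff)

lemma map_id: "Poly_Mapping.map (\<lambda>x. x) p = p"
  by (rule poly_mapping_eqI) (simp add: lookup_map_zero)

lemma map_comp:
  "f 0 = 0 \<Longrightarrow> g 0 = 0 \<Longrightarrow>
    Poly_Mapping.map f (Poly_Mapping.map g p) = Poly_Mapping.map (\<lambda>x. f (g x)) p"
  by (rule poly_mapping_eqI) (simp add: lookup_map_zero)

text \<open>
  One bilinear identity covers all coefficientwise compatibilities below: a ring homomorphism
  applied to coefficients, and a map of coefficients that is linear on one side only over a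
  subring, such as the symbol of an operator.
\<close>

lemma map_semimult:
  fixes f :: "'b::semiring_0 \<Rightarrow> 'c::semiring_0" and p :: "'k::monoid_add \<Rightarrow>\<^sub>0 'd::semiring_0"
    and q :: "'k::monoid_add \<Rightarrow>\<^sub>0 'e::semiring_0"
  assumes 0: "f 0 = 0" "g 0 = 0" "g' 0 = 0" "h 0 = 0" "h' 0 = 0"
    and add: "\<And>a b. f (a + b) = f a + f b" "\<And>a b. g (a + b) = g a + g b"
      "\<And>a b. g' (a + b) = g' a + g' b" "\<And>a b. h (a + b) = h a + h b"
      "\<And>a b. h' (a + b) = h' a + h' b"
    and mult: "\<And>a b. f (g a * g' b) = h a * h' b"
  shows "Poly_Mapping.map f (Poly_Mapping.map g p * Poly_Mapping.map g' q) =
    Poly_Mapping.map h p * Poly_Mapping.map h' q"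
proof (induction p rule: poly_mapping_additive_induct)
  case (single k c)
  show ?case
    by (induction q rule: poly_mapping_additive_induct)
      (simp_all add: mult_single 0 mult map_zero_add add distrib_left)
qed (simp_all add: 0 map_zero_add add distrib_right)

lemma mconst_simps [simp]:
  "mconst 0 = 0" "mconst 1 = 1" "mconst (a + b) = mconst a + mconst b"
  "mconst (- c) = - mconst c" "mconst (c - e) = mconst c - mconst e"
  "mconst (x * y) = mconst x * mconst y"
  by (simp_all add: mconst_def single_add single_uminus single_diff mult_single)

lemma mconst_power [simp]: "mconst (c ^ n) = mconst c ^ n"
  by (induction n) simp_all

lemma mconst_of_nat [simp]: "mconst (of_nat n) = of_nat n"
  by (simp add: mconst_def)

lemma lookup_mconst_mult: "Poly_Mapping.lookup (mconst c * p) k = c * Poly_Mapping.lookup p k"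
  unfolding mconst_def mult_map_scale_conv_mult[symmetric] by (simp add: lookup_map_zero)

lemma mvar_power: "mvar v ^ n = Poly_Mapping.single (Poly_Mapping.single v n) 1"
  by (induction n) (simp_all add: mvar_def mult_single flip: single_add)

text \<open>
  The monomial factor of a term of a polynomial evaluation. It is a monoid homomorphism in the
  exponent.
\<close>

definition mono_eval :: "('v \<Rightarrow> 'b::comm_semiring_1) \<Rightarrow> ('v \<Rightarrow>\<^sub>0 nat) \<Rightarrow> 'b" where
  "mono_eval e m = (\<Prod>v\<in>Poly_Mapping.keys m. e v ^ Poly_Mapping.lookup m v)"

lemma mono_eval_superset:
  "finite A \<Longrightarrow> Poly_Mapping.keys m \<subseteq> A \<Longrightarrow> mono_eval e m = (\<Prod>v\<in>A. e v ^ Poly_Mapping.lookup m v)"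
  unfolding mono_eval_def by (rule prod.mono_neutral_left) (auto simp: in_keys_iff)

lemma mono_eval_zero [simp]: "mono_eval e 0 = 1"
  by (simp add: mono_eval_def)

lemma mono_eval_add: "mono_eval e (m + n) = mono_eval e m * mono_eval e n"
proof -
  let ?A = "Poly_Mapping.keys m \<union> Poly_Mapping.keys n"
  have "mono_eval e k = (\<Prod>v\<in>?A. e v ^ Poly_Mapping.lookup k v)" if "k \<in> {m, n, m + n}" for k
    using that keys_add[of m n] by (intro mono_eval_superset) auto
  then show ?thesis
    by (simp add: lookup_add power_add prod.distrib)
qed

lemma mono_eval_single: "mono_eval e (Poly_Mapping.single v n) = e v ^ n"
  by (cases "n = 0") (simp_all add: mono_eval_def)

lemma mpoly_eval_alt:
  "mpoly_eval h e p = (\<Sum>m\<in>Poly_Mapping.keys p. h (Poly_Mapping.lookup p m) * mono_eval e m)"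
  by (simp add: mpoly_eval_def mono_eval_def)

lemma mpoly_eval_zero [simp]: "mpoly_eval h e 0 = 0"
  by (simp add: mpoly_eval_def)

lemma mpoly_eval_single:
  "h 0 = 0 \<Longrightarrow> mpoly_eval h e (Poly_Mapping.single m c) = h c * mono_eval e m"
  by (simp add: mpoly_eval_alt)

lemma mpoly_eval_mvar: "h 0 = 0 \<Longrightarrow> h 1 = 1 \<Longrightarrow> mpoly_eval h e (mvar v) = e v"
  by (simp add: mvar_def mpoly_eval_single mono_eval_single)

lemma mpoly_eval_mconst: "h 0 = 0 \<Longrightarrow> mpoly_eval h e (mconst c) = h c"
  by (simp add: mconst_def mpoly_eval_single)

lemma mpoly_eval_add:
  fixes p q :: "('v, 'c::comm_monoid_add) mpoly"
  assumes h: "h 0 = 0" "\<And>a b. h (a + b) = h a + h b"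
  shows "mpoly_eval h e (p + q) = mpoly_eval h e p + mpoly_eval h e q"
proof -
  let ?A = "Poly_Mapping.keys p \<union> Poly_Mapping.keys q"
  have *: "mpoly_eval h e r = (\<Sum>m\<in>?A. h (Poly_Mapping.lookup r m) * mono_eval e m)"
    if "Poly_Mapping.keys r \<subseteq> ?A" for r
    unfolding mpoly_eval_alt using that
    by (intro sum.mono_neutral_left) (auto simp: in_keys_iff h)
  show ?thesis
    using keys_add[of p q] by (simp add: * lookup_add h distrib_right sum.distrib)
qed

lemma mpoly_eval_mult:
  fixes p q :: "('v, 'c::comm_semiring_1) mpoly"
  assumes h: "h 0 = 0" "\<And>a b. h (a + b) = h a + h b" "\<And>a b. h (a * b) = h a * h b"
  shows "mpoly_eval h e (p * q) = mpoly_eval h e p * mpoly_eval h e q"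
proof (induction p rule: poly_mapping_additive_induct)
  case (single m c)
  show ?case
    by (induction q rule: poly_mapping_additive_induct)
      (simp_all add: mult_single mpoly_eval_single mono_eval_add h mpoly_eval_add distrib_left distrib_right
        mult_ac)
qed (simp_all add: mpoly_eval_add h distrib_right)

lemma mpoly_eval_mconst_mvar:
  fixes p :: "('v, 'c::comm_semiring_1) mpoly"
  shows "mpoly_eval mconst mvar p = p"
proof (induction p rule: poly_mapping_additive_induct)
  case (single k c)
  have "mono_eval mvar k = Poly_Mapping.single k (1 :: 'c)"
  proof (induction k rule: poly_mapping_additive_induct)
    case (add a b)
    then show ?case by (simp add: mono_eval_add mult_single)
  qed (simp_all add: mono_eval_single mvar_power)
  then show ?case
    by (simp add: mpoly_eval_single mconst_def mult_single)
qed (simp_all add: mpoly_eval_add)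

text \<open>
  Two ring homomorphisms that agree on constants and on the variables in \<open>V\<close> agree on every
  polynomial in these variables; this induction rule is the form in which that is used. The
  restriction to \<open>V\<close> is there for the polynomial ring whose variables are the elements of an
  ideal.
\<close>

lemma mpoly_induct_on:
  fixes p :: "('v, 'c::comm_ring_1) mpoly"
  assumes vars: "\<And>m. m \<in> Poly_Mapping.keys p \<Longrightarrow> Poly_Mapping.keys m \<subseteq> V"
    and const: "\<And>c. P (mconst c)" and var: "\<And>v. v \<in> V \<Longrightarrow> P (mvar v)"
    and add: "\<And>p q. P p \<Longrightarrow> P q \<Longrightarrow> P (p + q)" and mult: "\<And>p q. P p \<Longrightarrow> P q \<Longrightarrow> P (p * q)"
  shows "P p"
proof -
  have P01: "P 0" "P 1"
    using const[of 0] const[of 1] by simp_all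
  have pow: "P (mvar v ^ n)" if "v \<in> V" for v n
    by (induction n) (use that P01 var mult in auto)
  have mono: "P (\<Prod>v\<in>A. mvar v ^ n v)" if "finite A" "A \<subseteq> V" for A n
    using that by (induction A rule: finite_induct) (auto intro: P01 pow mult)
  have "P (\<Sum>m\<in>B. mconst (Poly_Mapping.lookup p m) * mono_eval mvar m)"
    if "finite B" "B \<subseteq> Poly_Mapping.keys p" for B
    using that unfolding mono_eval_def
    by (induction B rule: finite_induct) (auto intro!: P01 add mult const mono dest: vars)
  then have "P (mpoly_eval mconst mvar p)"
    by (simp add: mpoly_eval_alt)
  then show ?thesis
    by (simp add: mpoly_eval_mconst_mvar)
qed

lemma mpoly_induct [case_names const var add mult]:
  fixes p :: "('v, 'c::comm_ring_1) mpoly"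
  assumes "\<And>c. P (mconst c)" "\<And>v. P (mvar v)"
    "\<And>p q. P p \<Longrightarrow> P q \<Longrightarrow> P (p + q)" "\<And>p q. P p \<Longrightarrow> P q \<Longrightarrow> P (p * q)"
  shows "P p"
  using mpoly_induct_on[of p UNIV P] assms by blast

lemma mdeg_superset:
  "finite A \<Longrightarrow> Poly_Mapping.keys m \<subseteq> A \<Longrightarrow> mdeg m = (\<Sum>v\<in>A. int (Poly_Mapping.lookup m v))"
  unfolding mdeg_def by (rule sum.mono_neutral_left) (auto simp: in_keys_iff)

lemma mdeg_zero [simp]: "mdeg 0 = 0"
  by (simp add: mdeg_def)

lemma mdeg_nonneg [simp]: "0 \<le> mdeg m"
  by (simp add: mdeg_def sum_nonneg)

lemma mdeg_single [simp]: "mdeg (Poly_Mapping.single v n) = int n"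
  by (cases "n = 0") (simp_all add: mdeg_def)

lemma mdeg_add: "mdeg (m + n) = mdeg m + mdeg n"
proof -
  let ?A = "Poly_Mapping.keys m \<union> Poly_Mapping.keys n"
  have "mdeg k = (\<Sum>v\<in>?A. int (Poly_Mapping.lookup k v))" if "k \<in> {m, n, m + n}" for k
    using that keys_add[of m n] by (intro mdeg_superset) auto
  then show ?thesis
    by (simp add: lookup_add sum.distrib)
qed

lemma homogeneous_zero [simp]: "homogeneous k 0"
  by (simp add: homogeneous_def)

lemma homogeneous_add: "homogeneous k p \<Longrightarrow> homogeneous k q \<Longrightarrow> homogeneous k (p + q)"
  using keys_add[of p q] by (auto simp: homogeneous_def)

lemma homogeneous_sum: "(\<And>x. x \<in> A \<Longrightarrow> homogeneous k (f x)) \<Longrightarrow> homogeneous k (sum f A)"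
  by (induction A rule: infinite_finite_induct) (auto intro: homogeneous_add)

lemma homogeneous_mult: "homogeneous j p \<Longrightarrow> homogeneous k q \<Longrightarrow> homogeneous (j + k) (p * q)"
  using keys_mult[of p q] by (fastforce simp: homogeneous_def mdeg_add)

lemma homogeneous_mconst: "homogeneous 0 (mconst c)"
  by (auto simp: homogeneous_def mconst_def split: if_splits)

lemma homogeneous_mconst_mult: "homogeneous k p \<Longrightarrow> homogeneous k (mconst c * p)"
  using homogeneous_mult[OF homogeneous_mconst, of k p c] by simp

lemma homogeneous_map: "homogeneous k p \<Longrightarrow> homogeneous k (Poly_Mapping.map f p)"
  by (auto simp: homogeneous_def in_keys_iff map.rep_eq)

lemma homogeneous_one: "homogeneous 0 1"
  by (simp add: homogeneous_def)

lemma homogeneous_power: "homogeneous k p \<Longrightarrow> homogeneous (int n * k) (p ^ n)"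
proof (induction n)
  case (Suc n)
  then show ?case
    using homogeneous_mult[of k p "int n * k" "p ^ n"] by (simp add: algebra_simps)
qed (simp add: homogeneous_one)

lemma homogeneous_mono_eval:
  assumes "\<And>v. homogeneous k (e v)"
  shows "homogeneous (mdeg m * k) (mono_eval e m)"
proof (induction m rule: poly_mapping_additive_induct)
  case (add a b)
  then show ?case
    using homogeneous_mult by (fastforce simp: mono_eval_add mdeg_add distrib_right)
qed (simp_all add: mono_eval_single homogeneous_power homogeneous_one assms)

definition hom_component :: "int \<Rightarrow> ('v, 'c::comm_monoid_add) mpoly \<Rightarrow> ('v, 'c) mpoly" where
  "hom_component k p = Poly_Mapping.mapp (\<lambda>m c. c when mdeg m = k) p"

lemma lookup_hom_component: "Poly_Mapping.lookup (hom_component k p) m = (Poly_Mapping.lookup p m when mdeg m = k)"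
  by (auto simp: hom_component_def lookup_mapp when_def in_keys_iff)

lemma hom_component_add: "hom_component k (p + q) = hom_component k p + hom_component k q"
  by (rule poly_mapping_eqI) (simp add: lookup_hom_component lookup_add when_add_distrib)

lemma hom_component_zero [simp]: "hom_component k 0 = 0"
  by (rule poly_mapping_eqI) (simp add: lookup_hom_component)

lemma hom_component_sum: "hom_component k (sum f A) = (\<Sum>x\<in>A. hom_component k (f x))"
  by (induction A rule: infinite_finite_induct) (simp_all add: hom_component_add)

lemma hom_component_single:
  "hom_component k (Poly_Mapping.single m c) = (Poly_Mapping.single m c when mdeg m = k)"
  by (rule poly_mapping_eqI) (auto simp: lookup_hom_component lookup_single when_def)

lemma homogeneous_hom_component: "homogeneous k (hom_component k p)"
  by (auto simp: homogeneous_def in_keys_iff lookup_hom_component)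

lemma hom_component_homogeneous: "homogeneous k p \<Longrightarrow> hom_component k p = p"
  by (rule poly_mapping_eqI) (auto simp: homogeneous_def in_keys_iff lookup_hom_component when_def)

lemma hom_component_mult_homogeneous:
  fixes p q :: "('v, 'c::comm_semiring_1) mpoly"
  assumes q: "homogeneous j q"
  shows "hom_component (k + j) (p * q) = hom_component k p * q"
proof (induction p rule: poly_mapping_additive_induct)
  case (single m c)
  have "hom_component (k + j) (Poly_Mapping.single m c * (\<Sum>n\<in>N. Poly_Mapping.single n (b n))) =
      hom_component k (Poly_Mapping.single m c) * (\<Sum>n\<in>N. Poly_Mapping.single n (b n))"
    if "N \<subseteq> Poly_Mapping.keys q" for N b
    using q that
    by (auto simp: sum_distrib_left hom_component_sum hom_component_single mult_single mdeg_add homogeneous_def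
        when_def subset_iff intro!: sum.cong)
  from this[OF order_refl, of "Poly_Mapping.lookup q"] show ?case
    by (simp flip: mpoly_sum_single)
qed (simp_all add: hom_component_add distrib_right)

section \<open>Symbols of operators in the Weyl algebra\<close>

subsection \<open>The commutative subring of differential operators with constant coefficients\<close>

lemma wconst_of_nat: "wconst (of_nat n) = of_nat n"
  by (induction n) (simp_all add: wconst_add)

lemma wconst_left_commute: "u * (wconst c * v) = wconst c * (u * v)"
  by (simp add: wconst_central[of c u] flip: mult.assoc)

lemma fourier_weyl_zero [simp]: "fourier_weyl 0 = 0"
  using fourier_weyl_simps(2)[of 0 0] by simp

lemma fourier_weyl_sum: "fourier_weyl (sum f A) = (\<Sum>x\<in>A. fourier_weyl (f x))"
  by (induction A rule: infinite_finite_induct) (simp_all add: fourier_weyl_simps)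

lemma fourier_weyl_power: "fourier_weyl (u ^ n) = fourier_weyl u ^ n"
  by (induction n) (simp_all add: fourier_weyl_simps)

text \<open>The operator with constant coefficients \<open>r(\<partial>\<^sub>1, \<partial>\<^sub>2)\<close>; as a map it is a ring homomorphism from \<open>R\<close> to \<open>D\<close>.\<close>

definition dop :: "(2, 'f::comm_ring_1) mpoly \<Rightarrow> 'f weyl" where
  "dop r = fourier_weyl (weyl_of_poly r)"

definition wd_mono :: "(2 \<Rightarrow>\<^sub>0 nat) \<Rightarrow> 'f::comm_ring_1 weyl" where
  "wd_mono m = wd 1 ^ Poly_Mapping.lookup m 1 * wd 2 ^ Poly_Mapping.lookup m 2"

lemma dop_alt:
  "dop p = (\<Sum>m\<in>Poly_Mapping.keys p. wconst (Poly_Mapping.lookup p m) * wd_mono m)"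
  by (simp add: dop_def weyl_of_poly_def fourier_weyl_sum fourier_weyl_simps fourier_weyl_power
      wd_mono_def)

lemma dop_zero [simp]: "dop 0 = 0"
  by (simp add: dop_alt)

lemma dop_single: "dop (Poly_Mapping.single m c) = wconst c * wd_mono m"
  by (simp add: dop_alt)

lemma dop_add: "dop (p + q) = dop p + dop q"
proof -
  let ?A = "Poly_Mapping.keys p \<union> Poly_Mapping.keys q"
  have *: "dop r = (\<Sum>m\<in>?A. wconst (Poly_Mapping.lookup r m) * wd_mono m)"
    if "Poly_Mapping.keys r \<subseteq> ?A" for r :: "(2, 'a) mpoly"
    unfolding dop_alt using that by (intro sum.mono_neutral_left) (auto simp: in_keys_iff)
  show ?thesis
    using keys_add[of p q] by (simp add: * lookup_add wconst_add distrib_right sum.distrib)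
qed

lemma wd_power_commute: "wd i ^ m * wd j ^ n = wd j ^ n * wd i ^ m"
proof -
  have "wd i * wd j ^ n = wd j ^ n * wd i" for n
    by (rule power_commuting_commutes[OF wd_commute, symmetric])
  then show ?thesis
    by (rule power_commuting_commutes)
qed

lemma dop_mult: "dop (p * q) = dop p * dop q"
proof (induction p rule: poly_mapping_additive_induct)
  case (single k c)
  show ?case
  proof (induction q rule: poly_mapping_additive_induct)
    case (single l e)
    have "wd_mono (k + l) = wd_mono k * (wd_mono l :: 'a weyl)"
    proof -
      have "wd 1 ^ b * (wd 2 ^ c * x) = wd 2 ^ c * (wd 1 ^ b * (x :: 'a weyl))" for b c x
        unfolding mult.assoc[symmetric] by (subst wd_power_commute) (rule refl)
      then show ?thesis
        by (simp add: wd_mono_def lookup_add power_add mult.assoc)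
    qed
    then show ?case
      by (simp add: mult_single dop_single wconst_mult mult.assoc
          wconst_left_commute[of "wd_mono k" e])
  qed (simp_all add: dop_add distrib_left)
qed (simp_all add: dop_add distrib_right)

lemma dop_mconst [simp]: "dop (mconst c) = wconst c"
  by (simp add: mconst_def dop_single wd_mono_def)

lemma dop_of_nat: "dop (of_nat n) = of_nat n"
  using dop_mconst[of "of_nat n"] by (simp only: mconst_of_nat wconst_of_nat)

lemma dop_mvar [simp]: "dop (mvar i) = wd i"
proof -
  have "i = 1 \<or> i = 2" using exhaust_2 by blast
  then show ?thesis
    by (auto simp: mvar_def dop_single wd_mono_def lookup_single)
qed

subsection \<open>The symbol and the action of the generators on it\<close>

lift_definition wact :: "'r::comm_ring_1 weyl \<Rightarrow> ((2 \<Rightarrow> nat) \<Rightarrow> 'r) \<Rightarrow> (2 \<Rightarrow> nat) \<Rightarrow> 'r" is weyl_act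
proof -
  fix p q :: "(weyl_gen, 'r) free_alg"
  assume "weyl_rel p q"
  then have "(\<lambda>m. weyl_act p v m - weyl_act q v m) = (\<lambda>m. 0)" for v
    using weyl_act_ideal[of "p - q" v] by (simp add: weyl_rel_def weyl_act_diff)
  then show "weyl_act p = weyl_act q"
    by (simp add: fun_eq_iff)
qed

lemma wact_simps:
  "wact 0 v = (\<lambda>m. 0)" "wact 1 v = v" "wact (u + u') v = (\<lambda>m. wact u v m + wact u' v m)"
  "wact (u * u') v = wact u (wact u' v)" "wact (wconst c) v = (\<lambda>m. c * v m)"
  "wact (wx i) v = (\<lambda>m. if m i = 0 then 0 else v (m(i := m i - 1)))"
  "wact (wd i) v = (\<lambda>m. of_nat (m i + 1) * v (m(i := m i + 1)))"
  by (transfer; simp add: weyl_act_one weyl_act_add weyl_act_mult weyl_act_single weyl_act_fvar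
      weyl_word_act_def zero_word_def fun_eq_iff)+

lemma wact_scale: "wact u (\<lambda>m. c * v m) = (\<lambda>m. c * wact u v m)"
proof -
  have "wact u (wact (wconst c) v) = wact (wconst c) (wact u v)"
    using wconst_central[of c u] by (simp flip: wact_simps(4))
  then show ?thesis
    by (simp add: wact_simps)
qed

text \<open>
  The coefficients \<open>s\<^sub>a(\<xi>)\<close> of the normally ordered form \<open>u = \<Sum>\<^sub>a x\<^sup>a s\<^sub>a(\<partial>)\<close> can be read off
  from \<open>u\<close> applied to \<open>e\<^bsup>x \<cdot> \<xi>\<^esup>\<close>, which is \<open>\<Sum>\<^sub>a x\<^sup>a s\<^sub>a(\<xi>)\<close> times this exponential. To stay
  within power series in \<open>x\<close> with coefficients in \<open>\<FF>[\<xi>]\<close>, the operator is conjugated by the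
  exponential and applied to \<open>1\<close>: conjugation fixes \<open>x\<^sub>i\<close> and sends \<open>\<partial>\<^sub>i\<close> to \<open>\<partial>\<^sub>i + \<xi>\<^sub>i\<close>, and it
  takes values in the Weyl algebra over \<open>\<FF>[\<xi>]\<close>. The ring \<open>R\<close> serves as \<open>\<FF>[\<xi>]\<close>, with \<open>\<xi>\<^sub>i\<close> the
  variable \<open>x\<^sub>i\<close>.
\<close>

fun shift_gen :: "weyl_gen \<Rightarrow> (2, 'f::comm_ring_1) mpoly weyl" where
  "shift_gen (GX i) = wx i"
| "shift_gen (GD i) = wd i + wconst (mvar i)"

definition shift_free ::
  "(weyl_gen, 'f::comm_ring_1) free_alg \<Rightarrow> (2, 'f) mpoly weyl" where
  "shift_free = free_eval (\<lambda>c. wconst (mconst c)) shift_gen"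

lemma shift_free_simps:
  fixes a b :: "(weyl_gen, 'f::comm_ring_1) free_alg" and c :: 'f
  shows "shift_free 0 = (0 :: (2, 'f) mpoly weyl)" "shift_free 1 = (1 :: (2, 'f) mpoly weyl)"
  "shift_free (a + b) = shift_free a + shift_free b"
  "shift_free (a * b) = shift_free a * shift_free b"
  "shift_free (a - b) = shift_free a - shift_free b"
  "shift_free (fvar g) = (shift_gen g :: (2, 'f) mpoly weyl)"
  "shift_free (Poly_Mapping.single 0 c) = wconst (mconst c)"
proof -
  have letters_zero: "letters (0 :: weyl_gen word) = []"
    by (simp add: zero_word_def)
  have single: "shift_free (Poly_Mapping.single w c) =
      wconst (mconst c) * prod_list (map shift_gen (letters w))" for w and c :: 'f
    by (simp add: shift_free_def free_eval_single)
  show "shift_free 0 = (0 :: (2, 'f) mpoly weyl)"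
    by (simp add: shift_free_def free_eval_def)
  show "shift_free 1 = (1 :: (2, 'f) mpoly weyl)"
    using single[of 0 1] letters_zero by simp
  show add: "shift_free (a + b) = shift_free a + shift_free b" for a b :: "(_, 'f) free_alg"
    by (simp add: shift_free_def free_eval_add wconst_add)
  show "shift_free (a * b) = shift_free a * shift_free b"
    unfolding shift_free_def
    by (rule free_eval_mult) (rule wconst_central | simp add: wconst_add wconst_mult)+
  show "shift_free (a - b) = shift_free a - shift_free b"
    using add[of "a - b" b] by simp
  show "shift_free (fvar g) = (shift_gen g :: (2, 'f) mpoly weyl)"
    by (simp add: fvar_def single)
  show "shift_free (Poly_Mapping.single 0 c) = wconst (mconst c)"
    by (simp add: single letters_zero)
qed

lemma shift_free_ideal: "p \<in> weyl_ideal \<Longrightarrow> shift_free p = 0"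
proof -
  let ?J = "{p :: (weyl_gen, 'a) free_alg. shift_free p = 0}"
  have "ideal ?J type_ring"
    by (rule ideal_type_ringI) (simp_all add: shift_free_simps)
  moreover have "weyl_relators \<subseteq> ?J"
  proof -
    have xx: "wx i * wx j - wx j * wx i = (0 :: (2, 'a) mpoly weyl)" for i j
      by (simp add: wx_commute)
    have dd: "(wd i + wconst c) * (wd j + wconst e) = (wd j + wconst e) * (wd i + wconst c)"
      for i j and c e :: "(2, 'a) mpoly"
      using wd_commute[of i j] wconst_central[of c "wd j"] wconst_central[of e "wd i"]
        wconst_central[of c "wconst e"]
      by (simp add: distrib_left distrib_right add_ac)
    have dx: "(wd i + wconst c) * wx j = wx j * (wd i + wconst c) + of_bool (i = j)"
      for i j and c :: "(2, 'a) mpoly"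
      using wd_wx[of i j] wconst_central[of c "wx j"]
      by (simp add: distrib_left distrib_right add_ac)
    have ob: "shift_free (of_bool b) = of_bool b" for b
      by (cases b) (simp_all add: shift_free_simps)
    show ?thesis
      by (auto simp: weyl_relators_def shift_free_simps xx dx ob) (simp add: dd)
  qed
  ultimately show "p \<in> weyl_ideal \<Longrightarrow> shift_free p = 0"
    using weyl_ideal_minimal[of ?J] by blast
qed

lift_definition shift_weyl :: "'f::comm_ring_1 weyl \<Rightarrow> (2, 'f) mpoly weyl" is shift_free
  unfolding weyl_rel_def
  by (metis shift_free_ideal shift_free_simps(5) right_minus_eq)

lemma shift_weyl_simps:
  "shift_weyl 0 = 0" "shift_weyl 1 = 1" "shift_weyl (a + b) = shift_weyl a + shift_weyl b"
  "shift_weyl (a * b) = shift_weyl a * shift_weyl b"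
  "shift_weyl (wconst c) = wconst (mconst c)"
  "shift_weyl (wx i) = wx i" "shift_weyl (wd i) = wd i + wconst (mvar i)"
  by (transfer; simp add: shift_free_simps)+

text \<open>
  The coefficient of \<open>x\<^sup>a\<close> in the conjugated operator applied to the constant series \<open>1\<close>, whose
  coefficient function is the indicator of the exponent \<open>0\<close>.
\<close>

definition symbol :: "(2 \<Rightarrow> nat) \<Rightarrow> 'f::comm_ring_1 weyl \<Rightarrow> (2, 'f) mpoly" where
  "symbol a u = wact (shift_weyl u) (\<lambda>m. of_bool (m = (\<lambda>_. 0))) a"

lemma symbol_zero [simp]: "symbol a 0 = 0"
  by (simp add: symbol_def shift_weyl_simps wact_simps)

lemma symbol_one: "symbol a 1 = of_bool (a = (\<lambda>_. 0))"
  by (simp add: symbol_def shift_weyl_simps wact_simps)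

lemma symbol_add: "symbol a (u + v) = symbol a u + symbol a v"
  by (simp add: symbol_def shift_weyl_simps wact_simps)

lemma symbol_wx_mult: "symbol a (wx i * u) = (if a i = 0 then 0 else symbol (a(i := a i - 1)) u)"
  by (simp add: symbol_def shift_weyl_simps wact_simps)

lemma symbol_wd_mult:
  "symbol a (wd i * u) = of_nat (a i + 1) * symbol (a(i := a i + 1)) u + mvar i * symbol a u"
  by (simp add: symbol_def shift_weyl_simps wact_simps)

lemma symbol_wconst_mult: "symbol a (wconst c * u) = mconst c * symbol a u"
  by (simp add: symbol_def shift_weyl_simps wact_simps)

text \<open>
  The derivatives of the constant series \<open>1\<close> vanish, so the shifted \<open>\<partial>\<^sub>i\<close> acts on it as the
  scalar \<open>\<xi>\<^sub>i\<close>, and scalars pass through every operator. Hence the symbol is linear over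
  constant coefficient operators on the right.
\<close>

lemma symbol_mult_dop:
  fixes u :: "'f::comm_ring_1 weyl"
  shows "symbol a (u * dop r) = symbol a u * r"
proof (induction r arbitrary: u rule: mpoly_induct)
  case (const c)
  show ?case
    using symbol_wconst_mult[of a c u] by (simp add: mult.commute wconst_central[of c u])
next
  case (var i)
  have "wact (shift_weyl (wd i)) (\<lambda>m. of_bool (m = (\<lambda>_. 0))) = 
      (\<lambda>m. (mvar i :: (2, 'f) mpoly) * of_bool (m = (\<lambda>_. 0)))"
    by (auto simp: shift_weyl_simps wact_simps fun_eq_iff)
  then show ?case
    by (simp add: symbol_def shift_weyl_simps(4) wact_simps(4) wact_scale mult.commute)
next
  case (add p q)
  then show ?case by (simp add: dop_add symbol_add distrib_left)
next
  case (mult p q)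
  have "symbol a (u * dop (p * q)) = symbol a (u * dop p * dop q)"
    by (simp only: dop_mult mult.assoc)
  also have "\<dots> = symbol a u * p * q"
    by (simp only: mult.IH)
  finally show ?case
    by (simp only: mult.assoc)
qed

subsection \<open>The Poincare--Birkhoff--Witt expansion\<close>

definition wx_mono :: "(2 \<Rightarrow> nat) \<Rightarrow> 'f::comm_ring_1 weyl" where
  "wx_mono a = wx 1 ^ a 1 * wx 2 ^ a 2"

lemma wx_power_commute: "wx i * wx j ^ n = wx j ^ n * wx i"
  by (rule power_commuting_commutes[OF wx_commute, symmetric])

lemma wx_wx_mono: "wx i * wx_mono a = wx_mono (a(i := a i + 1))"
proof -
  have "i = 1 \<or> i = 2" using exhaust_2 by blast
  then show ?thesis
  proof
    assume [simp]: "i = 2"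
    have "wx 2 * (wx 1 ^ a 1 * wx 2 ^ a 2) = wx 1 ^ a 1 * (wx 2 * (wx 2 ^ a 2 :: 'a weyl))"
      by (simp add: wx_power_commute[of 2 1] flip: mult.assoc)
    then show ?thesis
      by (simp add: wx_mono_def)
  qed (simp add: wx_mono_def mult.assoc)
qed

lemma wd_wx_power_neq:
  assumes "i \<noteq> j"
  shows "wd i * wx j ^ n = wx j ^ n * wd i"
  by (rule power_commuting_commutes[symmetric]) (simp add: wd_wx assms)

lemma wd_wx_power_eq: "wd i * wx i ^ n = wx i ^ n * wd i + of_nat n * wx i ^ (n - 1)"
proof (induction n)
  case (Suc n)
  have "(wd i :: 'a weyl) * wx i ^ Suc n = (wx i * wd i + 1) * wx i ^ n"
    by (simp add: wd_wx flip: mult.assoc)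
  also have "\<dots> = wx i * (wd i * wx i ^ n) + wx i ^ n"
    by (simp add: distrib_right mult.assoc)
  also have "\<dots> = wx i * (wx i ^ n * wd i) + wx i * (of_nat n * wx i ^ (n - 1)) + wx i ^ n"
    by (simp only: Suc.IH distrib_left)
  also have "wx i * (of_nat n * wx i ^ (n - 1)) = (of_nat n * wx i ^ n :: 'a weyl)"
  proof -
    have "wx i * (of_nat n * y) = of_nat n * (wx i * (y :: 'a weyl))" for y
      by (simp add: mult_of_nat_commute[of n "wx i"] flip: mult.assoc)
    then show ?thesis
      by (cases n) (simp_all del: of_nat_Suc)
  qed
  finally show ?case
    by (simp add: algebra_simps)
qed simp

lemma wd_wx_mono:
  "wd i * wx_mono a = of_nat (a i) * wx_mono (a(i := a i - 1)) + wx_mono a * wd i"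
proof -
  have "i = 1 \<or> i = 2" using exhaust_2 by blast
  then show ?thesis
  proof
    assume [simp]: "i = 1"
    have "wd 1 * wx_mono a = (wx 1 ^ a 1 * wd 1 + of_nat (a 1) * wx 1 ^ (a 1 - 1)) * wx 2 ^ a 2"
      by (simp add: wx_mono_def wd_wx_power_eq flip: mult.assoc)
    then show ?thesis
      by (simp add: wx_mono_def wd_wx_power_neq algebra_simps)
  next
    assume [simp]: "i = 2"
    have "wd 2 * wx_mono a = wx 1 ^ a 1 * (wd 2 * wx 2 ^ a 2)"
      by (simp add: wx_mono_def wd_wx_power_neq flip: mult.assoc)
    also have "\<dots> = wx 1 ^ a 1 * (wx 2 ^ a 2 * wd 2) + wx 1 ^ a 1 * (of_nat (a 2) * wx 2 ^ (a 2 - 1))"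
      by (simp add: wd_wx_power_eq distrib_left)
    also have "wx 1 ^ a 1 * (of_nat (a 2) * wx 2 ^ (a 2 - 1)) =
        (of_nat (a 2) * (wx 1 ^ a 1 * wx 2 ^ (a 2 - 1)) :: 'a weyl)"
      by (simp add: mult_of_nat_commute[of "a 2" "wx 1 ^ a 1"] flip: mult.assoc)
    finally show ?thesis
      by (simp add: wx_mono_def mult.assoc add.commute)
  qed
qed

inductive normally_ordered :: "'f::comm_ring_1 weyl \<Rightarrow> bool" where
  zero: "normally_ordered 0"
| single: "normally_ordered (wx_mono a * dop r)"
| add: "normally_ordered u \<Longrightarrow> normally_ordered v \<Longrightarrow> normally_ordered (u + v)"

text \<open>
  Every operator is a sum of products of generators applied to \<open>1\<close>, so it is enough that
  normally ordered sums are stable under left multiplication by each generator; for \<open>\<partial>\<^sub>i\<close> this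
  is the product rule.
\<close>

lemma normally_ordered: "normally_ordered u"
proof -
  have "normally_ordered v \<Longrightarrow> normally_ordered (u * v)" for v
  proof (induction u arbitrary: v rule: weyl_induct)
    case (const c)
    from const.prems show ?case
    proof induction
      case (single a r)
      have "wconst c * (wx_mono a * dop r) = wx_mono a * dop (mconst c * r)"
        by (simp add: dop_mult wconst_left_commute)
      then show ?case by (simp add: normally_ordered.single)
    qed (auto simp: distrib_left intro: normally_ordered.intros)
  next
    case (x i)
    from x.prems show ?case
    proof induction
      case (single a r)
      have "wx i * (wx_mono a * dop r) = wx_mono (a(i := a i + 1)) * dop r"
        by (simp add: wx_wx_mono flip: mult.assoc)
      then show ?case by (simp add: normally_ordered.single)
    qed (auto simp: distrib_left intro: normally_ordered.intros)
  next
    case (d i)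
    from d.prems show ?case
    proof induction
      case (single a r)
      have "wd i * (wx_mono a * dop r) =
          (of_nat (a i) * wx_mono (a(i := a i - 1)) + wx_mono a * wd i) * dop r"
        by (simp add: wd_wx_mono flip: mult.assoc)
      also have "\<dots> = wx_mono (a(i := a i - 1)) * dop (of_nat (a i) * r) + wx_mono a * dop (mvar i * r)"
      proof -
        have "of_nat n * (wx_mono b * dop r) = wx_mono b * (of_nat n * dop r)" for n b
          by (simp add: mult_of_nat_commute[of n "wx_mono b"] flip: mult.assoc)
        then show ?thesis
          by (simp add: dop_mult dop_of_nat distrib_right mult.assoc)
      qed
      finally show ?case
        by (auto intro: normally_ordered.intros)
    qed (auto simp: distrib_left intro: normally_ordered.intros)
  qed (auto simp: distrib_right mult.assoc intro: normally_ordered.intros)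
  moreover have "normally_ordered (1 :: 'a weyl)"
    using normally_ordered.single[of "\<lambda>_. 0" "mconst 1"] by (simp add: wx_mono_def del: mconst_simps)
  ultimately show ?thesis
    by (metis mult.right_neutral)
qed

lemma symbol_wx_power_mult:
  "symbol a (wx i ^ n * u) = (if a i < n then 0 else symbol (a(i := a i - n)) u)"
proof (induction n arbitrary: a)
  case (Suc n)
  have "symbol a (wx i ^ Suc n * u) = symbol a (wx i * (wx i ^ n * u))"
    by (simp add: mult.assoc)
  also have "\<dots> = (if a i = 0 then 0 else symbol (a(i := a i - 1)) (wx i ^ n * u))"
    by (rule symbol_wx_mult)
  also have "\<dots> = (if a i = 0 then 0 else if a i - 1 < n then 0
      else symbol (a(i := a i - 1 - n)) u)"
    by (simp only: Suc.IH fun_upd_same fun_upd_upd)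
  finally show ?case
    by (cases "a i < Suc n") (auto simp: fun_upd_def)
qed simp

lemma symbol_wx_mono_dop:
  fixes r :: "(2, 'f::comm_ring_1) mpoly"
  shows "symbol a (wx_mono b * dop r) = (r when a = b)"
proof -
  have "symbol a (wx_mono b :: 'f weyl) = of_bool (a = b)"
  proof -
    have ex: "c = e \<longleftrightarrow> c 1 = e 1 \<and> c 2 = e 2" for c e :: "2 \<Rightarrow> nat"
      by (simp add: fun_eq_iff forall_2)
    have "symbol a (wx_mono b :: 'f weyl) = symbol a (wx 1 ^ b 1 * (wx 2 ^ b 2 * 1))"
      by (simp add: wx_mono_def)
    then show ?thesis
      by (simp only: symbol_wx_power_mult symbol_one ex) auto
  qed
  then show ?thesis
    by (simp add: symbol_mult_dop when_def)
qed

lemma finite_symbol_support: "finite {a. symbol a u \<noteq> 0}"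
  using normally_ordered[of u]
proof induction
  case (single b r)
  have "{a. symbol a (wx_mono b * dop r) \<noteq> 0} \<subseteq> {b}"
    by (auto simp: symbol_wx_mono_dop)
  then show ?case by (rule finite_subset) simp
next
  case (add u v)
  have "{a. symbol a (u + v) \<noteq> 0} \<subseteq> {a. symbol a u \<noteq> 0} \<union> {a. symbol a v \<noteq> 0}"
    by (auto simp: symbol_add)
  then show ?case by (rule finite_subset) (use add.IH in simp)
qed simp

text \<open>
  On a single term \<open>x\<^sup>b r(\<partial>)\<close> the symbol is concentrated at \<open>b\<close> with value \<open>r\<close>. So the symbol
  recovers the coefficients of any normally ordered expansion, and in particular the expansion
  is unique.
\<close>

lemma symbol_expansion:
  assumes "finite A" "{a. symbol a u \<noteq> 0} \<subseteq> A"
  shows "u = (\<Sum>a\<in>A. wx_mono a * dop (symbol a u))"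
proof -
  define s where "s A u = (\<Sum>a\<in>A. wx_mono a * dop (symbol a u))" for A and u :: "'a weyl"
  have super: "s A u = s {a. symbol a u \<noteq> 0} u" if "finite A" "{a. symbol a u \<noteq> 0} \<subseteq> A" for A u
    unfolding s_def using that by (intro sum.mono_neutral_right) auto
  have "s {a. symbol a u \<noteq> 0} u = u" for u
    using normally_ordered[of u]
  proof induction
    case zero
    show ?case by (simp add: s_def)
  next
    case (single b r)
    have "s {a. symbol a (wx_mono b * dop r) \<noteq> 0} (wx_mono b * dop r) = s {b} (wx_mono b * dop r)"
      by (rule super[symmetric]) (auto simp: symbol_wx_mono_dop)
    then show ?case
      by (simp add: s_def symbol_wx_mono_dop)
  next
    case (add u v)
    let ?A = "{a. symbol a u \<noteq> 0} \<union> {a. symbol a v \<noteq> 0}"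
    have fin: "finite ?A"
      by (simp add: finite_symbol_support)
    have "s ?A (u + v) = s ?A u + s ?A v"
      by (simp add: s_def symbol_add dop_add distrib_left sum.distrib)
    moreover have "s ?A w = s {a. symbol a w \<noteq> 0} w" if "w \<in> {u, v, u + v}" for w
      using that fin by (intro super) (auto simp: symbol_add)
    ultimately show ?case
      using add.IH by simp
  qed
  then show ?thesis
    using super[OF assms] by (simp add: s_def)
qed

section \<open>Left ideals\<close>

lemma left_ideal2_zero [simp]: "0 \<in> left_ideal2 a b"
  unfolding left_ideal2_def by (rule CollectI, intro exI[of _ 0]) simp

lemma left_ideal2_add:
  assumes "x \<in> left_ideal2 a b" "y \<in> left_ideal2 a b"
  shows "x + y \<in> left_ideal2 a b"
proof -
  obtain s t s' t' where "x = s * a + t * b" "y = s' * a + t' * b"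
    using assms by (auto simp: left_ideal2_def)
  then have "x + y = (s + s') * a + (t + t') * b"
    by (simp add: distrib_right)
  then show ?thesis
    by (auto simp: left_ideal2_def)
qed

lemma left_ideal2_mult: "x \<in> left_ideal2 a b \<Longrightarrow> r * x \<in> left_ideal2 a b"
  unfolding left_ideal2_def
  by (clarsimp simp: distrib_left) (metis mult.assoc)

lemma left_ideal2_uminus: "x \<in> left_ideal2 a b \<Longrightarrow> - x \<in> left_ideal2 a b"
  using left_ideal2_mult[of x a b "- 1"] by simp

lemma left_ideal2_diff: "x \<in> left_ideal2 a b \<Longrightarrow> y \<in> left_ideal2 a b \<Longrightarrow> x - y \<in> left_ideal2 a b"
  using left_ideal2_add[of x a b "- y"] left_ideal2_uminus[of y a b] by simp

lemma left_ideal2_sum: "(\<And>i. i \<in> A \<Longrightarrow> f i \<in> left_ideal2 a b) \<Longrightarrow> sum f A \<in> left_ideal2 a b"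
  by (induction A rule: infinite_finite_induct) (auto intro: left_ideal2_add)

section \<open>Operators that are horizontal modulo a left ideal\<close>

abbreviation dopT :: "(3, (2, 'f::comm_ring_1) mpoly) mpoly \<Rightarrow> 'f weyl_T" where
  "dopT \<equiv> Poly_Mapping.map dop"

abbreviation tsymbol :: "(2 \<Rightarrow> nat) \<Rightarrow> 'f::comm_ring_1 weyl_T \<Rightarrow> (3, (2, 'f) mpoly) mpoly" where
  "tsymbol a \<equiv> Poly_Mapping.map (symbol a)"

lemma fourier_weyl_T_of_poly:
  fixes s :: "(3, (2, 'f::comm_ring_1) mpoly) mpoly"
  shows "fourier (weyl_T_of_poly s) = dopT s"
proof -
  have "weyl_of_poly (0 :: (2, 'f) mpoly) = 0"
    by (simp add: weyl_of_poly_def)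
  then show ?thesis
    by (simp add: fourier_def weyl_T_of_poly_def map_comp dop_def[abs_def])
qed

lemma dopT_add: "dopT (p + q) = dopT p + dopT q"
  by (simp add: map_zero_add dop_add)

lemma dopT_mult: "dopT (p * q) = dopT p * dopT q"
  using map_semimult[of dop "\<lambda>x. x" "\<lambda>x. x" dop dop p q]
  by (simp add: map_id dop_add dop_mult)

lemma tsymbol_add: "tsymbol a (t + u) = tsymbol a t + tsymbol a u"
  by (simp add: map_zero_add symbol_add)

lemma tsymbol_sum: "tsymbol a (sum f A) = (\<Sum>x\<in>A. tsymbol a (f x))"
  by (induction A rule: infinite_finite_induct) (simp_all add: tsymbol_add)

lemma tsymbol_uminus: "tsymbol a (- t) = - tsymbol a t"
  using tsymbol_add[of a t "- t"] by (simp add: eq_neg_iff_add_eq_0 add.commute)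

lemma tsymbol_diff: "tsymbol a (t - u) = tsymbol a t - tsymbol a u"
  using tsymbol_add[of a t "- u"] by (simp add: tsymbol_uminus)

lemma tsymbol_mult_dopT: "tsymbol a (t * dopT s) = tsymbol a t * s"
  using map_semimult[of "symbol a" "\<lambda>x. x" dop "symbol a" "\<lambda>x. x" t s]
  by (simp add: map_id dop_add symbol_add symbol_mult_dop)

lemma tsymbol_wconst_mult:
  "tsymbol a (Poly_Mapping.map wconst u * t) = Poly_Mapping.map mconst u * tsymbol a t"
  using map_semimult[of "symbol a" wconst "\<lambda>x. x" mconst "symbol a" u t]
  by (simp add: map_id wconst_add symbol_add symbol_wconst_mult)

lemma lookup_of_nat_mult:
  "Poly_Mapping.lookup (of_nat n * p) k = of_nat n * Poly_Mapping.lookup (p :: ('v, 'c::semiring_1) mpoly) k"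
  by (metis lookup_mconst_mult mconst_def single_of_nat)

text \<open>
  Left multiplication by \<open>\<partial>\<^sub>i\<close> on normally ordered expansions: the product rule differentiates
  \<open>x\<^sup>a\<close>, and the remaining \<open>\<partial>\<^sub>i\<close> moves to the right, where it multiplies the symbol by its
  variable.
\<close>

lemma tsymbol_wd_mult:
  "tsymbol a (mconst (wd i) * t) =
    of_nat (a i + 1) * tsymbol (a(i := a i + 1)) t + mconst (mvar i) * tsymbol a t"
  by (rule poly_mapping_eqI)
    (simp only: lookup_map_zero symbol_zero lookup_add lookup_mconst_mult lookup_of_nat_mult
      symbol_wd_mult)

lemma tsymbol_wx_mono_dopT: "tsymbol a (mconst (wx_mono b) * dopT s) = (s when a = b)"
  by (rule poly_mapping_eqI)
    (simp add: lookup_map_zero lookup_mconst_mult symbol_wx_mono_dop when_def)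

lemma finite_tsymbol_support: "finite {a. tsymbol a t \<noteq> 0}"
proof -
  have "{a. tsymbol a t \<noteq> 0} \<subseteq>
      (\<Union>k\<in>Poly_Mapping.keys t. {a. symbol a (Poly_Mapping.lookup t k) \<noteq> 0})"
    by (auto simp: map_eq_zero_iff)
  then show ?thesis
    by (rule finite_subset) (simp add: finite_symbol_support)
qed

lemma tsymbol_expansion:
  "t = (\<Sum>a | tsymbol a t \<noteq> 0. mconst (wx_mono a) * dopT (tsymbol a t))"
proof (rule poly_mapping_eqI)
  fix k
  have "{a. symbol a (Poly_Mapping.lookup t k) \<noteq> 0} \<subseteq> {a. tsymbol a t \<noteq> 0}"
    by (force simp: map_eq_zero_iff in_keys_iff intro!: bexI[of _ k])
  from symbol_expansion[OF finite_tsymbol_support this]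
  show "Poly_Mapping.lookup t k =
      Poly_Mapping.lookup (\<Sum>a | tsymbol a t \<noteq> 0. mconst (wx_mono a) * dopT (tsymbol a t)) k"
    by (simp add: lookup_sum lookup_mconst_mult lookup_map_zero)
qed

text \<open>
  \<open>G\<close> is the ideal of \<open>S\<close> that defines the symmetric algebra, and \<open>J\<close> is the left ideal of \<open>\<T>\<close>
  that defines \<open>Q\<close>; its generators are the Fourier transforms of those of \<open>G\<close>.
\<close>

locale linear_forms =
  fixes g1 g2 :: "(3, (2, 'f::field_char_0) mpoly) mpoly"
begin

definition G :: "(3, (2, 'f) mpoly) mpoly set" where
  "G = left_ideal2 g1 g2"

definition J :: "'f weyl_T set" where
  "J = left_ideal2 (dopT g1) (dopT g2)"

lemma tsymbol_in_G: "t \<in> J \<Longrightarrow> tsymbol a t \<in> G"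
  unfolding J_def G_def
  by (auto simp: left_ideal2_def tsymbol_add tsymbol_mult_dopT) blast

lemma dopT_in_J: "s \<in> G \<Longrightarrow> dopT s \<in> J"
  unfolding J_def G_def
  by (auto simp: left_ideal2_def dopT_add dopT_mult) blast

text \<open>
  The generators of \<open>J\<close> have constant coefficients and multiply symbols from the right.
  Therefore membership in \<open>J\<close> can be tested on each symbol separately, that is, \<open>\<T>/J\<close> is the
  direct sum of the copies \<open>x\<^sup>a (S/G)\<close>.
\<close>

lemma in_J_iff: "t \<in> J \<longleftrightarrow> (\<forall>a. tsymbol a t \<in> G)"
proof
  assume "\<forall>a. tsymbol a t \<in> G"
  then have "(\<Sum>a | tsymbol a t \<noteq> 0. mconst (wx_mono a) * dopT (tsymbol a t)) \<in> J"
    using dopT_in_J unfolding J_def by (intro left_ideal2_sum left_ideal2_mult) auto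
  then show "t \<in> J"
    using tsymbol_expansion[of t] by simp
qed (simp add: tsymbol_in_G)

text \<open>
  The operators whose class in \<open>\<T>/J\<close> lies in \<open>H\<^sup>0\<^sub>d\<^sub>R\<close>.
\<close>

definition horizontal :: "'f weyl_T \<Rightarrow> bool" where
  "horizontal t \<longleftrightarrow> (\<forall>i. mconst (wd i) * t \<in> J)"

lemma horizontal_iff:
  "horizontal t \<longleftrightarrow>
    (\<forall>i a. of_nat (a i + 1) * tsymbol (a(i := a i + 1)) t + mconst (mvar i) * tsymbol a t \<in> G)"
  unfolding horizontal_def in_J_iff tsymbol_wd_mult ..

text \<open>
  The coefficients \<open>(-x)\<^sup>a / a!\<close> of the exponential that solves the recursion for the symbols of
  a horizontal operator.
\<close>

definition taylor :: "(2 \<Rightarrow> nat) \<Rightarrow> (2, 'f) mpoly" where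
  "taylor a = mconst (inverse (fact (a 1) * fact (a 2))) * ((- mvar 1) ^ a 1 * (- mvar 2) ^ a 2)"

lemma taylor_zero [simp]: "taylor (\<lambda>_. 0) = 1"
  by (simp add: taylor_def)

lemma taylor_Suc: "of_nat (a i + 1) * taylor (a(i := a i + 1)) = - mvar i * taylor a"
proof -
  have c: "of_nat (n + 1) * (mconst (inverse (fact (Suc n) * c)) * (z * p * q)) =
      z * (mconst (inverse (fact n * c)) * (p * q))"
    for n and c :: 'f and z p q :: "(2, 'f) mpoly"
  proof -
    have "mconst (of_nat (n + 1) * inverse (fact (Suc n) * c)) =
        (mconst (inverse (fact n * c)) :: (2, 'f) mpoly)"
      by (rule arg_cong[of _ _ mconst]) (simp add: field_simps del: of_nat_Suc)
    then have c1: "of_nat (n + 1) * mconst (inverse (fact (Suc n) * c)) =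
        (mconst (inverse (fact n * c)) :: (2, 'f) mpoly)"
      by (simp only: mconst_simps mconst_of_nat)
    have c2: "k * (r * (z * p * q)) = z * ((k * r) * (p * q))" for k r :: "(2, 'f) mpoly"
      by (simp add: mult_ac)
    show ?thesis
      unfolding c2 c1 ..
  qed
  have "i = 1 \<or> i = 2" using exhaust_2 by blast
  then show ?thesis
  proof
    assume [simp]: "i = 1"
    have "taylor (a(1 := a 1 + 1)) = mconst (inverse (fact (Suc (a 1)) * fact (a 2))) *
        (- mvar 1 * (- mvar 1) ^ a 1 * (- mvar 2) ^ a 2)"
      by (simp add: taylor_def del: fact_Suc mconst_simps)
    then show ?thesis
      using c[of "a 1" "fact (a 2)"] by (simp only: \<open>i = 1\<close>) (simp only: taylor_def)
  next
    assume [simp]: "i = 2"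
    have "taylor (a(2 := a 2 + 1)) = mconst (inverse (fact (Suc (a 2)) * fact (a 1))) *
        (- mvar 2 * (- mvar 1) ^ a 1 * (- mvar 2) ^ a 2)"
      by (simp add: taylor_def mult_ac del: fact_Suc mconst_simps)
    then show ?thesis
      using c[of "a 2" "fact (a 1)"]
      by (simp only: \<open>i = 2\<close>) (simp only: taylor_def mult.commute[of "fact (a 2)"])
  qed
qed

lemma G_mult: "s \<in> G \<Longrightarrow> r * s \<in> G"
  unfolding G_def by (rule left_ideal2_mult)

lemma G_add: "s \<in> G \<Longrightarrow> s' \<in> G \<Longrightarrow> s + s' \<in> G"
  unfolding G_def by (rule left_ideal2_add)

lemma G_diff: "s \<in> G \<Longrightarrow> s' \<in> G \<Longrightarrow> s - s' \<in> G"
  unfolding G_def by (rule left_ideal2_diff)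

lemma G_zero [simp]: "0 \<in> G"
  unfolding G_def by simp

lemma G_divide:
  assumes "of_nat (Suc n) * s \<in> G"
  shows "s \<in> G"
proof -
  have "mconst (mconst (inverse (of_nat (Suc n)) :: 'f)) * (of_nat (Suc n) * s) \<in> G"
    using assms by (rule G_mult)
  also have "mconst (mconst (inverse (of_nat (Suc n)) :: 'f)) * (of_nat (Suc n) * s) =
      mconst (mconst (inverse (of_nat (Suc n)) * of_nat (Suc n))) * s"
    by (simp only: mconst_simps mconst_of_nat mult.assoc)
  also have "\<dots> = s"
    by (simp del: of_nat_Suc)
  finally show ?thesis .
qed

text \<open>
  Horizontality is the recursion \<open>(a\<^sub>i + 1) s\<^bsub>a + e\<^sub>i\<^esub> = - x\<^sub>i s\<^sub>a\<close> modulo \<open>G\<close>. In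
  characteristic zero it determines every symbol from the one at \<open>a = 0\<close>.
\<close>

lemma horizontal_tsymbol:
  assumes "horizontal t"
  shows "tsymbol a t - mconst (taylor a) * tsymbol (\<lambda>_. 0) t \<in> G"
proof (induction "a 1 + a 2" arbitrary: a)
  case 0
  then have "a = (\<lambda>_. 0)"
    by (simp add: fun_eq_iff forall_2)
  then show ?case by simp
next
  case (Suc n)
  obtain i where i: "a i > 0"
    using Suc.hyps(2) by (metis add_is_0 gr0I nat.distinct(1))
  define b where "b = a(i := a i - 1)"
  have a: "a = b(i := b i + 1)"
    using i by (simp add: b_def)
  have "i = 1 \<or> i = 2" using exhaust_2 by blast
  then have "n = b 1 + b 2"
    using Suc.hyps(2) i by (auto simp: b_def)
  then have IH: "tsymbol b t - mconst (taylor b) * tsymbol (\<lambda>_. 0) t \<in> G"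
    by (rule Suc.hyps(1))
  have H: "of_nat (b i + 1) * tsymbol a t + mconst (mvar i) * tsymbol b t \<in> G"
    using assms unfolding a horizontal_iff by blast
  have T: "of_nat (b i + 1) * mconst (taylor a) = - mconst (mvar i) * mconst (taylor b)"
    using arg_cong[OF taylor_Suc[of b i], of mconst, unfolded mconst_simps mconst_of_nat] a by simp
  have "of_nat (b i + 1) * (tsymbol a t - mconst (taylor a) * tsymbol (\<lambda>_. 0) t) =
      (of_nat (b i + 1) * tsymbol a t + mconst (mvar i) * tsymbol b t) -
      mconst (mvar i) * (tsymbol b t - mconst (taylor b) * tsymbol (\<lambda>_. 0) t)"
    unfolding right_diff_distrib mult.assoc[symmetric] T by (simp add: mult.assoc)
  also have "\<dots> \<in> G"
    by (intro G_diff G_mult H IH)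
  finally show ?case
    using G_divide[of "b i"] by simp
qed

lemma horizontal_in_J_iff:
  assumes "horizontal t"
  shows "t \<in> J \<longleftrightarrow> tsymbol (\<lambda>_. 0) t \<in> G"
proof
  assume *: "tsymbol (\<lambda>_. 0) t \<in> G"
  have "tsymbol a t \<in> G" for a
    using G_add[OF horizontal_tsymbol[OF assms, of a] G_mult[OF *, of "mconst (taylor a)"]] by simp
  then show "t \<in> J"
    by (simp add: in_J_iff)
qed (simp add: tsymbol_in_G)

text \<open>
  An expansion has finitely many terms, so the symbol at \<open>(n, 0)\<close> vanishes for some \<open>n\<close>; there
  the recursion leaves a multiple of \<open>x\<^sub>1\<^sup>n\<close> times the symbol at \<open>0\<close>.
\<close>

lemma horizontal_torsion:
  assumes "horizontal t"
  shows "\<exists>n. mconst (mvar 1) ^ n * tsymbol (\<lambda>_. 0) t \<in> G"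
proof -
  define e where "e n = (\<lambda>i::2. if i = 1 then n else 0)" for n :: nat
  have "inj e"
    by (rule injI) (metis e_def)
  have "finite {n. tsymbol (e n) t \<noteq> 0}"
    using finite_vimageI[OF finite_tsymbol_support \<open>inj e\<close>, of t] by (simp add: vimage_def)
  then obtain n where "tsymbol (e n) t = 0"
    using ex_new_if_finite infinite_UNIV_nat by blast
  then have "- (mconst (taylor (e n)) * tsymbol (\<lambda>_. 0) t) \<in> G"
    using horizontal_tsymbol[OF assms, of "e n"] by simp
  \<comment> \<open>The unit \<open>(-1)\<^sup>n n!\<close> turns the Taylor coefficient at \<open>(n, 0)\<close> into \<open>x\<^sub>1\<^sup>n\<close>.\<close>
  then have "mconst ((- 1) ^ n * fact n) * - (mconst (taylor (e n)) * tsymbol (\<lambda>_. 0) t) \<in> G"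
    by (rule G_mult)
  moreover have "mconst ((- 1) ^ n * fact n) * - (mconst (taylor (e n)) * tsymbol (\<lambda>_. 0) t) =
      - (mconst ((- 1) ^ n * fact n * taylor (e n)) * tsymbol (\<lambda>_. 0) t)"
    by (simp only: mconst_simps mult_minus_right mult.assoc)
  moreover have "(- 1) ^ n * fact n * taylor (e n) = mvar 1 ^ n"
  proof -
    have "fact n * mconst (inverse (fact n :: 'f)) = (1 :: (2, 'f) mpoly)"
    proof -
      have "(fact n :: (2, 'f) mpoly) = mconst (fact n)"
        by (metis mconst_of_nat of_nat_fact)
      then show ?thesis
        by (simp flip: mconst_simps(6))
    qed
    moreover have "(- 1) ^ n * (- mvar 1) ^ n = (mvar 1 :: (2, 'f) mpoly) ^ n"
      by (simp flip: power_mult_distrib)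
    ultimately show ?thesis
      by (simp add: taylor_def e_def) (metis (no_types, opaque_lifting) mult.assoc mult.commute mult_1)
  qed
  ultimately have "- (mconst (mvar 1 ^ n) * tsymbol (\<lambda>_. 0) t) \<in> G"
    by (simp only:)
  then show ?thesis
    using G_diff[of 0 "- (mconst (mvar 1 ^ n) * tsymbol (\<lambda>_. 0) t)"] by auto
qed

text \<open>
  Conversely, the formal solution \<open>\<Sum>\<^sub>a x\<^sup>a (-\<partial>)\<^sup>a / a! \<cdot> s(\<partial>)\<close> of the recursion can be truncated
  as soon as large monomials kill \<open>s\<close> modulo \<open>G\<close>: the omitted terms lie in \<open>J\<close>.
\<close>

lemma horizontal_lift:
  assumes "\<And>i. \<exists>n. mconst (mvar i) ^ n * s \<in> G"
  obtains t where "horizontal t" "tsymbol (\<lambda>_. 0) t - s \<in> G" "\<And>p. homogeneous p s \<Longrightarrow> homogeneous p t"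
proof -
  obtain n1 n2 where n12: "mconst (mvar 1) ^ n1 * s \<in> G" "mconst (mvar 2) ^ n2 * s \<in> G"
    using assms by metis
  define N where "N = n1 + n2"
  have torsion: "mconst (mvar i) ^ n * s \<in> G" if "n \<ge> N" for i n
  proof -
    have "i = 1 \<or> i = 2" using exhaust_2 by blast
    then obtain k where k: "k \<le> n" "mconst (mvar i) ^ k * s \<in> G"
      using n12 \<open>n \<ge> N\<close> by (auto simp: N_def dest: add_leE)
    have "mconst (mvar i) ^ n * s = mconst (mvar i) ^ (n - k) * (mconst (mvar i) ^ k * s)"
      using k(1) by (simp flip: mult.assoc power_add)
    then show ?thesis
      using G_mult[OF k(2)] by metis
  qed
  define B where "B = {a :: 2 \<Rightarrow> nat. \<forall>i. a i < N}"
  have "B = Pi\<^sub>E UNIV (\<lambda>_. {..<N})"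
    by (auto simp: B_def PiE_UNIV_domain)
  then have finB: "finite B"
    by (simp add: finite_PiE)
  define t where "t = (\<Sum>a\<in>B. mconst (wx_mono a) * dopT (mconst (taylor a) * s))"
  have outside: "mconst (taylor a) * s \<in> G" if "a \<notin> B" for a
  proof -
    have "a 1 \<ge> N \<or> a 2 \<ge> N"
      using that by (auto simp: B_def forall_2 not_less)
    then show ?thesis
    proof
      assume "a 1 \<ge> N"
      have "mconst (taylor a) * s = mconst (mconst (inverse (fact (a 1) * fact (a 2)))) *
          mconst ((- mvar 2) ^ a 2) * (- 1) ^ a 1 * (mconst (mvar 1) ^ a 1 * s)"
        by (simp add: taylor_def power_minus[of "mvar _"] power_minus[of "mconst _"] mult_ac)
      then show ?thesis
        using G_mult[OF torsion[OF \<open>a 1 \<ge> N\<close>]] by metis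
    next
      assume "a 2 \<ge> N"
      have "mconst (taylor a) * s = mconst (mconst (inverse (fact (a 1) * fact (a 2)))) *
          mconst ((- mvar 1) ^ a 1) * (- 1) ^ a 2 * (mconst (mvar 2) ^ a 2 * s)"
        by (simp add: taylor_def power_minus[of "mvar _"] power_minus[of "mconst _"] mult_ac)
      then show ?thesis
        using G_mult[OF torsion[OF \<open>a 2 \<ge> N\<close>]] by metis
    qed
  qed
  have sym: "tsymbol a t = (mconst (taylor a) * s when a \<in> B)" for a
    by (simp add: t_def tsymbol_sum tsymbol_wx_mono_dopT when_def finB)
  have cong: "tsymbol a t - mconst (taylor a) * s \<in> G" for a
    using outside[of a] G_diff[of 0 "mconst (taylor a) * s"] by (cases "a \<in> B") (simp_all add: sym)
  have "horizontal t"
    unfolding horizontal_iff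
  proof (intro allI)
    fix i :: 2 and a :: "2 \<Rightarrow> nat"
    let ?b = "a(i := a i + 1)"
    have "of_nat (a i + 1) * tsymbol ?b t + mconst (mvar i) * tsymbol a t =
        of_nat (a i + 1) * (tsymbol ?b t - mconst (taylor ?b) * s) +
        mconst (mvar i) * (tsymbol a t - mconst (taylor a) * s) +
        (of_nat (a i + 1) * mconst (taylor ?b) + mconst (mvar i) * mconst (taylor a)) * s"
      by (simp only: right_diff_distrib distrib_right mult.assoc) simp
    also have "of_nat (a i + 1) * mconst (taylor ?b) + mconst (mvar i) * mconst (taylor a) =
        mconst (of_nat (a i + 1) * taylor ?b + mvar i * taylor a)"
      by (simp only: mconst_simps mconst_of_nat)
    also have "of_nat (a i + 1) * taylor ?b + mvar i * taylor a = 0"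
      by (simp only: taylor_Suc) simp
    finally have eq: "of_nat (a i + 1) * tsymbol ?b t + mconst (mvar i) * tsymbol a t =
        of_nat (a i + 1) * (tsymbol ?b t - mconst (taylor ?b) * s) +
        mconst (mvar i) * (tsymbol a t - mconst (taylor a) * s) + mconst 0 * s" .
    show "of_nat (a i + 1) * tsymbol ?b t + mconst (mvar i) * tsymbol a t \<in> G"
      unfolding eq mconst_simps(1) mult_zero_left add_0_right by (intro G_add G_mult cong)
  qed
  moreover have "homogeneous p t" if "homogeneous p s" for p
    unfolding t_def using that
    by (intro homogeneous_sum homogeneous_mconst_mult homogeneous_map)
  ultimately show ?thesis
    using that[of t] cong[of "\<lambda>_. 0"] by simp
qed

end

section \<open>The symmetric algebra of an ideal with three generators\<close>

lemma sym_poly_ring_carrier: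
  "carrier (sym_poly_ring I) = {p. \<forall>m\<in>Poly_Mapping.keys p. Poly_Mapping.keys m \<subseteq> I}"
  by (simp add: sym_poly_ring_def)

lemma sym_poly_ring_simps [simp]:
  "x \<otimes>\<^bsub>sym_poly_ring I\<^esub> y = x * y" "\<one>\<^bsub>sym_poly_ring I\<^esub> = 1"
  "\<zero>\<^bsub>sym_poly_ring I\<^esub> = 0" "x \<oplus>\<^bsub>sym_poly_ring I\<^esub> y = x + y"
  by (simp_all add: sym_poly_ring_def type_ring_def)

lemma sym_carrier_add:
  "p \<in> carrier (sym_poly_ring I) \<Longrightarrow> q \<in> carrier (sym_poly_ring I) \<Longrightarrow> p + q \<in> carrier (sym_poly_ring I)"
  using keys_add[of p q] by (auto simp: sym_poly_ring_carrier)

lemma sym_carrier_mult: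
  assumes "p \<in> carrier (sym_poly_ring I)" "q \<in> carrier (sym_poly_ring I)"
  shows "p * q \<in> carrier (sym_poly_ring I)"
  unfolding sym_poly_ring_carrier
proof (intro CollectI ballI)
  fix m
  assume "m \<in> Poly_Mapping.keys (p * q)"
  then obtain k l where "m = k + l" "k \<in> Poly_Mapping.keys p" "l \<in> Poly_Mapping.keys q"
    using keys_mult[of p q] by blast
  then show "Poly_Mapping.keys m \<subseteq> I"
    using assms keys_add[of k l] unfolding sym_poly_ring_carrier by blast
qed

lemma sym_carrier_uminus: "p \<in> carrier (sym_poly_ring I) \<Longrightarrow> - p \<in> carrier (sym_poly_ring I)"
  by (simp add: in_keys_iff sym_poly_ring_carrier)

lemma sym_carrier_mconst: "mconst c \<in> carrier (sym_poly_ring I)"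
  by (auto simp: mconst_def sym_poly_ring_carrier split: if_splits)

lemma sym_carrier_mvar: "a \<in> I \<Longrightarrow> mvar a \<in> carrier (sym_poly_ring I)"
  by (auto simp: mvar_def sym_poly_ring_carrier split: if_splits)

lemma sym_carrier_zero_one: "0 \<in> carrier (sym_poly_ring I)" "1 \<in> carrier (sym_poly_ring I)"
  by (simp_all add: sym_poly_ring_carrier)

lemma cring_sym_poly_ring: "cring (sym_poly_ring (I :: 'r::comm_ring_1 set))"
proof (rule cringI)
  show "abelian_group (sym_poly_ring I)"
  proof (rule abelian_groupI)
    fix x
    assume "x \<in> carrier (sym_poly_ring I)"
    then show "\<exists>y\<in>carrier (sym_poly_ring I). y \<oplus>\<^bsub>sym_poly_ring I\<^esub> x = \<zero>\<^bsub>sym_poly_ring I\<^esub>"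
      by (intro bexI[of _ "- x"] sym_carrier_uminus) simp_all
  qed (simp_all add: add_ac sym_carrier_add sym_carrier_zero_one)
  show "comm_monoid (sym_poly_ring I)"
    by (rule comm_monoidI) (simp_all add: mult_ac sym_carrier_mult sym_carrier_zero_one)
qed (simp add: distrib_right)

lemma ideal_sym_poly_ringI:
  fixes K :: "('r::comm_ring_1, 'r) mpoly set"
  assumes K: "K \<subseteq> carrier (sym_poly_ring I)" "0 \<in> K" "\<And>a b. a \<in> K \<Longrightarrow> b \<in> K \<Longrightarrow> a + b \<in> K"
    "\<And>a r. a \<in> K \<Longrightarrow> r \<in> carrier (sym_poly_ring I) \<Longrightarrow> r * a \<in> K"
  shows "ideal K (sym_poly_ring I)"
proof -
  interpret A: cring "sym_poly_ring I" by (rule cring_sym_poly_ring)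
  have inv: "\<ominus>\<^bsub>sym_poly_ring I\<^esub> a = - a" if "a \<in> K" for a
    using that K(1) sym_carrier_uminus[of a I] by (intro A.minus_equality) auto
  show ?thesis
  proof (rule idealI[OF A.ring_axioms])
    show "subgroup K (add_monoid (sym_poly_ring I))"
    proof (rule A.add.subgroupI)
      fix a
      assume a: "a \<in> K"
      then show "\<ominus>\<^bsub>sym_poly_ring I\<^esub> a \<in> K"
        using K(4)[OF a sym_carrier_mconst[of "- 1"]] by (simp add: inv)
    qed (use K in auto)
  qed (use K(4) in \<open>simp_all add: mult.commute\<close>)
qed

lemma sym_relators_carrier:
  assumes add: "\<And>a b. a \<in> I \<Longrightarrow> b \<in> I \<Longrightarrow> a + b \<in> I" and mult: "\<And>a r. a \<in> I \<Longrightarrow> r * a \<in> I"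
  shows "sym_relators I \<subseteq> carrier (sym_poly_ring I)"
proof
  fix x
  assume "x \<in> sym_relators I"
  then consider a b where "a \<in> I" "b \<in> I" "x = mvar (a + b) + - (mvar a + mvar b)"
    | r a where "a \<in> I" "x = mvar (r * a) + - (mconst r * mvar a)"
    by (auto simp: sym_relators_def)
  then show "x \<in> carrier (sym_poly_ring I)"
    by cases (auto intro!: sym_carrier_add sym_carrier_uminus sym_carrier_mult sym_carrier_mconst
      sym_carrier_mvar add mult simp del: add_uminus_conv_diff minus_add_distrib)
qed

definition linear_form :: "'r::comm_ring_1 ^ 3 \<Rightarrow> (3, 'r) mpoly" where
  "linear_form c = (\<Sum>i\<in>UNIV. mconst (c $ i) * mvar i)"

lemma linear_form_add: "linear_form (\<chi> i. c $ i + e $ i) = linear_form c + linear_form e"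
  by (simp add: linear_form_def distrib_right sum.distrib)

lemma linear_form_scale: "linear_form (\<chi> i. r * c $ i) = mconst r * linear_form c"
  by (simp add: linear_form_def sum_distrib_left mult.assoc)

lemma linear_form_diff: "linear_form (\<chi> i. c $ i - e $ i) = linear_form c - linear_form e"
  by (simp add: linear_form_def left_diff_distrib sum_subtractf)

lemma linear_form_axis: "linear_form (axis i r) = mconst r * mvar i"
proof -
  have "mconst (axis i r $ k) * mvar k = (if k = i then mconst r * mvar k else 0)" for k :: 3
    by (simp add: axis_def)
  then show ?thesis
    by (simp add: linear_form_def)
qed

lemma sum_axis: "(\<Sum>k\<in>UNIV. axis i r $ k * f $ k) = (r * f $ i :: 'r::comm_ring_1)"
proof -
  have "axis i r $ k * f $ k = (if k = i then r * f $ k else 0)" for k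
    by (simp add: axis_def)
  then show ?thesis
    by simp
qed

text \<open>
  The ideal \<open>I\<close> generated by \<open>f\<^sub>1, f\<^sub>2, f\<^sub>3\<close>, and the two generators of its syzygies encoded as
  linear forms in \<open>T\<^sub>1, T\<^sub>2, T\<^sub>3\<close>.
\<close>

locale syzygy_module = linear_forms g1 g2
  for g1 g2 :: "(3, (2, 'f::field_char_0) mpoly) mpoly" +
  fixes f :: "(2, 'f) mpoly ^ 3" and I :: "(2, 'f) mpoly set"
  assumes I_iff: "a \<in> I \<longleftrightarrow> (\<exists>c. a = (\<Sum>i\<in>UNIV. c $ i * f $ i))"
    and syzygy: "(\<Sum>i\<in>UNIV. c $ i * f $ i) = 0 \<Longrightarrow> linear_form c \<in> G"
    and g_syzygy: "\<And>g. g \<in> {g1, g2} \<Longrightarrow> \<exists>c. g = linear_form c \<and> (\<Sum>i\<in>UNIV. c $ i * f $ i) = 0"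
begin

lemma I_add: "a \<in> I \<Longrightarrow> b \<in> I \<Longrightarrow> a + b \<in> I"
  unfolding I_iff
proof clarify
  fix c e
  show "\<exists>k. (\<Sum>i\<in>UNIV. c $ i * f $ i) + (\<Sum>i\<in>UNIV. e $ i * f $ i) = (\<Sum>i\<in>UNIV. k $ i * f $ i)"
    by (rule exI[of _ "\<chi> i. c $ i + e $ i"]) (simp add: distrib_right sum.distrib)
qed

lemma I_mult: "a \<in> I \<Longrightarrow> r * a \<in> I"
  unfolding I_iff
proof clarify
  fix c
  show "\<exists>k. r * (\<Sum>i\<in>UNIV. c $ i * f $ i) = (\<Sum>i\<in>UNIV. k $ i * f $ i)"
    by (rule exI[of _ "\<chi> i. r * c $ i"]) (simp add: sum_distrib_left mult.assoc)
qed

lemma f_in_I: "f $ i \<in> I"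
  unfolding I_iff by (rule exI[of _ "axis i 1"]) (simp add: sum_axis)

lemma sym_ideal: "ideal (sym_ideal I) (sym_poly_ring I)"
  and sym_relators_sub: "sym_relators I \<subseteq> sym_ideal I"
  and sym_ideal_minimal: "ideal K (sym_poly_ring I) \<Longrightarrow> sym_relators I \<subseteq> K \<Longrightarrow> sym_ideal I \<subseteq> K"
proof -
  interpret A: cring "sym_poly_ring I" by (rule cring_sym_poly_ring)
  note rel = sym_relators_carrier[OF I_add I_mult]
  show "ideal (sym_ideal I) (sym_poly_ring I)"
    unfolding sym_ideal_def by (rule A.genideal_ideal) (rule rel)
  show "sym_relators I \<subseteq> sym_ideal I"
    unfolding sym_ideal_def by (rule A.genideal_self) (rule rel)
  show "ideal K (sym_poly_ring I) \<Longrightarrow> sym_relators I \<subseteq> K \<Longrightarrow> sym_ideal I \<subseteq> K"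
    unfolding sym_ideal_def by (rule A.genideal_minimal)
qed

lemma sym_ideal_sub: "sym_ideal I \<subseteq> carrier (sym_poly_ring I)"
  using ideal.Icarr[OF sym_ideal] by blast

lemma sym_ideal_zero: "0 \<in> sym_ideal I"
  using additive_subgroup.zero_closed[OF ideal.axioms(1)[OF sym_ideal]] by simp

lemma sym_ideal_add: "a \<in> sym_ideal I \<Longrightarrow> b \<in> sym_ideal I \<Longrightarrow> a + b \<in> sym_ideal I"
  using additive_subgroup.a_closed[OF ideal.axioms(1)[OF sym_ideal]] by simp

lemma sym_ideal_mult: "a \<in> sym_ideal I \<Longrightarrow> r \<in> carrier (sym_poly_ring I) \<Longrightarrow> r * a \<in> sym_ideal I"
  using ideal.I_l_closed[OF sym_ideal] by simp

lemma sym_ideal_uminus: "a \<in> sym_ideal I \<Longrightarrow> - a \<in> sym_ideal I"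
  using sym_ideal_mult[OF _ sym_carrier_mconst[of "- 1"]] by simp

lemma linear_form_cong:
  assumes "(\<Sum>i\<in>UNIV. c $ i * f $ i) = (\<Sum>i\<in>UNIV. e $ i * f $ i)"
  shows "linear_form c - linear_form e \<in> G"
proof -
  have "(\<Sum>i\<in>UNIV. (\<chi> i. c $ i - e $ i) $ i * f $ i) = 0"
    using assms by (simp only: vec_lambda_beta left_diff_distrib sum_subtractf) simp
  from syzygy[OF this] show ?thesis
    by (simp only: linear_form_diff)
qed

text \<open>
  A choice of coordinates for the elements of \<open>I\<close>. It is unique up to syzygies, so \<open>e\<^sub>a \<mapsto> \<Sum>\<^sub>i
  c\<^sub>i(a) T\<^sub>i\<close> respects the relations of the symmetric algebra modulo \<open>G\<close>; this gives the inverse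
  of the presentation \<open>T\<^sub>i \<mapsto> e\<^bsub>f\<^sub>i\<^esub>\<close>.
\<close>

definition coeffs :: "(2, 'f) mpoly \<Rightarrow> (2, 'f) mpoly ^ 3" where
  "coeffs a = (SOME c. a = (\<Sum>i\<in>UNIV. c $ i * f $ i))"

lemma coeffs: "a \<in> I \<Longrightarrow> (\<Sum>i\<in>UNIV. coeffs a $ i * f $ i) = a"
  unfolding I_iff coeffs_def by (drule someI_ex) (rule sym)

abbreviation to_S :: "((2, 'f) mpoly, (2, 'f) mpoly) mpoly \<Rightarrow> (3, (2, 'f) mpoly) mpoly" where
  "to_S \<equiv> mpoly_eval mconst (\<lambda>a. linear_form (coeffs a))"

abbreviation of_S :: "(3, (2, 'f) mpoly) mpoly \<Rightarrow> ((2, 'f) mpoly, (2, 'f) mpoly) mpoly" where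
  "of_S \<equiv> mpoly_eval mconst (\<lambda>i. mvar (f $ i))"

lemmas eval_simps = mpoly_eval_add mpoly_eval_mult mpoly_eval_mvar mpoly_eval_mconst

lemma eval_uminus: "mpoly_eval mconst e (- p) = - mpoly_eval mconst e (p :: ('v, 'c::comm_ring_1) mpoly)"
  using mpoly_eval_add[of mconst e p "- p"] by (simp add: eq_neg_iff_add_eq_0 add.commute)

lemma eval_diff:
  "mpoly_eval mconst e (p - q) = mpoly_eval mconst e p - mpoly_eval mconst e (q :: ('v, 'c::comm_ring_1) mpoly)"
  using mpoly_eval_add[of mconst e p "- q"] by (simp add: eval_uminus)

lemma of_S_carrier: "of_S s \<in> carrier (sym_poly_ring I)"
proof (induction s rule: mpoly_induct)
  case (const c)
  show ?case using sym_carrier_mconst[of c I] by (simp add: eval_simps)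
next
  case (var i)
  show ?case using sym_carrier_mvar[OF f_in_I[of i]] by (simp add: eval_simps)
next
  case (add p q)
  then show ?case using sym_carrier_add by (simp add: eval_simps)
next
  case (mult p q)
  then show ?case using sym_carrier_mult by (simp add: eval_simps)
qed

lemma to_S_sym_ideal: "p \<in> sym_ideal I \<Longrightarrow> to_S p \<in> G"
proof -
  let ?K = "{p \<in> carrier (sym_poly_ring I). to_S p \<in> G}"
  have "ideal ?K (sym_poly_ring I)"
    by (rule ideal_sym_poly_ringI)
      (auto simp: sym_carrier_zero_one mpoly_eval_add mpoly_eval_mult
        intro: sym_carrier_add sym_carrier_mult G_add G_mult)
  moreover have "sym_relators I \<subseteq> ?K"
  proof
    fix x
    assume x: "x \<in> sym_relators I"
    then consider a b where "a \<in> I" "b \<in> I" "x = mvar (a + b) - (mvar a + mvar b)"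
      | r a where "a \<in> I" "x = mvar (r * a) - mconst r * mvar a"
      by (auto simp: sym_relators_def)
    then have "to_S x \<in> G"
    proof cases
      case (1 a b)
      have "linear_form (coeffs (a + b)) - linear_form (\<chi> i. coeffs a $ i + coeffs b $ i) \<in> G"
        by (rule linear_form_cong) (simp add: coeffs I_add 1 distrib_right sum.distrib)
      then show ?thesis
        by (simp add: 1 eval_diff eval_simps linear_form_add)
    next
      case (2 r a)
      have "linear_form (coeffs (r * a)) - linear_form (\<chi> i. r * coeffs a $ i) \<in> G"
        by (rule linear_form_cong) (simp add: coeffs I_mult 2 mult.assoc flip: sum_distrib_left)
      then show ?thesis
        by (simp add: 2 eval_diff eval_simps linear_form_scale)
    qed
    then show "x \<in> ?K"
      using x sym_relators_sub sym_ideal_sub by blast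
  qed
  ultimately show "p \<in> sym_ideal I \<Longrightarrow> to_S p \<in> G"
    using sym_ideal_minimal[of ?K] by blast
qed

lemma to_S_of_S: "to_S (of_S s) - s \<in> G"
proof (induction s rule: mpoly_induct)
  case (const c)
  show ?case by (simp add: eval_simps)
next
  case (var i)
  have "linear_form (coeffs (f $ i)) - linear_form (axis i 1) \<in> G"
    by (rule linear_form_cong) (simp add: coeffs f_in_I sum_axis)
  then show ?case by (simp add: eval_simps linear_form_axis)
next
  case (add p q)
  from G_add[OF add] show ?case by (simp add: eval_simps algebra_simps)
next
  case (mult p q)
  from G_add[OF G_mult[OF mult(1), of "to_S (of_S q)"] G_mult[OF mult(2), of p]] show ?case
    by (simp add: eval_simps algebra_simps)
qed

text \<open>
  The linearity relations of the symmetric algebra collapse \<open>\<Sum>\<^sub>i c\<^sub>i e\<^bsub>f\<^sub>i\<^esub>\<close> to the single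
  generator at \<open>\<Sum>\<^sub>i c\<^sub>i f\<^sub>i\<close>. For a syzygy this is the generator at \<open>0\<close>, which is a relation
  itself.
\<close>

lemma of_S_linear_form: "of_S (linear_form c) - mvar (\<Sum>i\<in>UNIV. c $ i * f $ i) \<in> sym_ideal I"
proof -
  have rel1: "mvar (a + b) - (mvar a + mvar b) \<in> sym_ideal I" if "a \<in> I" "b \<in> I" for a b
    using that sym_relators_sub unfolding sym_relators_def by blast
  have rel2: "mvar (r * a) - mconst r * mvar a \<in> sym_ideal I" if "a \<in> I" for a r
    using that sym_relators_sub unfolding sym_relators_def by blast
  let ?x = "\<lambda>i. c $ i * f $ i"
  have "(mvar (?x 1 + ?x 2 + ?x 3) - (mvar (?x 1 + ?x 2) + mvar (?x 3))) +
      (mvar (?x 1 + ?x 2) - (mvar (?x 1) + mvar (?x 2))) +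
      (mvar (?x 1) - mconst (c $ 1) * mvar (f $ 1)) + (mvar (?x 2) - mconst (c $ 2) * mvar (f $ 2)) +
      (mvar (?x 3) - mconst (c $ 3) * mvar (f $ 3)) \<in> sym_ideal I"
    by (intro sym_ideal_add rel1 rel2 I_add I_mult f_in_I)
  from sym_ideal_uminus[OF this] show ?thesis
    by (simp add: linear_form_def sum_3 eval_simps algebra_simps)
qed

lemma of_S_to_S:
  assumes "p \<in> carrier (sym_poly_ring I)"
  shows "of_S (to_S p) - p \<in> sym_ideal I"
proof -
  let ?P = "\<lambda>p. p \<in> carrier (sym_poly_ring I) \<and> of_S (to_S p) - p \<in> sym_ideal I"
  have "?P p"
  proof (rule mpoly_induct_on[of p I ?P])
    show "Poly_Mapping.keys m \<subseteq> I" if "m \<in> Poly_Mapping.keys p" for m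
      using that assms unfolding sym_poly_ring_carrier by blast
    show "?P (mconst c)" for c
      by (simp add: eval_simps sym_ideal_zero sym_carrier_mconst)
    show "?P (mvar a)" if "a \<in> I" for a
      using that of_S_linear_form[of "coeffs a"] by (simp add: eval_simps coeffs sym_carrier_mvar)
    fix p q
    assume p: "?P p" and q: "?P q"
    have "(of_S (to_S p) - p) + (of_S (to_S q) - q) \<in> sym_ideal I"
      using p q by (intro sym_ideal_add) auto
    then show "?P (p + q)"
      using p q by (simp add: eval_simps sym_carrier_add algebra_simps)
    have "of_S (to_S q) * (of_S (to_S p) - p) + p * (of_S (to_S q) - q) \<in> sym_ideal I"
      using p q of_S_carrier by (intro sym_ideal_add sym_ideal_mult) blast+
    then show "?P (p * q)"
      using p q by (simp add: eval_simps sym_carrier_mult algebra_simps)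
  qed
  then show ?thesis ..
qed

text \<open>
  This is the isomorphism of \<open>S/G\<close> with the symmetric algebra: the two substitutions are inverse
  to each other modulo \<open>G\<close> and modulo the relations.
\<close>

lemma of_S_in_sym_ideal_iff: "of_S s \<in> sym_ideal I \<longleftrightarrow> s \<in> G"
proof
  assume "of_S s \<in> sym_ideal I"
  then have "to_S (of_S s) \<in> G"
    by (rule to_S_sym_ideal)
  then show "s \<in> G"
    using G_diff[OF _ to_S_of_S[of s]] by fastforce
next
  have zero: "mvar 0 \<in> sym_ideal I"
  proof -
    have "mvar (0 * f $ 1) - mconst 0 * mvar (f $ 1) \<in> sym_ideal I"
      using f_in_I[of 1] sym_relators_sub unfolding sym_relators_def by blast
    then show ?thesis by simp
  qed
  have gen: "of_S g \<in> sym_ideal I" if g: "g \<in> {g1, g2}" for g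
  proof -
    obtain c where "g = linear_form c" "(\<Sum>i\<in>UNIV. c $ i * f $ i) = 0"
      using g_syzygy[OF g] by blast
    then show ?thesis
      using sym_ideal_add[OF of_S_linear_form[of c] zero] by simp
  qed
  assume "s \<in> G"
  then obtain u v where "s = u * g1 + v * g2"
    by (auto simp: G_def left_ideal2_def)
  then show "of_S s \<in> sym_ideal I"
    by (simp add: eval_simps) (intro sym_ideal_add sym_ideal_mult gen of_S_carrier, auto)
qed

abbreviation "present \<equiv> Sym_presentation f I"

lemma present_eq_iff: "present s = present s' \<longleftrightarrow> s - s' \<in> G"
proof -
  interpret A: cring "sym_poly_ring I" by (rule cring_sym_poly_ring)
  have "of_S s \<ominus>\<^bsub>sym_poly_ring I\<^esub> of_S s' = of_S s - of_S s'"
  proof -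
    have "\<ominus>\<^bsub>sym_poly_ring I\<^esub> of_S s' = - of_S s'"
      using of_S_carrier[of s'] sym_carrier_uminus[OF of_S_carrier[of s']]
      by (intro A.minus_equality) auto
    then show ?thesis by (simp add: a_minus_def)
  qed
  then show ?thesis
    using A.quotient_eq_iff_same_a_r_cos[OF sym_ideal of_S_carrier of_S_carrier, of s s']
      of_S_in_sym_ideal_iff[of "s - s'"]
    by (simp add: Sym_presentation_def eval_diff)
qed

lemma Sym_simps:
  "carrier (Sym I) = range present" "\<zero>\<^bsub>Sym I\<^esub> = present 0"
  "present s \<oplus>\<^bsub>Sym I\<^esub> present s' = present (s + s')"
  "present s \<otimes>\<^bsub>Sym I\<^esub> present s' = present (s * s')"
proof -
  interpret A: cring "sym_poly_ring I" by (rule cring_sym_poly_ring)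
  interpret K: ideal "sym_ideal I" "sym_poly_ring I" by (rule sym_ideal)
  show "carrier (Sym I) = range present"
  proof
    show "range present \<subseteq> carrier (Sym I)"
      using of_S_carrier by (auto simp: Sym_def FactRing_def A_RCOSETS_def' Sym_presentation_def)
    show "carrier (Sym I) \<subseteq> range present"
    proof
      fix X
      assume "X \<in> carrier (Sym I)"
      then obtain p where p: "p \<in> carrier (sym_poly_ring I)" and X: "X = sym_ideal I +>\<^bsub>sym_poly_ring I\<^esub> p"
        by (auto simp: Sym_def FactRing_def A_RCOSETS_def')
      have "p \<ominus>\<^bsub>sym_poly_ring I\<^esub> of_S (to_S p) = p - of_S (to_S p)"
      proof -
        have "\<ominus>\<^bsub>sym_poly_ring I\<^esub> of_S (to_S p) = - of_S (to_S p)"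
          using of_S_carrier sym_carrier_uminus[OF of_S_carrier]
          by (intro A.minus_equality) auto
        then show ?thesis by (simp add: a_minus_def)
      qed
      then have "X = present (to_S p)"
        using A.quotient_eq_iff_same_a_r_cos[OF sym_ideal p of_S_carrier, of "to_S p"]
          sym_ideal_uminus[OF of_S_to_S[OF p]]
        by (simp add: X Sym_presentation_def)
      then show "X \<in> range present" by blast
    qed
  qed
  show "\<zero>\<^bsub>Sym I\<^esub> = present 0"
    using A.a_coset_add_zero[OF sym_ideal_sub]
    by (simp add: Sym_def FactRing_def Sym_presentation_def)
  show "present s \<oplus>\<^bsub>Sym I\<^esub> present s' = present (s + s')"
    using K.a_rcos_sum[OF of_S_carrier of_S_carrier, of s s']
    by (simp add: Sym_def FactRing_def Sym_presentation_def eval_simps)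
  show "present s \<otimes>\<^bsub>Sym I\<^esub> present s' = present (s * s')"
    using K.rcoset_mult_add[OF of_S_carrier of_S_carrier, of s s']
    by (simp add: Sym_def FactRing_def Sym_presentation_def eval_simps)
qed

section \<open>The Rees algebra\<close>

definition rees_eval :: "(3, (2, 'f) mpoly) mpoly \<Rightarrow> (2, 'f) mpoly poly" where
  "rees_eval = mpoly_eval (\<lambda>c. [:c:]) (\<lambda>i. Polynomial.monom (f $ i) 1)"

lemma rees_eval_simps:
  "rees_eval 0 = 0" "rees_eval (s + s') = rees_eval s + rees_eval s'"
  "rees_eval (s * s') = rees_eval s * rees_eval s'" "rees_eval (mconst c) = [:c:]"
  "rees_eval (mvar i) = Polynomial.monom (f $ i) 1"
  by (simp_all add: rees_eval_def mpoly_eval_add mpoly_eval_mult mpoly_eval_mconst mpoly_eval_mvar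
      pCons_one)

lemma rees_eval_linear_form:
  "rees_eval (linear_form c) = Polynomial.monom (\<Sum>i\<in>UNIV. c $ i * f $ i) 1"
  by (simp add: linear_form_def sum_3 rees_eval_simps smult_monom add_monom)

lemma rees_eval_G: "s \<in> G \<Longrightarrow> rees_eval s = 0"
proof -
  have "rees_eval g = 0" if "g \<in> {g1, g2}" for g
    using g_syzygy[OF that] by (auto simp: rees_eval_linear_form)
  then show "s \<in> G \<Longrightarrow> rees_eval s = 0"
    by (auto simp: G_def left_ideal2_def rees_eval_simps)
qed

text \<open>
  The canonical map is defined on a coset by evaluating any representative; it is well defined
  because \<open>a \<mapsto> a t\<close> satisfies the linearity relations.
\<close>

lemma Sym_to_Rees_present: "Sym_to_Rees (present s) = rees_eval s"
proof -
  define ev :: "((2, 'f) mpoly, (2, 'f) mpoly) mpoly \<Rightarrow> _"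
    where "ev = mpoly_eval (\<lambda>c. [:c:]) (\<lambda>a. Polynomial.monom a 1)"
  have ev: "ev 0 = 0" "ev (p + q) = ev p + ev q" "ev (p * q) = ev p * ev q" "ev (mconst c) = [:c:]"
    "ev (mvar a) = Polynomial.monom a 1" for p q c a
    by (simp_all add: ev_def mpoly_eval_add mpoly_eval_mult mpoly_eval_mconst mpoly_eval_mvar pCons_one)
  have uminus: "ev (- p) = - ev p" for p
  proof -
    have "ev (- p) + ev p = ev (- p + p)"
      by (simp only: ev(2))
    then show ?thesis
      using ev(1) by (simp add: eq_neg_iff_add_eq_0)
  qed
  have diff: "ev (p - q) = ev p - ev q" for p q
    by (simp only: diff_conv_add_uminus ev(2) uminus)
  have zero: "ev p = 0" if "p \<in> sym_ideal I" for p
  proof -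
    let ?K = "{p \<in> carrier (sym_poly_ring I). ev p = 0}"
    have "ideal ?K (sym_poly_ring I)"
      by (rule ideal_sym_poly_ringI) (auto simp: ev sym_carrier_zero_one intro: sym_carrier_add sym_carrier_mult)
    moreover have "sym_relators I \<subseteq> ?K"
    proof -
      have "ev x = 0" if "x \<in> sym_relators I" for x
        using that by (auto simp: sym_relators_def diff ev add_monom smult_monom)
      then show ?thesis
        using sym_relators_sub sym_ideal_sub by blast
    qed
    ultimately show ?thesis
      using sym_ideal_minimal[of ?K] that by blast
  qed
  have "ev (of_S s) = rees_eval s"
    by (induction s rule: mpoly_induct) (simp_all add: eval_simps ev rees_eval_simps)
  then have "ev ` present s = {rees_eval s}"
    using sym_ideal_zero
    by (auto simp: Sym_presentation_def a_r_coset_def' ev zero image_iff)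
  then show ?thesis
    by (simp add: Sym_to_Rees_def ev_def)
qed

lemma Rees_kernel_eq: "Rees_kernel I = present ` {s. rees_eval s = 0}"
proof -
  have "\<zero>\<^bsub>Rees I\<^esub> = 0"
    by (simp add: Rees_def type_ring_def)
  then show ?thesis
    by (auto simp: Rees_kernel_def a_kernel_def' Sym_simps(1) Sym_to_Rees_present)
qed

end

section \<open>Forms of degree 2d lie in the ideal\<close>

text \<open>
  Rank and nullity, in the form of a surjectivity criterion: if the kernel on the span of \<open>B\<close>
  has at most \<open>card K\<close> dimensions, the image has at least \<open>card B - card K\<close>, which is enough to
  fill the span of \<open>C\<close>.
\<close>

lemma (in vector_space_pair) linear_image_covers_span:
  assumes f: "Vector_Spaces.linear s1 s2 f" and B: "vs1.independent B"
    and K: "finite K" "\<And>v. v \<in> vs1.span B \<Longrightarrow> f v = 0 \<Longrightarrow> v \<in> vs1.span K"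
    and C: "finite C" "f ` B \<subseteq> vs2.span C"
    and card: "card K + card C \<le> card B"
  shows "vs2.span C \<subseteq> f ` vs1.span B"
proof -
  interpret f: Vector_Spaces.linear s1 s2 f by (rule f)
  have fB: "f ` vs1.span B = vs2.span (f ` B)"
    by (rule f.span_image[symmetric])
  \<comment> \<open>A basis \<open>D\<close> of the image is lifted to \<open>E\<close>; then \<open>K\<close> and \<open>E\<close> together span the source.\<close>
  obtain D where D: "D \<subseteq> f ` vs1.span B" "vs2.independent D" "f ` vs1.span B \<subseteq> vs2.span D"
    using vs2.basis_exists by blast
  have "f ` vs1.span B \<subseteq> vs2.span C"
    unfolding fB using C(2) by (intro vs2.span_minimal) simp_all
  then have DC: "D \<subseteq> vs2.span C"
    using D(1) by blast
  then have finD: "finite D" and cardD: "card D \<le> card C"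
    using vs2.independent_span_bound[OF C(1) D(2)] by blast+
  obtain E where E: "E \<subseteq> vs1.span B" "inj_on f E" "D = f ` E"
    using D(1) subset_image_inj[of D f "vs1.span B"] by blast
  then have "finite E" "card E = card D"
    using finD card_image[OF E(2)] by (simp_all add: finite_image_iff)
  note E = E(1) this(1) E(3) this(2)
  have "B \<subseteq> vs1.span (K \<union> E)"
  proof
    fix v
    assume "v \<in> B"
    then have v: "v \<in> vs1.span B" by (rule vs1.span_base)
    then have "f v \<in> f ` vs1.span E"
      using D(3) unfolding E(3) f.span_image by blast
    then obtain w where w: "w \<in> vs1.span E" "f v = f w" by blast
    have "w \<in> vs1.span B"
      using w(1) E(1) by (meson vs1.span_minimal vs1.subspace_span subsetD)
    then have "v - w \<in> vs1.span K"
      using v w(2) by (intro K(2)) (simp_all add: vs1.span_diff f.diff)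
    then have "v - w \<in> vs1.span (K \<union> E)" "w \<in> vs1.span (K \<union> E)"
      using w(1) vs1.span_mono[of K "K \<union> E"] vs1.span_mono[of E "K \<union> E"] by auto
    then show "v \<in> vs1.span (K \<union> E)"
      using vs1.span_add by fastforce
  qed
  then have "card B \<le> card (K \<union> E)"
    using vs1.independent_span_bound[OF _ B] K(1) E(2) by blast
  also have "\<dots> \<le> card K + card D"
    using card_Un_le[of K E] E(4) by simp
  finally have "card C \<le> card D"
    using card by simp
  have "C \<subseteq> vs2.span D"
  proof
    fix c
    assume c: "c \<in> C"
    show "c \<in> vs2.span D"
    proof (rule ccontr)
      assume not: "c \<notin> vs2.span D"
      then have "vs2.independent (insert c D)"
        using D(2) by (rule vs2.independent_insertI)
      moreover have "insert c D \<subseteq> vs2.span C"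
        using DC vs2.span_base[OF c] by blast
      ultimately have "card (insert c D) \<le> card C"
        using vs2.independent_span_bound[OF C(1)] by blast
      moreover have "c \<notin> D"
        using not vs2.span_base by blast
      ultimately show False
        using finD \<open>card C \<le> card D\<close> by simp
    qed
  qed
  then have "vs2.span C \<subseteq> vs2.span D"
    by (intro vs2.span_minimal) simp_all
  also have "\<dots> \<subseteq> vs2.span (f ` B)"
    using D(1) unfolding fB by (intro vs2.span_minimal) simp_all
  finally show ?thesis
    unfolding fB .
qed

definition monomials :: "nat \<Rightarrow> (2 \<Rightarrow>\<^sub>0 nat) set" where
  "monomials n = {m. mdeg m = int n}"

lemma mdeg_2: "mdeg (m :: 2 \<Rightarrow>\<^sub>0 nat) = int (Poly_Mapping.lookup m 1) + int (Poly_Mapping.lookup m 2)"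
proof -
  have "mdeg m = (\<Sum>v\<in>UNIV. int (Poly_Mapping.lookup m v))"
    by (rule mdeg_superset) auto
  then show ?thesis by (simp add: UNIV_2)
qed

lemma card_monomials: "finite (monomials n)" "card (monomials n) = n + 1"
proof -
  define e where "e k = Poly_Mapping.single 1 k + Poly_Mapping.single (2::2) (n - k)" for k
  have e: "Poly_Mapping.lookup (e k) 1 = k" "Poly_Mapping.lookup (e k) 2 = n - k" for k
    by (simp_all add: e_def lookup_add lookup_single)
  have "monomials n = e ` {..n}"
  proof
    show "e ` {..n} \<subseteq> monomials n"
      by (auto simp: monomials_def mdeg_2 e)
    show "monomials n \<subseteq> e ` {..n}"
    proof
      fix m
      assume "m \<in> monomials n"
      then have *: "Poly_Mapping.lookup m 1 + Poly_Mapping.lookup m 2 = n"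
        by (simp add: monomials_def mdeg_2)
      then have "m = e (Poly_Mapping.lookup m 1)"
        by (intro poly_mapping_eqI) (metis e exhaust_2 add_diff_cancel_left')
      then show "m \<in> e ` {..n}"
        using * by (intro image_eqI[of _ e "Poly_Mapping.lookup m 1"]) auto
    qed
  qed
  moreover have "inj e"
    by (rule injI) (metis e(1))
  ultimately show "finite (monomials n)" "card (monomials n) = n + 1"
    by (simp_all add: card_image inj_on_subset)
qed

lemma homogeneous_expansion:
  fixes p :: "(2, 'c::comm_ring_1) mpoly"
  assumes "homogeneous (int n) p"
  shows "p = (\<Sum>m\<in>monomials n. mconst (Poly_Mapping.lookup p m) * Poly_Mapping.single m 1)"
proof (rule poly_mapping_eqI)
  fix k
  have "Poly_Mapping.lookup p k = (if k \<in> monomials n then Poly_Mapping.lookup p k else 0)"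
    using assms by (auto simp: homogeneous_def in_keys_iff monomials_def)
  also have "\<dots> = (\<Sum>m\<in>monomials n. if m = k then Poly_Mapping.lookup p m else 0)"
    by (simp add: card_monomials(1))
  also have "\<dots> = (\<Sum>m\<in>monomials n. Poly_Mapping.lookup p m * (1 when m = k))"
    by (intro sum.cong) simp_all
  finally show "Poly_Mapping.lookup p k = Poly_Mapping.lookup
      (\<Sum>m\<in>monomials n. mconst (Poly_Mapping.lookup p m) * Poly_Mapping.single m 1) k"
    by (simp add: lookup_sum lookup_mconst_mult lookup_single)
qed

definition coeff_scale :: "'f::comm_ring_1 \<Rightarrow> ('v, 'f) mpoly \<Rightarrow> ('v, 'f) mpoly" where
  "coeff_scale c p = mconst c * p"

definition vec_scale :: "'f::comm_ring_1 \<Rightarrow> ('v, 'f) mpoly ^ 'n \<Rightarrow> ('v, 'f) mpoly ^ 'n" where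
  "vec_scale c v = (\<chi> i. mconst c * v $ i)"

lemma vector_space_coeff_scale: "vector_space (coeff_scale :: 'f::field \<Rightarrow> ('v, 'f) mpoly \<Rightarrow> _)"
  by unfold_locales (simp_all add: coeff_scale_def algebra_simps)

lemma vector_space_vec_scale: "vector_space (vec_scale :: 'f::field \<Rightarrow> ('v, 'f) mpoly ^ 'n \<Rightarrow> _)"
  by unfold_locales (simp_all add: vec_scale_def algebra_simps vec_eq_iff)

text \<open>
  A dimension count on the resolution in degree \<open>2 d\<close>. Multiplication by \<open>(f\<^sub>1, f\<^sub>2, f\<^sub>3)\<close> maps
  the space of triples of forms of degree \<open>d\<close>, of dimension \<open>3 (d + 1)\<close>, to the forms of degree
  \<open>2 d\<close>, of dimension \<open>2 d + 1\<close>. By exactness its kernel is the image under \<open>\<phi>\<close> of pairs of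
  forms of degrees \<open>d - \<mu>\<close> and \<open>\<mu>\<close>, so its dimension is at most \<open>d + 2\<close>, and \<open>3 (d + 1) - (d +
  2) = 2 d + 1\<close>.
\<close>

lemma hilbert_burch_generates:
  fixes f :: "(2, 'f::field) mpoly ^ 3"
  assumes hb: "hilbert_burch f d \<mu> \<phi>" and deg: "\<And>i. homogeneous d (f $ i)"
    and ord: "0 \<le> \<mu>" "\<mu> \<le> d" and p: "homogeneous (2 * d) p"
  shows "\<exists>c. p = (\<Sum>i\<in>UNIV. c $ i * f $ i)"
proof -
  interpret R3: vector_space "vec_scale :: 'f \<Rightarrow> (2, 'f) mpoly ^ 3 \<Rightarrow> _"
    by (rule vector_space_vec_scale)
  interpret R: vector_space "coeff_scale :: 'f \<Rightarrow> (2, 'f) mpoly \<Rightarrow> _"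
    by (rule vector_space_coeff_scale)
  interpret pair: vector_space_pair "vec_scale :: 'f \<Rightarrow> (2, 'f) mpoly ^ 3 \<Rightarrow> _"
    "coeff_scale :: 'f \<Rightarrow> (2, 'f) mpoly \<Rightarrow> _" ..
  define n where "n = nat d"
  define k where "k = nat \<mu>"
  have n: "d = int n" and k: "\<mu> = int k" and nk: "d - \<mu> = int (n - k)" and kn: "k \<le> n"
    using ord by (auto simp: n_def k_def)
  define F where "F v = (\<Sum>i\<in>UNIV. v $ i * f $ i)" for v
  have linF: "Vector_Spaces.linear vec_scale coeff_scale F"
    by unfold_locales
      (simp_all add: F_def vec_scale_def coeff_scale_def distrib_right sum.distrib sum_distrib_left
        mult.assoc)
  define b where "b = (\<lambda>(i :: 3, m :: 2 \<Rightarrow>\<^sub>0 nat). axis i (Poly_Mapping.single m (1 :: 'f)))"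
  have lookup_b: "Poly_Mapping.lookup (b x $ i) m = of_bool (x = (i, m))" for x i m
    by (auto simp: b_def axis_def lookup_single when_def split: prod.splits)
  have inj_b: "inj b"
  proof (rule injI)
    fix x y
    assume "b x = b y"
    then have "Poly_Mapping.lookup (b x $ fst y) (snd y) = Poly_Mapping.lookup (b y $ fst y) (snd y)"
      by simp
    then show "x = y"
      by (simp add: lookup_b)
  qed
  define B where "B = b ` (UNIV \<times> monomials n)"
  have finB: "finite B" and cardB: "card B = 3 * (n + 1)"
    using card_image[OF inj_on_subset[OF inj_b], of "UNIV \<times> monomials n"]
    by (simp_all add: B_def card_monomials card_cartesian_product)
  have indB: "R3.independent B"
  proof (rule R3.independent_if_scalars_zero[OF finB])
    fix u v
    assume sum: "(\<Sum>v\<in>B. vec_scale (u v) v) = 0" and "v \<in> B"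
    then obtain i m where v: "v = b (i, m)" and im: "(i, m) \<in> UNIV \<times> monomials n"
      by (auto simp: B_def)
    have "0 = Poly_Mapping.lookup ((\<Sum>v\<in>B. vec_scale (u v) v) $ i) m"
      by (simp add: sum)
    also have "\<dots> = (\<Sum>x\<in>UNIV \<times> monomials n. u (b x) * Poly_Mapping.lookup (b x $ i) m)"
      by (simp add: B_def sum.reindex inj_on_subset[OF inj_b] lookup_sum vec_scale_def
          lookup_mconst_mult)
    also have "\<dots> = (\<Sum>x\<in>UNIV \<times> monomials n. if x = (i, m) then u (b x) else 0)"
      by (intro sum.cong) (simp_all add: lookup_b)
    also have "\<dots> = u v"
      using im by (simp add: v sum.delta card_monomials)
    finally show "u v = 0" by simp
  qed
  define kap where "kap j m = \<phi> *v axis j (Poly_Mapping.single m (1 :: 'f))" for j m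
  define K where "K = kap 1 ` monomials (n - k) \<union> kap 2 ` monomials k"
  have finK: "finite K"
    by (simp add: K_def card_monomials)
  have cardK: "card K \<le> n + 2"
  proof -
    have "card K \<le> card (kap 1 ` monomials (n - k)) + card (kap 2 ` monomials k)"
      unfolding K_def by (rule card_Un_le)
    also have "\<dots> \<le> (n - k + 1) + (k + 1)"
      using card_image_le[OF card_monomials(1), of "kap 1" "n - k"]
        card_image_le[OF card_monomials(1), of "kap 2" k] by (simp add: card_monomials)
    finally show ?thesis using kn by simp
  qed
  have col: "\<phi> *v axis j q \<in> R3.span K"
    if q: "homogeneous (int l) q" and K: "kap j ` monomials l \<subseteq> K" for j l q
  proof -
    have "\<phi> *v axis j q = (\<Sum>m\<in>monomials l. vec_scale (Poly_Mapping.lookup q m) (kap j m))"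
    proof -
      have col: "(\<phi> *v axis j r) $ i = \<phi> $ i $ j * r" for r i
        by (simp add: matrix_vector_mult_def axis_def if_distrib[of "(*) _"] cong: if_cong)
      show ?thesis
        by (subst homogeneous_expansion[OF q])
          (simp add: vec_eq_iff kap_def vec_scale_def col sum_distrib_left mult_ac)
    qed
    also have "\<dots> \<in> R3.span K"
      using K by (intro R3.span_sum R3.span_scale R3.span_base) auto
    finally show ?thesis .
  qed
  have ker: "v \<in> R3.span K" if "v \<in> R3.span B" "F v = 0" for v
  proof -
    have hom: "homogeneous (int n) (v $ i)" for i
      using that(1)
    proof (induction rule: R3.span_induct_alt)
      case (step c x y)
      have "homogeneous (int n) (x $ i)"
        using step(1)
        by (auto simp: B_def b_def axis_def homogeneous_def monomials_def split: if_splits)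
      then show ?case
        using step(2) by (auto simp: vec_scale_def intro: homogeneous_add homogeneous_mconst_mult)
    qed simp
    have "v \<in> range (\<lambda>c. \<phi> *v c)"
      using that(2) hb unfolding hilbert_burch_def F_def by (metis (mono_tags) mem_Collect_eq)
    then obtain c where c: "v = \<phi> *v c"
      by blast
    \<comment> \<open>Exactness gives a preimage that need not be homogeneous; its components of the right degrees
      suffice because the columns of \<open>\<phi>\<close> are homogeneous.\<close>
    have "v = \<phi> *v axis 1 (hom_component (int (n - k)) (c $ 1)) + \<phi> *v axis 2 (hom_component (int k) (c $ 2))"
    proof (subst vec_eq_iff, rule allI)
      fix i
      have 1: "homogeneous (int k) (\<phi> $ i $ 1)" and 2: "homogeneous (int (n - k)) (\<phi> $ i $ 2)"
        using hb nk k by (simp_all add: hilbert_burch_def)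
      have "v $ i = hom_component (int n) (v $ i)"
        by (simp add: hom_component_homogeneous hom)
      also have "\<dots> = hom_component (int (n - k) + int k) (c $ 1 * \<phi> $ i $ 1) +
          hom_component (int k + int (n - k)) (c $ 2 * \<phi> $ i $ 2)"
        using kn by (simp add: c matrix_vector_mult_def UNIV_2 hom_component_add mult.commute)
      also have "\<dots> = hom_component (int (n - k)) (c $ 1) * \<phi> $ i $ 1 + hom_component (int k) (c $ 2) * \<phi> $ i $ 2"
        by (simp only: hom_component_mult_homogeneous[OF 1] hom_component_mult_homogeneous[OF 2])
      finally show "v $ i = (\<phi> *v axis 1 (hom_component (int (n - k)) (c $ 1)) +
          \<phi> *v axis 2 (hom_component (int k) (c $ 2))) $ i"
        by (simp add: matrix_vector_mult_def UNIV_2 axis_def mult.commute)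
    qed
    also have "\<dots> \<in> R3.span K"
      by (intro R3.span_add col[OF homogeneous_hom_component]) (auto simp: K_def)
    finally show ?thesis .
  qed
  define C where "C = (\<lambda>m. Poly_Mapping.single m (1 :: 'f)) ` monomials (2 * n)"
  have finC: "finite C" and cardC: "card C \<le> 2 * n + 1"
    using card_image_le[OF card_monomials(1), of "\<lambda>m. Poly_Mapping.single m (1 :: 'f)" "2 * n"]
    by (simp_all add: C_def card_monomials)
  have spanC: "q \<in> R.span C" if "homogeneous (int (2 * n)) q" for q
  proof -
    have "(\<Sum>m\<in>monomials (2 * n). coeff_scale (Poly_Mapping.lookup q m) (Poly_Mapping.single m 1))
        \<in> R.span C"
      by (intro R.span_sum R.span_scale R.span_base) (auto simp: C_def)
    then show ?thesis
      using homogeneous_expansion[OF that] by (simp add: coeff_scale_def)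
  qed
  have FB: "F ` B \<subseteq> R.span C"
  proof
    fix q
    assume "q \<in> F ` B"
    then obtain i m where m: "m \<in> monomials n" and q: "q = F (b (i, m))"
      by (auto simp: B_def)
    have "q = Poly_Mapping.single m 1 * f $ i"
      by (simp add: q F_def b_def axis_def if_distrib[of "\<lambda>x. x * _"] cong: if_cong)
    moreover have "homogeneous d (Poly_Mapping.single m (1 :: 'f))"
      using m n by (simp add: homogeneous_def monomials_def)
    ultimately have "homogeneous (int (2 * n)) q"
      using homogeneous_mult[OF _ deg[of i]] n by (metis mult_2 of_nat_add)
    then show "q \<in> R.span C"
      by (rule spanC)
  qed
  have "R.span C \<subseteq> F ` R3.span B"
    using cardB cardC cardK
    by (intro pair.linear_image_covers_span[OF linF indB finK ker finC FB]) auto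
  moreover have "p \<in> R.span C"
    using p n by (intro spanC) simp
  ultimately show ?thesis
    by (auto simp: F_def)
qed

text \<open>
  Powers of both variables in \<open>I\<close> say that \<open>I\<close> contains a power of the irrelevant ideal, so that
  torsion with respect to \<open>I\<close> and with respect to the variables agree.
\<close>

locale graded_syzygy_module = syzygy_module g1 g2 f I
  for g1 g2 :: "(3, (2, 'f::field_char_0) mpoly) mpoly" and f :: "(2, 'f) mpoly ^ 3"
    and I :: "(2, 'f) mpoly set" +
  fixes d :: int
  assumes degree: "\<And>i. homogeneous d (f $ i)"
    and power_in_I: "\<And>i. \<exists>n. mvar i ^ n \<in> I"
begin

section \<open>The kernel of Sym(I) to Rees(I) is the torsion\<close>

lemma G_cong_mult:
  assumes "x - y \<in> G" "x' - y' \<in> G"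
  shows "x * x' - y * y' \<in> G"
proof -
  have "x' * (x - y) + y * (x' - y') \<in> G"
    by (intro G_add G_mult assms)
  then show ?thesis
    by (simp add: algebra_simps)
qed

lemma G_cong_power: "x - y \<in> G \<Longrightarrow> x ^ n - y ^ n \<in> G"
  by (induction n) (simp_all add: G_cong_mult)

text \<open>
  For \<open>h = \<Sum>\<^sub>i c\<^sub>i f\<^sub>i\<close> in \<open>I\<close>, with \<open>T\<^sub>h = \<Sum>\<^sub>i c\<^sub>i T\<^sub>i\<close>, the linear form \<open>h T\<^sub>i - f\<^sub>i T\<^sub>h\<close>
  comes from a syzygy. So modulo \<open>G\<close> each factor \<open>h T\<^sub>i\<close> may be exchanged for \<open>f\<^sub>i T\<^sub>h\<close>.
\<close>

lemma ideal_exchange: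
  assumes h: "h = (\<Sum>i\<in>UNIV. c $ i * f $ i)"
  shows "mconst h ^ nat (mdeg m) * mono_eval mvar m -
    mconst (mono_eval (\<lambda>i. f $ i) m) * linear_form c ^ nat (mdeg m) \<in> G"
proof (induction m rule: poly_mapping_additive_induct)
  case zero
  show ?case by simp
next
  case (single i n)
  have "(\<Sum>k\<in>UNIV. axis i h $ k * f $ k) = (\<Sum>k\<in>UNIV. (\<chi> k. f $ i * c $ k) $ k * f $ k)"
    unfolding sum_axis by (simp add: h sum_distrib_left sum_distrib_right mult_ac)
  from linear_form_cong[OF this]
  have "mconst h * mvar i - mconst (f $ i) * linear_form c \<in> G"
    by (simp add: linear_form_axis linear_form_scale)
  from G_cong_power[OF this, of n] show ?case
    by (simp add: mono_eval_single power_mult_distrib)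
next
  case (add k l)
  from G_cong_mult[OF add] show ?case
    by (simp add: mdeg_add nat_add_distrib power_add mono_eval_add mult_ac)
qed

lemma mono_eval_monom:
  "mono_eval (\<lambda>i. Polynomial.monom (f $ i) 1) m = Polynomial.monom (mono_eval (\<lambda>i. f $ i) m) (nat (mdeg m))"
  by (induction m rule: poly_mapping_additive_induct)
    (simp_all add: mono_eval_single monom_power mono_eval_add mult_monom mdeg_add nat_add_distrib
      flip: one_poly_eq_simps)

lemma rees_eval_expansion:
  "rees_eval s = (\<Sum>m\<in>Poly_Mapping.keys s.
    Polynomial.monom (Poly_Mapping.lookup s m * mono_eval (\<lambda>i. f $ i) m) (nat (mdeg m)))"
  by (simp add: rees_eval_def mpoly_eval_alt mono_eval_monom[simplified] smult_monom)

text \<open>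
  The exchange turns \<open>h\<^sup>N s(T)\<close> into \<open>s(f t)\<close> with \<open>t\<^sup>n\<close> replaced by \<open>h\<^bsup>N - n\<^esup> T\<^sub>h\<^sup>n\<close>, and \<open>s(f
  t)\<close> is the image of \<open>s\<close> in the Rees algebra.
\<close>

lemma rees_eval_zero_torsion:
  assumes "rees_eval s = 0" "h \<in> I"
  shows "\<exists>n. mconst h ^ n * s \<in> G"
proof -
  obtain c where h: "h = (\<Sum>i\<in>UNIV. c $ i * f $ i)"
    using assms(2) I_iff by blast
  let ?T = "linear_form c" and ?K = "Poly_Mapping.keys s" and ?s = "Poly_Mapping.lookup s"
    and ?d = "\<lambda>m :: 3 \<Rightarrow>\<^sub>0 nat. nat (mdeg m)" and ?f = "mono_eval (\<lambda>i. f $ i)"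
  define N where "N = Max (insert 0 (?d ` ?K))"
  have N: "?d m \<le> N" if "m \<in> ?K" for m
    using that unfolding N_def by (intro Max_ge) auto
  \<comment> \<open>This is the replacement of the powers of \<open>t\<close>; \<open>N\<close> bounds the degrees in \<open>t\<close> that occur.\<close>
  define H where "H q = (\<Sum>n\<le>N. mconst (h ^ (N - n) * poly.coeff q n) * ?T ^ n)" for q
  have H_zero: "H 0 = 0"
    by (simp add: H_def)
  have H_add: "H (q + q') = H q + H q'" for q q'
    by (simp add: H_def distrib_left distrib_right sum.distrib)
  have H_sum: "H (\<Sum>m\<in>A. q m) = (\<Sum>m\<in>A. H (q m))" for A and q :: "(3 \<Rightarrow>\<^sub>0 nat) \<Rightarrow> _"
    by (induction A rule: infinite_finite_induct) (simp_all add: H_zero H_add)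
  have H_monom: "H (Polynomial.monom a n) = mconst (h ^ (N - n) * a) * ?T ^ n" if "n \<le> N" for a n
  proof -
    have "H (Polynomial.monom a n) = (\<Sum>k\<le>N. if k = n then mconst (h ^ (N - n) * a) * ?T ^ n else 0)"
      unfolding H_def by (intro sum.cong) (auto simp: coeff_monom)
    then show ?thesis
      using that by simp
  qed
  have "(\<Sum>m\<in>?K. mconst (h ^ (N - ?d m) * ?s m) *
      (mconst h ^ ?d m * mono_eval mvar m - mconst (?f m) * ?T ^ ?d m)) \<in> G"
    unfolding G_def by (intro left_ideal2_sum left_ideal2_mult ideal_exchange[OF h, unfolded G_def])
  also have "(\<Sum>m\<in>?K. mconst (h ^ (N - ?d m) * ?s m) *
      (mconst h ^ ?d m * mono_eval mvar m - mconst (?f m) * ?T ^ ?d m)) =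
      (\<Sum>m\<in>?K. mconst h ^ N * (mconst (?s m) * mono_eval mvar m) -
        H (Polynomial.monom (?s m * ?f m) (?d m)))"
  proof (intro sum.cong refl)
    fix m
    assume m: "m \<in> ?K"
    have "mconst h ^ (N - ?d m) * mconst h ^ ?d m = (mconst h ^ N :: (3, (2, 'f) mpoly) mpoly)"
      using N[OF m] by (simp flip: power_add)
    then have 1: "mconst h ^ N * (mconst (?s m) * mono_eval mvar m) =
        mconst (h ^ (N - ?d m) * ?s m) * (mconst h ^ ?d m * mono_eval mvar m)"
      by (metis (no_types, lifting) mconst_power mconst_simps(6) mult.assoc mult.left_commute)
    have 2: "H (Polynomial.monom (?s m * ?f m) (?d m)) =
        mconst (h ^ (N - ?d m) * ?s m) * (mconst (?f m) * ?T ^ ?d m)"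
      using N[OF m] by (simp add: H_monom mult.assoc)
    show "mconst (h ^ (N - ?d m) * ?s m) *
        (mconst h ^ ?d m * mono_eval mvar m - mconst (?f m) * ?T ^ ?d m) =
        mconst h ^ N * (mconst (?s m) * mono_eval mvar m) - H (Polynomial.monom (?s m * ?f m) (?d m))"
      by (simp only: right_diff_distrib 1 2)
  qed
  also have "\<dots> = mconst h ^ N * mpoly_eval mconst mvar s - H (rees_eval s)"
    by (simp add: sum_subtractf mpoly_eval_alt rees_eval_expansion H_sum sum_distrib_left)
  also have "\<dots> = mconst h ^ N * s"
    by (simp add: mpoly_eval_mconst_mvar assms(1) H_zero)
  finally show ?thesis ..
qed

text \<open>
  The Rees algebra lies in the domain \<open>R[t]\<close>, so torsion maps to zero.
\<close>

lemma torsion_rees_eval_zero: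
  assumes "mconst (mvar i) ^ n * s \<in> G"
  shows "rees_eval s = 0"
proof -
  have "rees_eval (mconst (mvar i ^ n) * s) = 0"
    using assms by (simp add: rees_eval_G)
  then have "[:mvar i ^ n:] * rees_eval s = 0"
    by (simp only: rees_eval_simps)
  moreover have "mvar i ^ n \<noteq> (0 :: (2, 'f) mpoly)"
    by (metis mvar_power lookup_single_eq lookup_zero zero_neq_one)
  ultimately show ?thesis
    by (metis mult_eq_0_iff pCons_eq_0_iff)
qed

lemma rees_eval_zero_iff: "rees_eval s = 0 \<longleftrightarrow> (\<forall>i. \<exists>n. mconst (mvar i) ^ n * s \<in> G)"
proof
  assume s: "rees_eval s = 0"
  show "\<forall>i. \<exists>n. mconst (mvar i) ^ n * s \<in> G"
  proof
    fix i
    obtain k where "mvar i ^ k \<in> I"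
      using power_in_I by blast
    from rees_eval_zero_torsion[OF s this] obtain n where "mconst (mvar i ^ k) ^ n * s \<in> G" ..
    then have "mconst (mvar i) ^ (k * n) * s \<in> G"
      by (simp add: power_mult)
    then show "\<exists>n. mconst (mvar i) ^ n * s \<in> G" ..
  qed
qed (use torsion_rees_eval_zero in blast)

lemma rees_eval_uminus: "rees_eval (- s) = - rees_eval s"
  using rees_eval_simps(2)[of "- s" s] by (simp add: rees_eval_simps(1) eq_neg_iff_add_eq_0)

lemma rees_eval_diff: "rees_eval (s - s') = rees_eval s - rees_eval s'"
  by (simp only: diff_conv_add_uminus rees_eval_simps rees_eval_uminus)

section \<open>The graded pieces of the kernel\<close>

text \<open>
  Since the \<open>f\<^sub>i\<close> have degree \<open>d\<close>, the map to \<open>R[t]\<close> shifts the \<open>x\<close>-degree by \<open>n d\<close> in front of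
  \<open>t\<^sup>n\<close>. Hence its kernel contains the \<open>x\<close>-components of each of its elements.
\<close>

lemma coeff_rees_eval_hom_component:
  "poly.coeff (rees_eval (Poly_Mapping.map (hom_component q) s)) n = hom_component (q + int n * d) (poly.coeff (rees_eval s) n)"
proof (induction s rule: poly_mapping_additive_induct)
  case zero
  show ?case by (simp add: rees_eval_simps)
next
  case (single m c)
  have single: "rees_eval (Poly_Mapping.single m b) =
      Polynomial.monom (b * mono_eval (\<lambda>i. f $ i) m) (nat (mdeg m))" for b
    by (cases "b = 0") (simp_all add: rees_eval_expansion)
  have "homogeneous (int (nat (mdeg m)) * d) (mono_eval (\<lambda>i. f $ i) m)"
    using homogeneous_mono_eval[of d "\<lambda>i. f $ i" m] degree by simp
  from hom_component_mult_homogeneous[OF this] show ?case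
    by (auto simp: single coeff_monom)
next
  case (add a b)
  then show ?case
    by (simp add: map_zero_add hom_component_add rees_eval_simps)
qed

lemma rees_eval_hom_component_zero: "rees_eval s = 0 \<Longrightarrow> rees_eval (Poly_Mapping.map (hom_component q) s) = 0"
  by (rule poly_eqI) (simp add: coeff_rees_eval_hom_component)

lemma sum_hom_component:
  obtains Q where "finite Q" "s = (\<Sum>q\<in>Q. Poly_Mapping.map (hom_component q) s)"
proof
  let ?Q = "\<Union>m\<in>Poly_Mapping.keys s. mdeg ` Poly_Mapping.keys (Poly_Mapping.lookup s m)"
  show "finite ?Q" by simp
  show "s = (\<Sum>q\<in>?Q. Poly_Mapping.map (hom_component q) s)"
  proof (intro poly_mapping_eqI)
    fix m k
    have "(\<Sum>q\<in>?Q. Poly_Mapping.lookup (hom_component q (Poly_Mapping.lookup s m)) k) =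
        (\<Sum>q\<in>?Q. if q = mdeg k then Poly_Mapping.lookup (Poly_Mapping.lookup s m) k else 0)"
      by (intro sum.cong) (auto simp: lookup_hom_component when_def)
    also have "\<dots> = Poly_Mapping.lookup (Poly_Mapping.lookup s m) k"
    proof (cases "Poly_Mapping.lookup (Poly_Mapping.lookup s m) k = 0")
      case False
      then have "k \<in> Poly_Mapping.keys (Poly_Mapping.lookup s m)"
        by (simp add: in_keys_iff)
      moreover from this have "m \<in> Poly_Mapping.keys s"
        by (auto simp: in_keys_iff)
      ultimately show ?thesis
        by auto
    qed simp
    finally show "Poly_Mapping.lookup (Poly_Mapping.lookup s m) k =
        Poly_Mapping.lookup (Poly_Mapping.lookup (\<Sum>q\<in>?Q. Poly_Mapping.map (hom_component q) s) m) k"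
      by (simp add: lookup_sum lookup_map_zero)
  qed
qed

lemma ring_Sym: "ring (Sym I)"
  unfolding Sym_def by (rule ideal.quotient_is_ring[OF sym_ideal])

lemma K_bidegree_eq:
  "K_bidegree f I p q = present ` {s. bihomogeneous p q s \<and> rees_eval s = 0}"
proof -
  have "rees_eval s = 0" if "present s = present s'" "rees_eval s' = 0" for s s'
    using rees_eval_G[of "s - s'"] that by (simp add: present_eq_iff rees_eval_diff)
  then show ?thesis
    by (auto simp: K_bidegree_def Rees_kernel_eq)
qed

text \<open>
  The sum over all \<open>x\<close>-degrees of the bigraded pieces is everything of \<open>T\<close>-degree \<open>p\<close> in the
  kernel, because the kernel is bigraded.
\<close>

lemma K_degree_eq: "K_degree f I p = present ` {s. homogeneous p s \<and> rees_eval s = 0}"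
proof -
  interpret S: ring "Sym I" by (rule ring_Sym)
  let ?P = "present ` {s. homogeneous p s \<and> rees_eval s = 0}"
  have "subgroup ?P (add_monoid (Sym I))"
  proof (rule S.add.subgroupI)
    show "?P \<subseteq> carrier (Sym I)" by (auto simp: Sym_simps)
    show "?P \<noteq> {}" using rees_eval_simps(1) homogeneous_zero by blast
  next
    fix X
    assume "X \<in> ?P"
    then obtain s where s: "X = present s" "homogeneous p s" "rees_eval s = 0" by blast
    have "\<ominus>\<^bsub>Sym I\<^esub> X = present (- s)"
      by (rule S.minus_equality) (simp_all add: s Sym_simps)
    moreover have "homogeneous p (- s)"
      using s(2) by (simp add: homogeneous_def in_keys_iff)
    ultimately show "\<ominus>\<^bsub>Sym I\<^esub> X \<in> ?P"
      using s(3) rees_eval_uminus[of s] by auto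
  next
    fix X Y
    assume "X \<in> ?P" "Y \<in> ?P"
    then obtain s t where "X = present s" "homogeneous p s" "rees_eval s = 0"
      "Y = present t" "homogeneous p t" "rees_eval t = 0" by blast
    then show "X \<oplus>\<^bsub>Sym I\<^esub> Y \<in> ?P"
      by (auto simp: Sym_simps rees_eval_simps intro!: imageI homogeneous_add)
  qed
  moreover have "(\<Union>q. K_bidegree f I p q) \<subseteq> ?P"
    by (auto simp: K_bidegree_eq bihomogeneous_def homogeneous_def)
  ultimately have "K_degree f I p \<subseteq> ?P"
    unfolding K_degree_def by (intro S.add.generate_subgroup_incl)
  moreover have "present s \<in> K_degree f I p" if s: "homogeneous p s" "rees_eval s = 0" for s
  proof -
    let ?c = "\<lambda>q. Poly_Mapping.map (hom_component q) s"
    obtain Q where Q: "finite Q" "s = (\<Sum>q\<in>Q. ?c q)"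
      using sum_hom_component by blast
    have comp: "present (?c q) \<in> K_degree f I p" for q
    proof -
      have "bihomogeneous p q (?c q)"
        using homogeneous_map[OF s(1), of "hom_component q"] homogeneous_hom_component
        by (auto simp: bihomogeneous_def homogeneous_def[of p] lookup_map_zero)
      then have "present (?c q) \<in> K_bidegree f I p q"
        using rees_eval_hom_component_zero[OF s(2)] by (auto simp: K_bidegree_eq)
      then show ?thesis
        unfolding K_degree_def by (intro generate.incl) blast
    qed
    have "present (\<Sum>q\<in>A. ?c q) \<in> K_degree f I p" if "finite A" for A
      using that
    proof (induction A rule: finite_induct)
      case empty
      show ?case
        using generate.one[of "add_monoid (Sym I)" "\<Union>q. K_bidegree f I p q"]
        by (simp add: K_degree_def Sym_simps)
    next
      case (insert q A)
      then show ?case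
        using generate.eng[of "present (?c q)" "add_monoid (Sym I)" "\<Union>q. K_bidegree f I p q"
            "present (\<Sum>q\<in>A. ?c q)"] comp[of q]
        by (simp add: K_degree_def Sym_simps)
    qed
    from this[OF Q(1)] show ?thesis
      using Q(2) by simp
  qed
  ultimately show ?thesis by blast
qed

section \<open>Horizontal classes and their constant symbols\<close>

lemma J_coset_eq: "J +>\<^bsub>type_ring\<^esub> t = J +>\<^bsub>type_ring\<^esub> t' \<longleftrightarrow> t - t' \<in> J"
proof
  assume "J +>\<^bsub>type_ring\<^esub> t = J +>\<^bsub>type_ring\<^esub> t'"
  moreover have "t \<in> J +>\<^bsub>type_ring\<^esub> t"
    by (auto simp: a_r_coset_def' J_def intro!: bexI[of _ 0])
  ultimately show "t - t' \<in> J"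
    by (auto simp: a_r_coset_def')
next
  have sub: "J +>\<^bsub>type_ring\<^esub> u \<subseteq> J +>\<^bsub>type_ring\<^esub> u'" if "u - u' \<in> J" for u u'
  proof
    fix x
    assume "x \<in> J +>\<^bsub>type_ring\<^esub> u"
    then obtain j where "j \<in> J" "x = j + u"
      by (auto simp: a_r_coset_def')
    then have "j + (u - u') \<in> J" "x = (j + (u - u')) + u'"
      using that by (auto simp: J_def intro: left_ideal2_add)
    then show "x \<in> J +>\<^bsub>type_ring\<^esub> u'"
      unfolding a_r_coset_def' type_ring_simps by blast
  qed
  assume "t - t' \<in> J"
  moreover from this have "t' - t \<in> J"
    unfolding J_def using left_ideal2_uminus by fastforce
  ultimately show "J +>\<^bsub>type_ring\<^esub> t = J +>\<^bsub>type_ring\<^esub> t'"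
    using sub by blast
qed

lemma J_coset_zero: "J +>\<^bsub>type_ring\<^esub> 0 = J"
  by (auto simp: a_r_coset_def')

lemma J_coset_add:
  "(J +>\<^bsub>type_ring\<^esub> t) <+>\<^bsub>type_ring\<^esub> (J +>\<^bsub>type_ring\<^esub> t') = J +>\<^bsub>type_ring\<^esub> (t + t')"
proof
  show "(J +>\<^bsub>type_ring\<^esub> t) <+>\<^bsub>type_ring\<^esub> (J +>\<^bsub>type_ring\<^esub> t') \<subseteq> J +>\<^bsub>type_ring\<^esub> (t + t')"
  proof
    fix x
    assume "x \<in> (J +>\<^bsub>type_ring\<^esub> t) <+>\<^bsub>type_ring\<^esub> (J +>\<^bsub>type_ring\<^esub> t')"
    then obtain j j' where "j \<in> J" "j' \<in> J" "x = (j + t) + (j' + t')"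
      by (auto simp: a_r_coset_def' set_add_def')
    then have "j + j' \<in> J" "x = (j + j') + (t + t')"
      by (auto simp: J_def intro: left_ideal2_add)
    then show "x \<in> J +>\<^bsub>type_ring\<^esub> (t + t')"
      by (auto simp: a_r_coset_def')
  qed
  show "J +>\<^bsub>type_ring\<^esub> (t + t') \<subseteq> (J +>\<^bsub>type_ring\<^esub> t) <+>\<^bsub>type_ring\<^esub> (J +>\<^bsub>type_ring\<^esub> t')"
  proof
    fix x
    assume "x \<in> J +>\<^bsub>type_ring\<^esub> (t + t')"
    then obtain j where j: "j \<in> J" "x = (j + t) + (0 + t')"
      by (auto simp: a_r_coset_def' add.assoc)
    moreover have "0 \<in> J" by (simp add: J_def)
    ultimately show "x \<in> (J +>\<^bsub>type_ring\<^esub> t) <+>\<^bsub>type_ring\<^esub> (J +>\<^bsub>type_ring\<^esub> t')"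
      unfolding a_r_coset_def' set_add_def' by fastforce
  qed
qed

lemma J_coset_act: "coset_act J r (J +>\<^bsub>type_ring\<^esub> t) = J +>\<^bsub>type_ring\<^esub> (r * t)"
proof
  show "coset_act J r (J +>\<^bsub>type_ring\<^esub> t) \<subseteq> J +>\<^bsub>type_ring\<^esub> (r * t)"
  proof
    fix x
    assume "x \<in> coset_act J r (J +>\<^bsub>type_ring\<^esub> t)"
    then obtain i j where "i \<in> J" "j \<in> J" "x = i + r * (j + t)"
      by (auto simp: coset_act_def a_r_coset_def' set_add_def' l_coset_def)
    then have "i + r * j \<in> J" "x = (i + r * j) + r * t"
      by (auto simp: J_def algebra_simps intro: left_ideal2_add left_ideal2_mult)
    then show "x \<in> J +>\<^bsub>type_ring\<^esub> (r * t)"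
      by (auto simp: a_r_coset_def')
  qed
  show "J +>\<^bsub>type_ring\<^esub> (r * t) \<subseteq> coset_act J r (J +>\<^bsub>type_ring\<^esub> t)"
  proof
    fix x
    assume "x \<in> J +>\<^bsub>type_ring\<^esub> (r * t)"
    then obtain j where "j \<in> J" "x = j + r * (0 + t)"
      by (auto simp: a_r_coset_def')
    moreover have "0 \<in> J" by (simp add: J_def)
    ultimately show "x \<in> coset_act J r (J +>\<^bsub>type_ring\<^esub> t)"
      unfolding coset_act_def a_r_coset_def' set_add_def' l_coset_def type_ring_simps by blast
  qed
qed

lemma coset_in_H0_dR_iff:
  "J +>\<^bsub>type_ring\<^esub> t \<in> H0_dR J W \<longleftrightarrow> J +>\<^bsub>type_ring\<^esub> t \<in> W \<and> horizontal t"
proof -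
  have "J +>\<^bsub>type_ring\<^esub> u = J \<longleftrightarrow> u \<in> J" for u
    using J_coset_eq[of u 0] by (simp add: J_coset_zero)
  then show ?thesis
    by (auto simp: H0_dR_def J_coset_act horizontal_def forall_2)
qed

lemma H0_dR_Q: "H0_dR J (Q_carrier J) = (\<lambda>t. J +>\<^bsub>type_ring\<^esub> t) ` {t. horizontal t}"
proof -
  have "H0_dR J (Q_carrier J) \<subseteq> Q_carrier J" by (auto simp: H0_dR_def)
  moreover have "Q_carrier J = range (\<lambda>t. J +>\<^bsub>type_ring\<^esub> t)"
    by (auto simp: Q_carrier_def A_RCOSETS_def')
  ultimately show ?thesis
    by (auto simp: coset_in_H0_dR_iff)
qed

lemma H0_dR_Q_degree:
  "H0_dR J (Q_degree J p) = (\<lambda>t. J +>\<^bsub>type_ring\<^esub> t) ` {t. horizontal t \<and> homogeneous p t}"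
proof
  show "H0_dR J (Q_degree J p) \<subseteq> (\<lambda>t. J +>\<^bsub>type_ring\<^esub> t) ` {t. horizontal t \<and> homogeneous p t}"
  proof
    fix w
    assume w: "w \<in> H0_dR J (Q_degree J p)"
    then obtain t where "w = J +>\<^bsub>type_ring\<^esub> t" "homogeneous p t"
      by (auto simp: H0_dR_def Q_degree_def)
    then show "w \<in> (\<lambda>t. J +>\<^bsub>type_ring\<^esub> t) ` {t. horizontal t \<and> homogeneous p t}"
      using w by (auto simp: coset_in_H0_dR_iff)
  qed
qed (auto simp: coset_in_H0_dR_iff Q_degree_def)

text \<open>
  The symbol at \<open>a = 0\<close>, as an element of the symmetric algebra. On horizontal operators it
  induces the inverse of the isomorphism: it is defined on representatives, linear over \<open>U\<close>, and
  it preserves the degree in \<open>T\<close>.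
\<close>

definition constant_symbol :: "'f weyl_T \<Rightarrow> ((2, 'f) mpoly, (2, 'f) mpoly) mpoly set" where
  "constant_symbol t = present (tsymbol (\<lambda>_. 0) t)"

lemma constant_symbol_eq_iff:
  assumes "horizontal t" "horizontal t'"
  shows "constant_symbol t = constant_symbol t' \<longleftrightarrow> J +>\<^bsub>type_ring\<^esub> t = J +>\<^bsub>type_ring\<^esub> t'"
proof -
  have "horizontal (t - t')"
    using assms by (auto simp: horizontal_def right_diff_distrib J_def intro: left_ideal2_diff)
  then show ?thesis
    by (simp add: constant_symbol_def present_eq_iff J_coset_eq horizontal_in_J_iff tsymbol_diff)
qed

lemma constant_symbol_rees:
  assumes "horizontal t"
  shows "rees_eval (tsymbol (\<lambda>_. 0) t) = 0"
  using horizontal_torsion[OF assms] torsion_rees_eval_zero by blast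

lemma constant_symbol_surj:
  assumes "rees_eval s = 0"
  obtains t where "horizontal t" "constant_symbol t = present s" "\<And>p. homogeneous p s \<Longrightarrow> homogeneous p t"
proof -
  have "\<exists>n. mconst (mvar i) ^ n * s \<in> G" for i
    using assms by (simp add: rees_eval_zero_iff)
  then obtain t where t: "horizontal t" "tsymbol (\<lambda>_. 0) t - s \<in> G"
    "\<And>p. homogeneous p s \<Longrightarrow> homogeneous p t"
    using horizontal_lift[of s] by blast
  then have "constant_symbol t = present s"
    by (simp add: constant_symbol_def present_eq_iff)
  then show ?thesis
    using that t(1,3) by blast
qed

lemma mconst_map_wconst_commute:
  "mconst u * Poly_Mapping.map wconst q = Poly_Mapping.map wconst q * mconst u"
proof (induction q rule: poly_mapping_additive_induct)
  case (single k c)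
  show ?case
    by (simp add: mconst_def mult_single wconst_central)
qed (simp_all add: map_zero_add wconst_add distrib_left distrib_right)

lemma horizontal_closed:
  "horizontal t \<Longrightarrow> horizontal t' \<Longrightarrow> horizontal (t + t')"
  "horizontal t \<Longrightarrow> horizontal (Poly_Mapping.map wconst u * t)"
proof -
  show "horizontal t \<Longrightarrow> horizontal t' \<Longrightarrow> horizontal (t + t')"
    by (simp add: horizontal_def distrib_left J_def left_ideal2_add)
  assume t: "horizontal t"
  have "mconst (wd i) * (Poly_Mapping.map wconst u * t) =
      Poly_Mapping.map wconst u * (mconst (wd i) * t)" for i
    unfolding mult.assoc[symmetric] mconst_map_wconst_commute ..
  then show "horizontal (Poly_Mapping.map wconst u * t)"
    using t by (simp add: horizontal_def J_def left_ideal2_mult)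
qed

text \<open>
  By \<open>constant_symbol_eq_iff\<close> and \<open>constant_symbol_surj\<close> the constant symbol is a bijection from
  horizontal classes to the kernel. The isomorphism sends an element of the kernel to the class
  of any horizontal operator with that constant symbol.
\<close>

theorem kernel_iso_H0_dR:
  obtains h where "h \<in> module_iso type_ring (K_module f I) (H0_dR_module J)"
    "\<And>p. h ` K_degree f I p = H0_dR J (Q_degree J p)"
proof -
  define h where "h X = J +>\<^bsub>type_ring\<^esub> (SOME t. horizontal t \<and> constant_symbol t = X)" for X
  have h: "h (constant_symbol t) = J +>\<^bsub>type_ring\<^esub> t" if "horizontal t" for t
  proof -
    let ?t = "SOME t'. horizontal t' \<and> constant_symbol t' = constant_symbol t"
    have "horizontal ?t \<and> constant_symbol ?t = constant_symbol t"
      by (rule someI[of _ t]) (simp add: that)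
    then show ?thesis
      using constant_symbol_eq_iff[OF _ that, of ?t] by (simp add: h_def)
  qed
  have kernel: "Rees_kernel I = constant_symbol ` {t. horizontal t}"
  proof -
    have "\<exists>t. horizontal t \<and> present s = constant_symbol t" if "rees_eval s = 0" for s
      by (rule constant_symbol_surj[OF that]) auto
    then show ?thesis
      using constant_symbol_rees unfolding Rees_kernel_eq by (fastforce simp: constant_symbol_def)
  qed
  have deg: "K_degree f I p = constant_symbol ` {t. horizontal t \<and> homogeneous p t}" for p
  proof -
    have "\<exists>t. horizontal t \<and> homogeneous p t \<and> present s = constant_symbol t"
      if "rees_eval s = 0" "homogeneous p s" for s
      by (rule constant_symbol_surj[OF that(1)]) (use that(2) in auto)
    then show ?thesis
      using constant_symbol_rees homogeneous_map unfolding K_degree_eq by (fastforce simp: constant_symbol_def)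
  qed
  have "h \<in> module_iso type_ring (K_module f I) (H0_dR_module J)"
    unfolding module_iso_def
  proof (intro CollectI conjI ballI)
    have "inj_on h (Rees_kernel I)"
      by (auto simp: inj_on_def kernel h constant_symbol_eq_iff)
    moreover have "h ` Rees_kernel I = H0_dR J (Q_carrier J)"
      by (simp add: kernel H0_dR_Q image_image h cong: image_cong_simp)
    ultimately show "bij_betw h (carrier (K_module f I)) (carrier (H0_dR_module J))"
      by (simp add: bij_betw_def K_module_def H0_dR_module_def)
  next
    fix X Y
    assume "X \<in> carrier (K_module f I)" "Y \<in> carrier (K_module f I)"
    then obtain t u where "X = constant_symbol t" "horizontal t" "Y = constant_symbol u" "horizontal u"
      by (auto simp: K_module_def kernel)
    moreover have "constant_symbol t \<oplus>\<^bsub>Sym I\<^esub> constant_symbol u = constant_symbol (t + u)"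
      by (simp add: constant_symbol_def Sym_simps tsymbol_add)
    ultimately show "h (X \<oplus>\<^bsub>K_module f I\<^esub> Y) = h X \<oplus>\<^bsub>H0_dR_module J\<^esub> h Y"
      by (simp add: K_module_def H0_dR_module_def h horizontal_closed J_coset_add)
  next
    fix u X
    assume "X \<in> carrier (K_module f I)"
    then obtain t where "X = constant_symbol t" "horizontal t"
      by (auto simp: K_module_def kernel)
    moreover have "present (Poly_Mapping.map mconst u) \<otimes>\<^bsub>Sym I\<^esub> constant_symbol t =
        constant_symbol (Poly_Mapping.map wconst u * t)"
      by (simp add: constant_symbol_def Sym_simps tsymbol_wconst_mult)
    ultimately show "h (u \<odot>\<^bsub>K_module f I\<^esub> X) = u \<odot>\<^bsub>H0_dR_module J\<^esub> h X"
      by (simp add: K_module_def H0_dR_module_def h horizontal_closed J_coset_act)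
  qed
  moreover have "h ` K_degree f I p = H0_dR J (Q_degree J p)" for p
    unfolding deg H0_dR_Q_degree image_image by (rule image_cong) (simp_all add: h)
  ultimately show ?thesis
    by (rule that)
qed

lemma K_degree_subset: "K_degree f I p \<subseteq> carrier (K_module f I)"
  by (auto simp: K_degree_eq K_module_def Rees_kernel_eq)

end

lemma module_iso_subspace:
  assumes h: "h \<in> module_iso type_ring M N" and W: "W \<subseteq> carrier M" and image: "h ` W = W'"
  shows "h \<in> module_iso type_ring (subspace_module M W) (subspace_module N W')"
proof -
  have "bij_betw h W W'"
    using h W image by (auto simp: module_iso_def intro: bij_betw_subset)
  then show ?thesis
    using h W by (auto simp: module_iso_def subspace_module_def subset_iff)
qed

section \<open>From a Hilbert--Burch resolution to the isomorphism\<close>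

lemma genideal_three:
  fixes f :: "'r::comm_ring_1 ^ 3"
  shows "a \<in> Idl\<^bsub>type_ring\<^esub> {f $ 1, f $ 2, f $ 3} \<longleftrightarrow> (\<exists>c. a = (\<Sum>i\<in>UNIV. c $ i * f $ i))"
proof
  interpret R: cring "type_ring :: 'r ring" by (rule cring_type_ring)
  let ?I = "Idl\<^bsub>type_ring\<^esub> {f $ 1, f $ 2, f $ 3}"
  let ?K = "{a. \<exists>c. a = (\<Sum>i\<in>UNIV. c $ i * f $ i)}"
  have mult: "r * a \<in> ?K" if "a \<in> ?K" for r a
  proof -
    obtain c where "a = (\<Sum>i\<in>UNIV. c $ i * f $ i)"
      using \<open>a \<in> ?K\<close> by blast
    then have "r * a = (\<Sum>i\<in>UNIV. (\<chi> i. r * c $ i) $ i * f $ i)"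
      by (simp add: sum_distrib_left mult.assoc)
    then show ?thesis by blast
  qed
  have "ideal ?K type_ring"
  proof (rule ideal_type_ringI)
    have "0 = (\<Sum>i\<in>UNIV. (0 :: 'r ^ 3) $ i * f $ i)" by simp
    then show "0 \<in> ?K" by blast
    show "a + b \<in> ?K" if ab: "a \<in> ?K" "b \<in> ?K" for a b
    proof -
      obtain c e where "a = (\<Sum>i\<in>UNIV. c $ i * f $ i)" "b = (\<Sum>i\<in>UNIV. e $ i * f $ i)"
        using ab by blast
      then have "a + b = (\<Sum>i\<in>UNIV. (c + e) $ i * f $ i)"
        by (simp add: distrib_right sum.distrib)
      then show ?thesis by blast
    qed
    show "a * r \<in> ?K" if "a \<in> ?K" for a r
      using mult[OF that, of r] by (simp add: mult.commute)
  qed (rule mult)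
  moreover have "f $ i \<in> ?K" for i
    by (intro CollectI exI[of _ "axis i 1"]) (simp add: sum_axis)
  ultimately have "?I \<subseteq> ?K"
    by (intro R.genideal_minimal) auto
  then show "a \<in> ?I \<Longrightarrow> \<exists>c. a = (\<Sum>i\<in>UNIV. c $ i * f $ i)"
    by blast
  have ideal: "ideal ?I type_ring"
    by (rule R.genideal_ideal) simp
  have self: "{f $ 1, f $ 2, f $ 3} \<subseteq> ?I"
    by (rule R.genideal_self) simp
  have "r * b \<in> ?I" if "b \<in> {f $ 1, f $ 2, f $ 3}" for r b
    using ideal.I_l_closed[OF ideal, of b r] self that by auto
  then have "c $ 1 * f $ 1 + c $ 2 * f $ 2 + c $ 3 * f $ 3 \<in> ?I" for c :: "'r ^ 3"
    using additive_subgroup.a_closed[OF ideal.axioms(1)[OF ideal]] by simp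
  then show "\<exists>c. a = (\<Sum>i\<in>UNIV. c $ i * f $ i) \<Longrightarrow> a \<in> ?I"
    by (auto simp: sum_3)
qed

lemma hilbert_burch_graded_syzygy_module:
  fixes f :: "(2, 'f::field_char_0) mpoly ^ 3"
  assumes hb: "hilbert_burch f d \<mu> \<phi>" and deg: "\<And>i. homogeneous d (f $ i)"
    and ord: "0 \<le> \<mu>" "\<mu> \<le> d" and I: "I = Idl\<^bsub>type_ring\<^esub> {f $ 1, f $ 2, f $ 3}"
  shows "graded_syzygy_module (sym_equation \<phi> 1) (sym_equation \<phi> 2) f I d"
proof
  fix c
  show I_iff: "a \<in> I \<longleftrightarrow> (\<exists>c. a = (\<Sum>i\<in>UNIV. c $ i * f $ i))" for a
    unfolding I by (rule genideal_three)
  have g: "sym_equation \<phi> j = linear_form (\<chi> i. \<phi> $ i $ j)" for j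
    by (simp add: sym_equation_def linear_form_def mult.commute)
  have range: "range (\<lambda>c. \<phi> *v c) = {a. (\<Sum>i\<in>UNIV. a $ i * f $ i) = 0}"
    using hb by (simp add: hilbert_burch_def)
  show "linear_form c \<in> linear_forms.G (sym_equation \<phi> 1) (sym_equation \<phi> 2)"
    if "(\<Sum>i\<in>UNIV. c $ i * f $ i) = 0"
  proof -
    have "c \<in> range (\<lambda>c. \<phi> *v c)"
      using that unfolding range by simp
    then obtain e where "c = \<phi> *v e" by blast
    then have "linear_form c = mconst (e $ 1) * sym_equation \<phi> 1 + mconst (e $ 2) * sym_equation \<phi> 2"
      by (simp add: g linear_form_def matrix_vector_mult_def UNIV_2 sum_3 algebra_simps)
    then show ?thesis
      unfolding linear_forms.G_def left_ideal2_def by blast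
  qed
  show "\<exists>c. g = linear_form c \<and> (\<Sum>i\<in>UNIV. c $ i * f $ i) = 0"
    if "g \<in> {sym_equation \<phi> 1, sym_equation \<phi> 2}" for g
  proof -
    have "\<phi> *v axis j 1 = (\<chi> i. \<phi> $ i $ j)" for j
      by (simp add: vec_eq_iff matrix_vector_mult_def axis_def if_distrib[of "(*) _"] cong: if_cong)
    then have "(\<chi> i. \<phi> $ i $ j) \<in> range (\<lambda>c. \<phi> *v c)" for j
      by (metis rangeI)
    then have "(\<Sum>i\<in>UNIV. (\<chi> i. \<phi> $ i $ j) $ i * f $ i) = 0" for j
      unfolding range by simp
    then show ?thesis
      using that g by blast
  qed
  show "homogeneous d (f $ i)" for i by (rule deg)
  show "\<exists>n. mvar i ^ n \<in> I" for i
  proof -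
    have "homogeneous (2 * d) (mvar i ^ nat (2 * d) :: (2, 'f) mpoly)"
      using ord by (simp add: mvar_power homogeneous_def)
    from hilbert_burch_generates[OF hb deg ord this] show ?thesis
      unfolding I_iff by blast
  qed
qed

theorem theorem3:
  fixes I :: "(2, 'f::field_char_0) mpoly set"
    and f :: "(2, 'f) mpoly ^ 3"
    and \<phi> :: "(2, 'f) mpoly ^ 2 ^ 3"
    and d \<mu> :: int
    and J :: "'f weyl_T set"
  assumes height: "ideal_height type_ring I = 2"
    and generated: "I = Idl\<^bsub>type_ring\<^esub> {f $ 1, f $ 2, f $ 3}"
    and minimal: "\<And>i. f $ i \<notin> Idl\<^bsub>type_ring\<^esub> ((\<lambda>j. f $ j) ` (- {i}))"
    and degree: "\<And>i. homogeneous d (f $ i)"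
    and resolution: "hilbert_burch f d \<mu> \<phi>"
    and ordered: "0 < \<mu>" "\<mu> \<le> d - \<mu>"
    and J: "J = left_ideal2 (L_operator \<phi> 1) (L_operator \<phi> 2)"
  shows "(\<exists>h \<in> module_iso type_ring (K_module f I) (H0_dR_module J).
            \<forall>p::int. h ` K_degree f I p = H0_dR J (Q_degree J p)) \<and>
         (\<forall>p::int. \<exists>h. h \<in> module_iso type_ring
            (subspace_module (K_module f I) (K_degree f I p))
            (subspace_module (H0_dR_module J) (H0_dR J (Q_degree J p))))"
proof -
  interpret S: graded_syzygy_module "sym_equation \<phi> 1" "sym_equation \<phi> 2" f I d
    using ordered by (intro hilbert_burch_graded_syzygy_module[OF resolution degree _ _ generated]) auto
  have "J = S.J"
    by (simp add: J S.J_def L_operator_def fourier_weyl_T_of_poly)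
  then obtain h where h: "h \<in> module_iso type_ring (K_module f I) (H0_dR_module J)"
    and hp: "\<And>p. h ` K_degree f I p = H0_dR J (Q_degree J p)"
    using S.kernel_iso_H0_dR by blast
  have "h \<in> module_iso type_ring (subspace_module (K_module f I) (K_degree f I p))
      (subspace_module (H0_dR_module J) (H0_dR J (Q_degree J p)))" for p
    by (rule module_iso_subspace[OF h S.K_degree_subset hp])
  with h hp show ?thesis
    by blast
qed

end
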